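(* Let $M$ be an $n$-dimensional Frobenius manifold. Consider, for the unknowns $v^\alpha,\sigma_{\alpha,k},f_{\alpha,p},\Phi^n_{\alpha,p}$, the flows \[\frac{\partial v^\alpha}{\partial t^{\beta,p}}=\eta^{\alpha\gamma}(\partial_\lambda\partial_\gamma h_{\beta,p+1})v^{\lambda,1},\qquad \frac{\partial \sigma_{\alpha,k}}{\partial t^{\beta,p}}=\eta^{\gamma\epsilon}(\partial_\alpha\partial_\epsilon h_{\beta,p+1})\sigma_{\gamma,k}^1,\] \[\frac{\partial v^\alpha}{\partial\tau_m}=\eta^{\alpha\beta}\sigma_{\beta,m}^1,\qquad \frac{\partial\sigma_{\alpha,k}}{\partial\tau_m}=-\frac{\partial\sigma_{\alpha,m}}{\partial\tau_k}=\Gamma_\alpha^{\gamma\beta}\sum_{i=0}^{m-k-1}\sigma_{\beta,k+i}\sigma_{\gamma,m-i-1}^1\quad(0\le k\le m),\] together with \[\frac{\partial f_{\alpha,p}}{\partial t^{\beta,q}}=\Omega_{\alpha,p;\beta,q},\qquad \frac{\partial f_{\alpha,p}}{\partial\tau_n}=\Phi_{\alpha,p}^n,\qquad \frac{\partial\Phi_{\alpha,p}^n}{\partial t^{\beta,q}}=\frac{\partial\Omega_{\alpha,p;\beta,q}}{\partial\tau_n},\qquad \frac{\partial\Phi^n_{\alpha,p}}{\partial\tau_k}=\Delta^{k,n}_{\alpha,p}.\] Then these equations define a super tau-cover of the principal hierarchy of $M$; that is, all the flows $\partial/\partial t^{\beta,q}$, $\partial/\partial\tau_k$ mutually commute in the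 graded sense (the odd flows $\partial/\partial\tau_k$ anticommute with each other, all other pairs commute) on all the unknowns.
   Context: Summation over repeated upper and lower Greek indices is assumed. Frobenius manifold data. $M$ is an $n$-dimensional (complex) Frobenius manifold with flat metric $\eta$, multiplication $\cdot$ on $TM$, Euler vector field $E$ and charge $d$; $v^1,\dots,v^n$ are flat coordinates of $\eta$, $\partial_\alpha=\partial/\partial v^\alpha$, and $\partial_1$ is the unit vector field. With $F$ the potential, $\eta_{\alpha\beta}=\partial_1\partial_\alpha\partial_\beta F$ (constant, nondegenerate), $(\eta^{\alpha\beta})=(\eta_{\alpha\beta})^{-1}$, $c_{\alpha\beta}^\gamma=\eta^{\gamma\zeta}\partial_\zeta\partial_\alpha\partial_\beta F$, $c^{\alpha\beta}_\gamma=\eta^{\alpha\zeta}c_{\zeta\gamma}^\beta$. The Euler field is $E=E^\alpha\partial_\alpha=\sum_\alpha\big((1-\tfrac d2-\mu_\alpha)v^\alpha+r_\alpha\big)\partial_\alpha$, with $\mu=\mathrm{diag}(\mu_1,\dots,\mu_n)$, $\mu_1=-d/2$, $(\mu_\alpha+\mu_\beta)\eta_{\alpha\beta}=0$, $\mathcal L_E\eta_{\alpha\beta}=(2-d)\eta_{\alpha\beta}$, $\mathcal L_Ec^\gamma_{\alpha\beta}=c^\gamma_{\alpha\beta}$. The intersection form is $g^{\alpha\beta}=E^\epsilon c^{\alpha\beta}_\epsilon$, with contravariant Christoffel symbols $\Gamma^{\alpha\beta}_\gamma=(\tfrac12-\mu_\beta)c^{\alpha\beta}_\gamma$ (no sum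 over $\beta$). The functions $h_{\alpha,p}(v)$, $p\ge0$, are the coefficients of $h_\alpha(v,z)=\sum_{p\ge 0}h_{\alpha,p}(v)z^p$, where $(h_1,\dots,h_n)z^\mu z^R$ is a system of flat coordinates of the deformed flat connection of $M$; they satisfy $\partial_\alpha\partial_\beta h_{\gamma,p+1}=c^\lambda_{\alpha\beta}\partial_\lambda h_{\gamma,p}$, $h_{\alpha,0}=\eta_{\alpha\gamma}v^\gamma$, $\partial_1h_{\alpha,p+1}=h_{\alpha,p}$, $E(\partial_\beta h_{\alpha,p})=(p+\mu_\alpha+\mu_\beta)\partial_\beta h_{\alpha,p}+\sum_{k=1}^p(R_k)^\gamma_\alpha\partial_\beta h_{\gamma,p-k}$, and $\langle\nabla h_\alpha(v,z),\nabla h_\beta(v,-z)\rangle=\eta_{\alpha\beta}$, where $R=R_1+\dots+R_m$ is the constant matrix of isomonodromy data at $z=0$, $[\mu,R_k]=kR_k$. The functions $\Omega_{\alpha,p;\beta,q}(v)$ are defined by \[\sum_{p,q\ge0}\Omega_{\alpha,p;\beta,q}(v)z_1^pz_2^q=\frac{\langle\nabla h_\alpha(v,z_1),\nabla h_\beta(v,z_2)\rangle-\eta_{\alpha\beta}}{z_1+z_2};\] in particular $\Omega_{\alpha,p;1,0}=h_{\alpha,p}$, $\Omega_{\alpha,p;\beta,0}=\partial_\beta h_{\alpha,p+1}$. Differential ring. Take even variables $v^{\alpha,s}$ ($s\ge0$, $v^{\alpha,0}=v^\alpha$) and odd variables $\sigma_{\alpha,k}^s$ ($k,s\ge 0$;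 $\sigma_{\alpha,k}^0=\sigma_{\alpha,k}$), supercommuting, with even derivation $\partial=\partial_x$ (also denoted by a prime), $\partial v^{\alpha,s}=v^{\alpha,s+1}$, $\partial\sigma_{\alpha,k}^s=\sigma_{\alpha,k}^{s+1}$, subject to (and to all $\partial$-derivatives of) \[\eta^{\alpha\beta}\sigma_{\beta,k+1}^1=g^{\alpha\beta}\sigma_{\beta,k}^1+\Gamma_\gamma^{\alpha\beta}v^{\gamma,1}\sigma_{\beta,k},\qquad k\ge0.\] In addition take even variables $f_{\alpha,p}$ and odd variables $\Phi_{\alpha,p}^n$ ($p,n\ge0$) with $f_{\alpha,p}'=h_{\alpha,p}$, $(\Phi^n_{\alpha,p})'=\partial_\beta h_{\alpha,p}\,\eta^{\beta\gamma}\sigma^1_{\gamma,n}$ $(=\partial h_{\alpha,p}/\partial\tau_n)$ and $\Phi^n_{\alpha,0}=\sigma_{\alpha,n}$. Convention: there are no nonzero odd constants, i.e. an element of positive super degree annihilated by $\partial$ is zero. Further, \[\Delta_{\alpha,p}^{k,n}=-\Delta_{\alpha,p}^{n,k}=\eta^{\gamma\lambda}\,\partial_\lambda h_{\alpha,p}\,\Gamma_\gamma^{\delta\xi}\sum_{i=0}^{k-n-1}\sigma_{\xi,n+i}\,\sigma_{\delta,k-i-1}^1,\qquad k\ge n.\] Flows: $\partial/\partial t^{\beta,q}$ are even derivations and $\partial/\partial\tau_k$ odd derivations (signed Leibniz rule), commuting with $\partial$; $\partial/\partial t^{1,0}$ is identified with $\partial$. An empty sum is $0$. (The superscript $n$ in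 $\Phi^n$, $\tau_n$ is an arbitrary nonnegative integer, unrelated to $\dim M$.) The principal hierarchy consists of the flows $\partial v^\alpha/\partial t^{\beta,p}$. *)

theory Defs
  imports
    "HOL-Analysis.Analysis"
    "HOL-Computational_Algebra.Formal_Power_Series"
    "HOL-Library.Poly_Mapping"
    "HOL-Library.Function_Algebras"
begin

section \<open>Holomorphic functions of several variables\<close>

type_synonym 'n scalar_fn = "complex^'n \<Rightarrow> complex"

definition pd :: "'n::finite \<Rightarrow> 'n scalar_fn \<Rightarrow> 'n scalar_fn" where
  "pd i f x = deriv (\<lambda>w. f (x + axis i w)) 0"

definition complex_differentiable_at :: "'n::finite scalar_fn \<Rightarrow> complex^'n \<Rightarrow> bool" where
  "complex_differentiable_at f x \<longleftrightarrow>
     (\<exists>f'. (f has_derivative f') (at x) \<and> (\<forall>c y. f' (c *s y) = c * f' y))"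

text \<open>On an open set, being holomorphic is the same as being infinitely often complex
  differentiable; the definition uses the latter form. Functions are total, so only their values
  on the chart matter.\<close>

definition holo_on :: "(complex^'n::finite) set \<Rightarrow> 'n scalar_fn \<Rightarrow> bool" where
  "holo_on D f \<longleftrightarrow> (\<forall>is. \<forall>x\<in>D. complex_differentiable_at (foldr pd is f) x)"


section \<open>Frobenius manifolds in a chart of flat coordinates\<close>

text \<open>The flat coordinates are indexed by \<open>'n\<close>, and \<open>unit_idx\<close> is the index written 1 in the
  usual notation. \<open>eshift\<close> is the constant part $r_\alpha$ of the Euler vector field,
  \<open>Rmat k $ \<gamma> $ \<alpha>\<close> is $(R_k)^\gamma_\alpha$, \<open>hfun \<alpha> p\<close> is $h_{\alpha,p}$ and
  \<open>Omega \<alpha> p \<beta> q\<close> is $\Omega_{\alpha,p;\beta,q}$.\<close>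

record ('n::finite) frobenius_data =
  chart :: "(complex^'n) set"
  potential :: "'n scalar_fn"
  metric :: "complex^'n^'n"
  unit_idx :: 'n
  charge :: complex
  spec :: "'n \<Rightarrow> complex"
  eshift :: "'n \<Rightarrow> complex"
  Rmat :: "nat \<Rightarrow> complex^'n^'n"
  hfun :: "'n \<Rightarrow> nat \<Rightarrow> 'n scalar_fn"
  Omega :: "'n \<Rightarrow> nat \<Rightarrow> 'n \<Rightarrow> nat \<Rightarrow> 'n scalar_fn"

abbreviation eta :: "'n::finite frobenius_data \<Rightarrow> 'n \<Rightarrow> 'n \<Rightarrow> complex" where
  "eta M \<alpha> \<beta> \<equiv> metric M $ \<alpha> $ \<beta>"

abbreviation etaI :: "'n::finite frobenius_data \<Rightarrow> 'n \<Rightarrow> 'n \<Rightarrow> complex" where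
  "etaI M \<alpha> \<beta> \<equiv> matrix_inv (metric M) $ \<alpha> $ \<beta>"

text \<open>\<open>cmul M \<gamma> \<alpha> \<beta>\<close> is $c^\gamma_{\alpha\beta}$, \<open>cup M \<alpha> \<beta> \<gamma>\<close> is $c^{\alpha\beta}_\gamma$,
  \<open>gup M \<alpha> \<beta>\<close> is $g^{\alpha\beta}$, \<open>Gam M \<alpha> \<beta> \<gamma>\<close> is $\Gamma^{\alpha\beta}_\gamma$.\<close>

definition cmul :: "'n::finite frobenius_data \<Rightarrow> 'n \<Rightarrow> 'n \<Rightarrow> 'n \<Rightarrow> 'n scalar_fn" where
  "cmul M \<gamma> \<alpha> \<beta> x = (\<Sum>\<zeta>\<in>UNIV. etaI M \<gamma> \<zeta> * pd \<zeta> (pd \<alpha> (pd \<beta> (potential M))) x)"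

definition cup :: "'n::finite frobenius_data \<Rightarrow> 'n \<Rightarrow> 'n \<Rightarrow> 'n \<Rightarrow> 'n scalar_fn" where
  "cup M \<alpha> \<beta> \<gamma> x = (\<Sum>\<zeta>\<in>UNIV. etaI M \<alpha> \<zeta> * cmul M \<beta> \<zeta> \<gamma> x)"

definition euler :: "'n::finite frobenius_data \<Rightarrow> 'n \<Rightarrow> 'n scalar_fn" where
  "euler M \<alpha> x = (1 - charge M / 2 - spec M \<alpha>) * x $ \<alpha> + eshift M \<alpha>"

definition gup :: "'n::finite frobenius_data \<Rightarrow> 'n \<Rightarrow> 'n \<Rightarrow> 'n scalar_fn" where
  "gup M \<alpha> \<beta> x = (\<Sum>\<epsilon>\<in>UNIV. euler M \<epsilon> x * cup M \<alpha> \<beta> \<epsilon> x)"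

definition Gam :: "'n::finite frobenius_data \<Rightarrow> 'n \<Rightarrow> 'n \<Rightarrow> 'n \<Rightarrow> 'n scalar_fn" where
  "Gam M \<alpha> \<beta> \<gamma> x = (1/2 - spec M \<beta>) * cup M \<alpha> \<beta> \<gamma> x"

definition lie_metric :: "'n::finite frobenius_data \<Rightarrow> 'n \<Rightarrow> 'n \<Rightarrow> 'n scalar_fn" where
  "lie_metric M \<alpha> \<beta> x =
     (\<Sum>\<epsilon>\<in>UNIV. euler M \<epsilon> x * pd \<epsilon> (\<lambda>_. eta M \<alpha> \<beta>) x
       + pd \<alpha> (euler M \<epsilon>) x * eta M \<epsilon> \<beta> + pd \<beta> (euler M \<epsilon>) x * eta M \<alpha> \<epsilon>)"

definition lie_mult :: "'n::finite frobenius_data \<Rightarrow> 'n \<Rightarrow> 'n \<Rightarrow> 'n \<Rightarrow> 'n scalar_fn" where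
  "lie_mult M \<gamma> \<alpha> \<beta> x =
     (\<Sum>\<epsilon>\<in>UNIV. euler M \<epsilon> x * pd \<epsilon> (cmul M \<gamma> \<alpha> \<beta>) x
       - pd \<epsilon> (euler M \<gamma>) x * cmul M \<epsilon> \<alpha> \<beta> x
       + pd \<alpha> (euler M \<epsilon>) x * cmul M \<gamma> \<epsilon> \<beta> x
       + pd \<beta> (euler M \<epsilon>) x * cmul M \<gamma> \<alpha> \<epsilon> x)"

definition frobenius_manifold :: "'n::finite frobenius_data \<Rightarrow> bool" where
  "frobenius_manifold M \<longleftrightarrow>
     open (chart M) \<and> chart M \<noteq> {} \<and> holo_on (chart M) (potential M) \<and>
     (\<forall>x\<in>chart M. \<forall>\<alpha> \<beta>. pd (unit_idx M) (pd \<alpha> (pd \<beta> (potential M))) x = eta M \<alpha> \<beta>) \<and>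
     invertible (metric M) \<and>
     (\<forall>x\<in>chart M. \<forall>\<alpha> \<beta> \<gamma> \<epsilon>.
        (\<Sum>\<kappa>\<in>UNIV. cmul M \<kappa> \<alpha> \<beta> x * cmul M \<epsilon> \<kappa> \<gamma> x)
        = (\<Sum>\<kappa>\<in>UNIV. cmul M \<kappa> \<beta> \<gamma> x * cmul M \<epsilon> \<alpha> \<kappa> x)) \<and>
     spec M (unit_idx M) = - charge M / 2 \<and>
     (\<forall>\<alpha> \<beta>. (spec M \<alpha> + spec M \<beta>) * eta M \<alpha> \<beta> = 0) \<and>
     (\<forall>x\<in>chart M. \<forall>\<alpha> \<beta>. lie_metric M \<alpha> \<beta> x = (2 - charge M) * eta M \<alpha> \<beta>) \<and>
     (\<forall>x\<in>chart M. \<forall>\<alpha> \<beta> \<gamma>. lie_mult M \<gamma> \<alpha> \<beta> x = cmul M \<gamma> \<alpha> \<beta> x)"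

text \<open>The functions $h_{\alpha,p}$ and the isomonodromy data $R = R_1 + \dots + R_m$. The last
  clause is $\langle\nabla h_\alpha(v,z),\nabla h_\beta(v,-z)\rangle = \eta_{\alpha\beta}$ as an
  identity of formal power series in $z$.\<close>

definition calibration :: "'n::finite frobenius_data \<Rightarrow> bool" where
  "calibration M \<longleftrightarrow>
     (\<forall>\<alpha> p. holo_on (chart M) (hfun M \<alpha> p)) \<and>
     (\<exists>m. \<forall>k>m. Rmat M k = 0) \<and>
     (\<forall>k\<ge>1. \<forall>\<gamma> \<alpha>. (spec M \<gamma> - spec M \<alpha>) * Rmat M k $ \<gamma> $ \<alpha> = of_nat k * Rmat M k $ \<gamma> $ \<alpha>) \<and>
     (\<forall>x\<in>chart M. \<forall>\<alpha>. hfun M \<alpha> 0 x = (\<Sum>\<gamma>\<in>UNIV. eta M \<alpha> \<gamma> * x $ \<gamma>)) \<and>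
     (\<forall>x\<in>chart M. \<forall>\<alpha> \<beta> \<gamma> p.
        pd \<alpha> (pd \<beta> (hfun M \<gamma> (Suc p))) x
        = (\<Sum>\<kappa>\<in>UNIV. cmul M \<kappa> \<alpha> \<beta> x * pd \<kappa> (hfun M \<gamma> p) x)) \<and>
     (\<forall>x\<in>chart M. \<forall>\<alpha> p. pd (unit_idx M) (hfun M \<alpha> (Suc p)) x = hfun M \<alpha> p x) \<and>
     (\<forall>x\<in>chart M. \<forall>\<alpha> \<beta> p.
        (\<Sum>\<epsilon>\<in>UNIV. euler M \<epsilon> x * pd \<epsilon> (pd \<beta> (hfun M \<alpha> p)) x)
        = (of_nat p + spec M \<alpha> + spec M \<beta>) * pd \<beta> (hfun M \<alpha> p) x
          + (\<Sum>k=1..p. \<Sum>\<gamma>\<in>UNIV. Rmat M k $ \<gamma> $ \<alpha> * pd \<beta> (hfun M \<gamma> (p - k)) x)) \<and>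
     (\<forall>x\<in>chart M. \<forall>\<alpha> \<beta>.
        (\<Sum>\<gamma>\<in>UNIV. \<Sum>\<kappa>\<in>UNIV. fps_const (etaI M \<gamma> \<kappa>)
           * Abs_fps (\<lambda>p. pd \<gamma> (hfun M \<alpha> p) x)
           * Abs_fps (\<lambda>p. (- 1) ^ p * pd \<kappa> (hfun M \<beta> p) x))
        = fps_const (eta M \<alpha> \<beta>))"

text \<open>The defining identity of $\Omega_{\alpha,p;\beta,q}$, multiplied by $z_1+z_2$, in
  $\mathbb{C}[[z_2]][[z_1]]$: here \<open>fps_X\<close> is $z_1$ and \<open>fps_const fps_X\<close> is $z_2$.\<close>

definition two_point_functions :: "'n::finite frobenius_data \<Rightarrow> bool" where
  "two_point_functions M \<longleftrightarrow>
     (\<forall>x\<in>chart M. \<forall>\<alpha> \<beta>.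
        (fps_X + fps_const fps_X) * Abs_fps (\<lambda>p. Abs_fps (\<lambda>q. Omega M \<alpha> p \<beta> q x))
        = (\<Sum>\<gamma>\<in>UNIV. \<Sum>\<kappa>\<in>UNIV. fps_const (fps_const (etaI M \<gamma> \<kappa>))
             * Abs_fps (\<lambda>p. fps_const (pd \<gamma> (hfun M \<alpha> p) x))
             * fps_const (Abs_fps (\<lambda>q. pd \<kappa> (hfun M \<beta> q) x)))
          - fps_const (fps_const (eta M \<alpha> \<beta>)))"


section \<open>The differential superalgebra\<close>

text \<open>\<open>V \<alpha> s\<close>, \<open>Sg \<alpha> k s\<close>, \<open>Ff \<alpha> p\<close>, \<open>Ph \<alpha> p n\<close> stand for $v^{\alpha,s}$,
  $\sigma_{\alpha,k}^s$, $f_{\alpha,p}$, $\Phi^n_{\alpha,p}$.\<close>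

datatype 'n gen = V 'n nat | Sg 'n nat nat | Ff 'n nat | Ph 'n nat nat

fun is_odd :: "'n gen \<Rightarrow> bool" where
  "is_odd (V _ _) = False"
| "is_odd (Sg _ _ _) = True"
| "is_odd (Ff _ _) = False"
| "is_odd (Ph _ _ _) = True"

text \<open>Words form an additively written monoid because \<^const>\<open>times\<close> on \<^type>\<open>poly_mapping\<close> is
  convolution over an additive monoid.\<close>

datatype 'g word = Word (letters: "'g list")

instantiation word :: (type) monoid_add
begin
definition "0 = Word []"
definition "u + w = Word (letters u @ letters w)"
instance by standard (auto simp: zero_word_def plus_word_def)
end

text \<open>Free associative algebra on the generators, with functions as central coefficients. The
  differential superalgebra of the super tau-cover is the quotient of the subring
  \<open>dring M\<close> (holomorphic coefficients) by the ideal \<open>relations M\<close>.\<close>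

type_synonym 'n superpoly = "'n gen word \<Rightarrow>\<^sub>0 'n scalar_fn"

definition fn :: "'n::finite scalar_fn \<Rightarrow> 'n superpoly" where
  "fn a = Poly_Mapping.single 0 a"

definition mon :: "'n gen list \<Rightarrow> 'n::finite superpoly" where
  "mon w = Poly_Mapping.single (Word w) 1"

abbreviation gen :: "'n gen \<Rightarrow> 'n::finite superpoly" where
  "gen g \<equiv> mon [g]"

definition dring :: "'n::finite frobenius_data \<Rightarrow> 'n superpoly set" where
  "dring M = {a. \<forall>w. holo_on (chart M) (Poly_Mapping.lookup a w)}"

definition super_degree :: "'n gen word \<Rightarrow> nat" where
  "super_degree w = length (filter is_odd (letters w))"

definition has_parity :: "nat \<Rightarrow> 'n::finite superpoly \<Rightarrow> bool" where
  "has_parity i a \<longleftrightarrow> (\<forall>w\<in>Poly_Mapping.keys a. even (super_degree w + i))"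

definition positive_degree :: "'n::finite superpoly \<Rightarrow> bool" where
  "positive_degree a \<longleftrightarrow> (\<forall>w\<in>Poly_Mapping.keys a. super_degree w > 0)"

text \<open>The derivation $\partial$ on generators, on words (Leibniz rule) and on all of the free
  algebra (chain rule for the coefficients).\<close>

fun dx_gen :: "'n::finite frobenius_data \<Rightarrow> 'n gen \<Rightarrow> 'n superpoly" where
  "dx_gen M (V \<alpha> s) = gen (V \<alpha> (Suc s))"
| "dx_gen M (Sg \<alpha> k s) = gen (Sg \<alpha> k (Suc s))"
| "dx_gen M (Ff \<alpha> p) = fn (hfun M \<alpha> p)"
| "dx_gen M (Ph \<alpha> p n) =
     (\<Sum>\<beta>\<in>UNIV. \<Sum>\<gamma>\<in>UNIV. fn (\<lambda>x. pd \<beta> (hfun M \<alpha> p) x * etaI M \<beta> \<gamma>) * gen (Sg \<gamma> n 1))"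

fun dx_word :: "'n::finite frobenius_data \<Rightarrow> 'n gen list \<Rightarrow> 'n superpoly" where
  "dx_word M [] = 0"
| "dx_word M (g # w) = dx_gen M g * mon w + gen g * dx_word M w"

definition dx :: "'n::finite frobenius_data \<Rightarrow> 'n superpoly \<Rightarrow> 'n superpoly" where
  "dx M a = (\<Sum>w\<in>Poly_Mapping.keys a.
     (\<Sum>\<alpha>\<in>UNIV. fn (pd \<alpha> (Poly_Mapping.lookup a w)) * gen (V \<alpha> 1)) * mon (letters w)
     + fn (Poly_Mapping.lookup a w) * dx_word M (letters w))"

text \<open>Rule \<open>no_odd_constants\<close> implements the convention that an element of positive super degree
  annihilated by $\partial$ is zero.\<close>

inductive_set relations :: "'n::finite frobenius_data \<Rightarrow> 'n superpoly set"
  for M :: "'n::finite frobenius_data" where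
  zero: "0 \<in> relations M"
| add: "a \<in> relations M \<Longrightarrow> b \<in> relations M \<Longrightarrow> a + b \<in> relations M"
| lmult: "a \<in> relations M \<Longrightarrow> b \<in> dring M \<Longrightarrow> b * a \<in> relations M"
| rmult: "a \<in> relations M \<Longrightarrow> b \<in> dring M \<Longrightarrow> a * b \<in> relations M"
| dx_closed: "a \<in> relations M \<Longrightarrow> dx M a \<in> relations M"
| chart_fn: "holo_on (chart M) a \<Longrightarrow> (\<And>x. x \<in> chart M \<Longrightarrow> a x = 0) \<Longrightarrow> fn a \<in> relations M"
| supercommute:
    "gen g * gen g' - (if is_odd g \<and> is_odd g' then - 1 else 1) * (gen g' * gen g) \<in> relations M"
| coordinate: "gen (V \<alpha> 0) - fn (\<lambda>x. x $ \<alpha>) \<in> relations M"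
| bihamiltonian_recursion:
    "(\<Sum>\<beta>\<in>UNIV. fn (\<lambda>_. etaI M \<alpha> \<beta>) * gen (Sg \<beta> (Suc k) 1))
     - ((\<Sum>\<beta>\<in>UNIV. fn (gup M \<alpha> \<beta>) * gen (Sg \<beta> k 1))
        + (\<Sum>\<beta>\<in>UNIV. \<Sum>\<gamma>\<in>UNIV. fn (Gam M \<alpha> \<beta> \<gamma>) * gen (V \<gamma> 1) * gen (Sg \<beta> k 0))) \<in> relations M"
| Phi_zero: "gen (Ph \<alpha> 0 n) - gen (Sg \<alpha> n 0) \<in> relations M"
| no_odd_constants:
    "a \<in> dring M \<Longrightarrow> positive_degree a \<Longrightarrow> dx M a \<in> relations M \<Longrightarrow> a \<in> relations M"

definition sreq :: "'n::finite superpoly \<Rightarrow> 'n frobenius_data \<Rightarrow> 'n superpoly \<Rightarrow> bool"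
    ("(_/ \<approx>\<^bsub>_\<^esub> _)" [51, 0, 51] 50) where
  "a \<approx>\<^bsub>M\<^esub> b \<longleftrightarrow> a - b \<in> relations M"


section \<open>The flows\<close>

text \<open>A derivation of the quotient superalgebra, of parity \<open>e\<close> (0 even, 1 odd), given on
  representatives. On functions of the coordinates a derivation is required to satisfy the chain
  rule.\<close>

definition superderivation ::
    "'n::finite frobenius_data \<Rightarrow> nat \<Rightarrow> ('n superpoly \<Rightarrow> 'n superpoly) \<Rightarrow> bool" where
  "superderivation M e X \<longleftrightarrow>
     (\<forall>a\<in>dring M. X a \<in> dring M) \<and>
     (\<forall>a\<in>dring M. \<forall>b\<in>dring M. a \<approx>\<^bsub>M\<^esub> b \<longrightarrow> X a \<approx>\<^bsub>M\<^esub> X b) \<and>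
     (\<forall>a\<in>dring M. \<forall>b\<in>dring M. X (a + b) \<approx>\<^bsub>M\<^esub> X a + X b) \<and>
     (\<forall>i. \<forall>a\<in>dring M. \<forall>b\<in>dring M. has_parity i a \<longrightarrow>
        X (a * b) \<approx>\<^bsub>M\<^esub> X a * b + (- 1) ^ (e * i) * a * X b) \<and>
     (\<forall>i. \<forall>a\<in>dring M. has_parity i a \<longrightarrow>
        (\<exists>b\<in>dring M. has_parity (e + i) b \<and> X a \<approx>\<^bsub>M\<^esub> b)) \<and>
     (\<forall>a. holo_on (chart M) a \<longrightarrow>
        X (fn a) \<approx>\<^bsub>M\<^esub> (\<Sum>\<alpha>\<in>UNIV. fn (pd \<alpha> a) * X (gen (V \<alpha> 0))))"

text \<open>The right-hand side of $\partial\sigma_{\alpha,k}/\partial\tau_m$ for $k \le m$.\<close>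

definition sigma_tau :: "'n::finite frobenius_data \<Rightarrow> 'n \<Rightarrow> nat \<Rightarrow> nat \<Rightarrow> 'n superpoly" where
  "sigma_tau M \<alpha> k m = (\<Sum>\<gamma>\<in>UNIV. \<Sum>\<beta>\<in>UNIV. fn (Gam M \<gamma> \<beta> \<alpha>)
     * (\<Sum>i<m - k. gen (Sg \<beta> (k + i) 0) * gen (Sg \<gamma> (m - i - 1) 1)))"

text \<open>\<open>Delta_ge\<close> is $\Delta^{k,n}_{\alpha,p}$ for $k \ge n$.\<close>

definition Delta_ge :: "'n::finite frobenius_data \<Rightarrow> 'n \<Rightarrow> nat \<Rightarrow> nat \<Rightarrow> nat \<Rightarrow> 'n superpoly" where
  "Delta_ge M \<alpha> p k n =
     (\<Sum>\<gamma>\<in>UNIV. \<Sum>\<kappa>\<in>UNIV. \<Sum>\<delta>\<in>UNIV. \<Sum>\<xi>\<in>UNIV.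
        fn (\<lambda>x. etaI M \<gamma> \<kappa> * pd \<kappa> (hfun M \<alpha> p) x * Gam M \<delta> \<xi> \<gamma> x)
        * (\<Sum>i<k - n. gen (Sg \<xi> (n + i) 0) * gen (Sg \<delta> (k - i - 1) 1)))"

definition Delta :: "'n::finite frobenius_data \<Rightarrow> 'n \<Rightarrow> nat \<Rightarrow> nat \<Rightarrow> nat \<Rightarrow> 'n superpoly" where
  "Delta M \<alpha> p k n = (if n \<le> k then Delta_ge M \<alpha> p k n else - Delta_ge M \<alpha> p n k)"

text \<open>\<open>T \<beta> q\<close> is $\partial/\partial t^{\beta,q}$ and \<open>S k\<close> is $\partial/\partial\tau_k$.\<close>

definition super_flows :: "'n::finite frobenius_data
    \<Rightarrow> ('n \<Rightarrow> nat \<Rightarrow> 'n superpoly \<Rightarrow> 'n superpoly) \<Rightarrow> (nat \<Rightarrow> 'n superpoly \<Rightarrow> 'n superpoly) \<Rightarrow> bool" where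
  "super_flows M T S \<longleftrightarrow>
     (\<forall>\<beta> q. superderivation M 0 (T \<beta> q)) \<and>
     (\<forall>k. superderivation M 1 (S k)) \<and>
     (\<forall>\<beta> q. \<forall>a\<in>dring M. T \<beta> q (dx M a) \<approx>\<^bsub>M\<^esub> dx M (T \<beta> q a)) \<and>
     (\<forall>k. \<forall>a\<in>dring M. S k (dx M a) \<approx>\<^bsub>M\<^esub> dx M (S k a)) \<and>
     (\<forall>a\<in>dring M. T (unit_idx M) 0 a \<approx>\<^bsub>M\<^esub> dx M a) \<and>
     (\<forall>\<alpha> \<beta> p. T \<beta> p (gen (V \<alpha> 0)) \<approx>\<^bsub>M\<^esub>
        (\<Sum>\<gamma>\<in>UNIV. \<Sum>\<kappa>\<in>UNIV.
           fn (\<lambda>x. etaI M \<alpha> \<gamma> * pd \<kappa> (pd \<gamma> (hfun M \<beta> (Suc p))) x) * gen (V \<kappa> 1))) \<and>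
     (\<forall>\<alpha> k \<beta> p. T \<beta> p (gen (Sg \<alpha> k 0)) \<approx>\<^bsub>M\<^esub>
        (\<Sum>\<gamma>\<in>UNIV. \<Sum>\<epsilon>\<in>UNIV.
           fn (\<lambda>x. etaI M \<gamma> \<epsilon> * pd \<alpha> (pd \<epsilon> (hfun M \<beta> (Suc p))) x) * gen (Sg \<gamma> k 1))) \<and>
     (\<forall>\<alpha> m. S m (gen (V \<alpha> 0)) \<approx>\<^bsub>M\<^esub>
        (\<Sum>\<beta>\<in>UNIV. fn (\<lambda>_. etaI M \<alpha> \<beta>) * gen (Sg \<beta> m 1))) \<and>
     (\<forall>\<alpha> k m. k \<le> m \<longrightarrow>
        S m (gen (Sg \<alpha> k 0)) \<approx>\<^bsub>M\<^esub> sigma_tau M \<alpha> k m \<and>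
        - S k (gen (Sg \<alpha> m 0)) \<approx>\<^bsub>M\<^esub> sigma_tau M \<alpha> k m) \<and>
     (\<forall>\<alpha> p \<beta> q. T \<beta> q (gen (Ff \<alpha> p)) \<approx>\<^bsub>M\<^esub> fn (Omega M \<alpha> p \<beta> q)) \<and>
     (\<forall>\<alpha> p n. S n (gen (Ff \<alpha> p)) \<approx>\<^bsub>M\<^esub> gen (Ph \<alpha> p n)) \<and>
     (\<forall>\<alpha> p n \<beta> q. T \<beta> q (gen (Ph \<alpha> p n)) \<approx>\<^bsub>M\<^esub> S n (fn (Omega M \<alpha> p \<beta> q))) \<and>
     (\<forall>\<alpha> p n k. S k (gen (Ph \<alpha> p n)) \<approx>\<^bsub>M\<^esub> Delta M \<alpha> p k n)"

definition unknowns :: "'n::finite superpoly set" where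
  "unknowns = {gen (V \<alpha> 0) |\<alpha>. True} \<union> {gen (Sg \<alpha> k 0) |\<alpha> k. True}
     \<union> {gen (Ff \<alpha> p) |\<alpha> p. True} \<union> {gen (Ph \<alpha> p n) |\<alpha> p n. True}"

definition flows_supercommute :: "'n::finite frobenius_data
    \<Rightarrow> ('n \<Rightarrow> nat \<Rightarrow> 'n superpoly \<Rightarrow> 'n superpoly) \<Rightarrow> (nat \<Rightarrow> 'n superpoly \<Rightarrow> 'n superpoly) \<Rightarrow> bool" where
  "flows_supercommute M T S \<longleftrightarrow>
     (\<forall>u\<in>unknowns.
        (\<forall>\<alpha> p \<beta> q. T \<alpha> p (T \<beta> q u) \<approx>\<^bsub>M\<^esub> T \<beta> q (T \<alpha> p u)) \<and>
        (\<forall>\<beta> q k. T \<beta> q (S k u) \<approx>\<^bsub>M\<^esub> S k (T \<beta> q u)) \<and>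
        (\<forall>k l. S k (S l u) \<approx>\<^bsub>M\<^esub> - S l (S k u)))"

end

theory Submission
  imports Defs
begin

text \<open>
  Write $X\circ Y$ for the product of covectors induced by the multiplication of $M$, $\mathcal U$
  for multiplication by the Euler field, $w_k=\sigma_k'$ and $\rho_k=(\frac12-\mu)\sigma_k$. The
  recursion becomes $w_{k+1}=\mathcal U w_k+v_x\circ\rho_k$. An odd or even flow with
  $\delta v=u$, $\delta\sigma_k=\delta_k$ is compatible with it as soon as
  $v_x\circ\delta_k=u\circ w_k$ and $\delta_{k+1}=\mathcal U\delta_k+u\circ\rho_k$. Both
  identities hold for $\partial/\partial t^{\beta,q}$, where $u=H\circ v_x$ and
  $\delta_k=H\circ w_k$ with $H=dh_{\beta,q}$, and for $\partial/\partial\tau_m$, where $u=w_m$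
  and $\delta_k=\sum_a\rho_a\circ w_{m+k-1-a}$; the latter by telescoping and the antisymmetry of
  products of odd covectors. A derivation given on generators that respects the remaining
  relations and commutes with $\partial$ on generators preserves the whole ideal, including the
  elements added by the absence of odd constants, since it preserves positive super degree.

  Commutators of flows kill the $f_{\alpha,p}$ because $\Omega$ is a potential for the totally
  symmetric $\langle dh\circ dh, dh\circ v_x\rangle$ and $\Delta$ is antisymmetric. Since
  $v_\alpha=f_{\alpha,0}'$ and $\sigma_{\alpha,k}=\Phi^k_{\alpha,0}=\partial f_{\alpha,0}/\partial\tau_k$,
  formal manipulations with (anti)symmetries reduce everything else to $\sigma_0$ and then, by the
  recursion and the absence of odd constants, to all $\sigma_k$ and $\Phi$.
\<close>

section \<open>Partial derivatives of holomorphic functions\<close>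

text \<open>The ideal of relations is not given by explicit generators: the rule
  \<open>no_odd_constants\<close> adds elements that are known only through their derivatives. It is
  also the only means of concluding that something vanishes because its x-derivative does. Even
  constants are not excluded, so commutators on the even unknowns f are computed directly, while
  vanishing is propagated to odd unknowns through derivatives. This propagation needs positive super
  degree instead of odd parity, because an odd flow sends sigma to an even quadratic expression;
  hence the two predicates \<open>par\<close> and \<open>pos\<close>.

  Elements of the ideal need not be homogeneous, and for those the Leibniz rule of an odd derivation
  holds only with a sign automorphism on the left factor. That the derivation and this automorphism
  both respect the ideal is therefore proved in a single induction.

  Commutativity is claimed for every solution of the flow equations, so it is argued for abstract
  superderivations. The induction over the indices of sigma starts at 0, where antisymmetry yields x
  = -x and 2 is invertible.\<close>

lemma axis_scale: "axis i w = w *s axis i (1::complex)"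
  by (simp add: vec_eq_iff axis_def)

lemma norm_axis: "norm (axis i w :: complex^'n) = norm w"
  by (simp add: axis_def norm_vec_def L2_set_def if_distrib[where f = "\<lambda>x. x\<^sup>2"]
      if_distrib[where f = norm] cong: if_cong)

lemma has_derivative_axis: "((\<lambda>w. x + axis i (w::complex)) has_derivative axis i) F"
proof -
  have "bounded_linear (axis i :: complex \<Rightarrow> complex^'a)"
    by (rule bounded_linear_intro[where K=1]) (auto simp: vec_eq_iff norm_axis, auto simp: axis_def)
  from bounded_linear.has_derivative[OF this has_derivative_ident]
  have "((\<lambda>w. axis i w) has_derivative axis i) F" by simp
  from has_derivative_add[OF has_derivative_const[of x] this] show ?thesis by simp
qed

text \<open>Complex linearity of the total derivative makes its restriction to a complex line
  multiplication by a number, hence a complex derivative.\<close>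

lemma has_field_derivative_along_axis:
  assumes "(f has_derivative f') (at (x + axis i w0))" and "\<And>c y. f' (c *s y) = c * f' y"
  shows "((\<lambda>w. f (x + axis i w)) has_field_derivative f' (axis i 1)) (at (w0::complex))"
proof -
  have "((\<lambda>w. f (x + axis i w)) has_derivative (\<lambda>w. f' (axis i w))) (at w0)"
    using has_derivative_compose[OF has_derivative_axis assms(1)] .
  moreover have "(\<lambda>w. f' (axis i w)) = (*) (f' (axis i 1))"
  proof
    fix w show "f' (axis i w) = f' (axis i 1) * w"
      using assms(2)[of w "axis i 1"] by (simp add: axis_scale[of i w] mult.commute)
  qed
  ultimately show ?thesis
    unfolding has_field_derivative_def by metis
qed

lemma pd_eq:
  assumes "(f has_derivative f') (at x)" and "\<And>c y. f' (c *s y) = c * f' y"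
  shows "pd i f x = f' (axis i 1)"
  unfolding pd_def
  by (rule DERIV_imp_deriv, rule has_field_derivative_along_axis)
     (use assms in \<open>auto simp: axis_scale[of i 0]\<close>)

lemma complex_differentiable_const: "complex_differentiable_at (\<lambda>_. c) x"
  unfolding complex_differentiable_at_def by (rule exI[of _ "\<lambda>_. 0"]) simp

lemma complex_differentiable_coord [simp]: "complex_differentiable_at (\<lambda>x. x $ \<alpha>) x"
  unfolding complex_differentiable_at_def
  by (rule exI[of _ "\<lambda>y. y $ \<alpha>"])
     (auto intro!: bounded_linear.has_derivative[OF bounded_linear_vec_nth] has_derivative_ident)

lemma has_derivative_complex_add:
  assumes "complex_differentiable_at f x" "complex_differentiable_at g x"
  shows "complex_differentiable_at (f + g) x" "pd i (f + g) x = pd i f x + pd i g x"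
proof -
  obtain f' g' where f: "(f has_derivative f') (at x)" "\<And>c y. f' (c *s y) = c * f' y"
    and g: "(g has_derivative g') (at x)" "\<And>c y. g' (c *s y) = c * g' y"
    using assms unfolding complex_differentiable_at_def by blast
  have d: "(f + g has_derivative (\<lambda>y. f' y + g' y)) (at x)"
    using has_derivative_add[OF f(1) g(1)] by (simp add: plus_fun_def)
  show "complex_differentiable_at (f + g) x"
    unfolding complex_differentiable_at_def
    by (rule exI[of _ "\<lambda>y. f' y + g' y"]) (use d f g in \<open>auto simp: algebra_simps\<close>)
  show "pd i (f + g) x = pd i f x + pd i g x"
    using pd_eq[OF d] pd_eq[OF f] pd_eq[OF g] f(2) g(2) by (simp add: algebra_simps)
qed

lemma has_derivative_complex_mult:
  assumes "complex_differentiable_at f x" "complex_differentiable_at g x"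
  shows "complex_differentiable_at (f * g) x" "pd i (f * g) x = pd i f x * g x + f x * pd i g x"
proof -
  obtain f' g' where f: "(f has_derivative f') (at x)" "\<And>c y. f' (c *s y) = c * f' y"
    and g: "(g has_derivative g') (at x)" "\<And>c y. g' (c *s y) = c * g' y"
    using assms unfolding complex_differentiable_at_def by blast
  have d: "(f * g has_derivative (\<lambda>y. f x * g' y + f' y * g x)) (at x)"
    using has_derivative_mult[OF f(1) g(1)] by (simp add: times_fun_def)
  show "complex_differentiable_at (f * g) x"
    unfolding complex_differentiable_at_def
    by (rule exI[of _ "\<lambda>y. f x * g' y + f' y * g x"]) (use d f g in \<open>auto simp: algebra_simps\<close>)
  show "pd i (f * g) x = pd i f x * g x + f x * pd i g x"
    using pd_eq[OF d] pd_eq[OF f] pd_eq[OF g] f(2) g(2) by (simp add: algebra_simps)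
qed

lemma pd_const: "pd i (\<lambda>_. c) x = 0"
  by (simp add: pd_def)

lemma pd_zero [simp]: "pd i 0 x = 0" and pd_one [simp]: "pd i 1 x = 0"
  using pd_const[of i 0 x] pd_const[of i 1 x] by (simp_all add: zero_fun_def one_fun_def)

lemma pd_coord [simp]: "pd i (\<lambda>x. x $ \<alpha>) x = (if i = \<alpha> then 1 else 0)"
  by (subst pd_eq[where f' = "\<lambda>y. y $ \<alpha>"])
     (auto intro!: bounded_linear.has_derivative[OF bounded_linear_vec_nth] has_derivative_ident
       simp: axis_def)

text \<open>Identities are known only on the chart while functions are total. Near x the axis stays
  inside the open set, and \<open>deriv\<close> sees no more than that.\<close>

lemma pd_cong:
  assumes "open D" "x \<in> D" "\<And>y. y \<in> D \<Longrightarrow> f y = g y"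
  shows "pd i f x = pd i g x"
  unfolding pd_def
proof (rule deriv_cong_ev)
  have "((\<lambda>w. x + axis i w) \<longlongrightarrow> x + axis i 0) (nhds (0::complex))"
    using has_derivative_continuous[OF has_derivative_axis[of x i "at 0"]]
    using tendsto_at_iff_tendsto_nhds[of "\<lambda>w. x + axis i w" "0::complex"] by (simp add: continuous_within)
  then have "\<forall>\<^sub>F w in nhds 0. x + axis i w \<in> D"
    using assms(1,2) by (auto simp: tendsto_def axis_scale[of i 0])
  then show "\<forall>\<^sub>F w in nhds 0. f (x + axis i w) = g (x + axis i w)"
    by (rule eventually_mono) (rule assms(3))
qed simp

lemma complex_differentiable_cong:
  assumes "open D" "x \<in> D" "\<And>y. y \<in> D \<Longrightarrow> f y = g y"
  shows "complex_differentiable_at f x \<longleftrightarrow> complex_differentiable_at g x"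
  unfolding complex_differentiable_at_def
  using has_derivative_transform_within_open[OF _ assms(1,2)] assms(3) by metis

lemma foldr_pd_cong:
  assumes "open D" "\<And>y. y \<in> D \<Longrightarrow> f y = g y" "x \<in> D"
  shows "foldr pd is f x = foldr pd is g x"
  using assms(3)
proof (induction "is" arbitrary: x)
  case (Cons i "is")
  then show ?case by (auto intro: pd_cong[OF assms(1)])
qed (use assms(2) in simp)

section \<open>Holomorphy on an open set\<close>

lemma holo_on_cong:
  assumes "open D" "\<And>y. y \<in> D \<Longrightarrow> f y = g y"
  shows "holo_on D f \<longleftrightarrow> holo_on D g"
proof -
  have "complex_differentiable_at (foldr pd is f) x \<longleftrightarrow> complex_differentiable_at (foldr pd is g) x"
    if "x \<in> D" for "is" x
    by (rule complex_differentiable_cong[OF assms(1) that]) (rule foldr_pd_cong[OF assms])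
  then show ?thesis by (simp add: holo_on_def)
qed

lemma holo_on_complex_differentiable: "holo_on D f \<Longrightarrow> x \<in> D \<Longrightarrow> complex_differentiable_at f x"
  unfolding holo_on_def by (metis foldr.simps(1) id_apply)

lemma holo_on_pd [intro]:
  assumes "holo_on D f"
  shows "holo_on D (pd i f)"
  unfolding holo_on_def
proof (intro allI ballI)
  fix "is" :: "'a list" and x assume "x \<in> D"
  \<comment> \<open>\<open>foldr\<close> applies the last index of the list first, so the derivative
    already taken is appended at the end.\<close>
  then have "complex_differentiable_at (foldr pd (is @ [i]) f) x"
    using assms unfolding holo_on_def by blast
  then show "complex_differentiable_at (foldr pd is (pd i f)) x" by simp
qed

lemma holo_on_const [intro]: "holo_on D (\<lambda>_. c)"
  unfolding holo_on_def
proof (intro allI ballI)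
  fix "is" :: "'a list" and x
  have "\<exists>c'. foldr pd is (\<lambda>_. c) = (\<lambda>_. c')"
  proof (induction "is")
    case (Cons i "is")
    then obtain c' where "foldr pd is (\<lambda>_. c) = (\<lambda>_. c')" by blast
    then have "foldr pd (i # is) (\<lambda>_. c) = (\<lambda>_. 0)" by (auto simp: pd_const)
    then show ?case by blast
  qed auto
  then show "complex_differentiable_at (foldr pd is (\<lambda>_. c)) x"
    using complex_differentiable_const by auto
qed

lemma holo_on_zero [simp, intro]: "holo_on D 0" and holo_on_one [simp, intro]: "holo_on D 1"
  using holo_on_const[of D 0] holo_on_const[of D 1] by (simp_all add: zero_fun_def one_fun_def)

text \<open>Holomorphy truncated at n derivatives. The product rule lowers the number of derivatives
  still to be taken, so closure under products becomes an induction on n, which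
  \<open>holo_on\<close>, quantifying over all lists at once, does not offer.\<close>

definition holo_order :: "nat \<Rightarrow> (complex^'n::finite) set \<Rightarrow> 'n scalar_fn \<Rightarrow> bool" where
  "holo_order n D f \<longleftrightarrow>
     (\<forall>is. length is \<le> n \<longrightarrow> (\<forall>x\<in>D. complex_differentiable_at (foldr pd is f) x))"

lemma holo_on_iff_order: "holo_on D f \<longleftrightarrow> (\<forall>n. holo_order n D f)"
  unfolding holo_on_def holo_order_def by blast

lemma holo_order_0: "holo_order 0 D f \<longleftrightarrow> (\<forall>x\<in>D. complex_differentiable_at f x)"
  by (simp add: holo_order_def)

text \<open>The derivative split off is the innermost one, the last entry of the list, so that an
  induction hypothesis for arbitrary functions applies to \<open>pd i f\<close>.\<close>

lemma holo_order_Suc: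
  "holo_order (Suc n) D f \<longleftrightarrow>
     (\<forall>x\<in>D. complex_differentiable_at f x) \<and> (\<forall>i. holo_order n D (pd i f))"
proof (intro iffI conjI allI ballI; (elim conjE)?)
  fix x assume "holo_order (Suc n) D f" "x \<in> D"
  then show "complex_differentiable_at f x"
    unfolding holo_order_def by (elim allE[of _ "[]"]) auto
next
  fix i assume h: "holo_order (Suc n) D f"
  show "holo_order n D (pd i f)"
    unfolding holo_order_def
  proof (intro allI impI ballI)
    fix "is" :: "'a list" and x assume "length is \<le> n" "x \<in> D"
    then show "complex_differentiable_at (foldr pd is (pd i f)) x"
      using h unfolding holo_order_def by (elim allE[of _ "is @ [i]"]) auto
  qed
next
  assume a: "\<forall>x\<in>D. complex_differentiable_at f x" "\<forall>i. holo_order n D (pd i f)"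
  show "holo_order (Suc n) D f"
    unfolding holo_order_def
  proof (intro allI impI ballI)
    fix "is" :: "'a list" and x assume l: "length is \<le> Suc n" and x: "x \<in> D"
    show "complex_differentiable_at (foldr pd is f) x"
    proof (cases "is" rule: rev_cases)
      case (snoc js j)
      then show ?thesis using a(2) l x by (auto simp: holo_order_def)
    qed (use a x in simp)
  qed
qed

lemma holo_on_coord [simp, intro]: "holo_on D (\<lambda>x. x $ \<alpha>)"
proof -
  have "holo_order n D (\<lambda>x. x $ \<alpha>)" for n
  proof (cases n)
    case (Suc k)
    have "holo_order k D (pd i (\<lambda>x. x $ \<alpha>))" for i
      using holo_on_const[of D "if i = \<alpha> then 1 else 0"]
      by (simp add: pd_coord[abs_def] holo_on_iff_order)
    then show ?thesis by (simp add: Suc holo_order_Suc)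
  qed (simp add: holo_order_0)
  then show ?thesis by (simp add: holo_on_iff_order)
qed

lemma holo_order_Suc_imp: "holo_order (Suc n) D f \<Longrightarrow> holo_order n D f"
  by (auto simp: holo_order_def)

lemma holo_order_cong:
  assumes "open D" "\<And>y. y \<in> D \<Longrightarrow> f y = g y"
  shows "holo_order n D f \<longleftrightarrow> holo_order n D g"
proof -
  have "complex_differentiable_at (foldr pd is f) x \<longleftrightarrow> complex_differentiable_at (foldr pd is g) x"
    if "x \<in> D" for "is" x
    by (rule complex_differentiable_cong[OF assms(1) that]) (rule foldr_pd_cong[OF assms])
  then show ?thesis by (simp add: holo_order_def)
qed

lemma holo_order_add:
  assumes "open D" "holo_order n D f" "holo_order n D g"
  shows "holo_order n D (f + g)"
  using assms(2,3)
proof (induction n arbitrary: f g)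
  case (Suc n)
  have diff: "complex_differentiable_at f x" "complex_differentiable_at g x" if "x \<in> D" for x
    using Suc.prems that by (auto simp: holo_order_Suc)
  have "holo_order n D (pd i f + pd i g)" for i
    using Suc.prems by (intro Suc.IH) (auto simp: holo_order_Suc)
  moreover have "holo_order n D (pd i (f + g)) = holo_order n D (pd i f + pd i g)" for i
    by (rule holo_order_cong[OF assms(1)]) (simp add: has_derivative_complex_add diff)
  ultimately show ?case
    unfolding holo_order_Suc by (intro conjI ballI allI has_derivative_complex_add(1) diff) simp_all
next
  case 0
  then have "complex_differentiable_at f x" "complex_differentiable_at g x" if "x \<in> D" for x
    using that by (auto simp: holo_order_0)
  then show ?case
    unfolding holo_order_0 by (intro ballI has_derivative_complex_add(1))
qed

text \<open>Each summand of the product rule keeps one factor undifferentiated;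
  \<open>holo_order_Suc_imp\<close> lowers that factor to the order of the induction
  hypothesis.\<close>

lemma holo_order_mult:
  assumes "open D" "holo_order n D f" "holo_order n D g"
  shows "holo_order n D (f * g)"
  using assms(2,3)
proof (induction n arbitrary: f g)
  case (Suc n)
  have diff: "complex_differentiable_at f x" "complex_differentiable_at g x" if "x \<in> D" for x
    using Suc.prems that by (auto simp: holo_order_Suc)
  have "holo_order n D f" "holo_order n D g"
    using Suc.prems by (auto intro: holo_order_Suc_imp)
  then have "holo_order n D (pd i f * g + f * pd i g)" for i
    using Suc.prems by (intro holo_order_add[OF assms(1)] Suc.IH) (auto simp: holo_order_Suc)
  moreover have "holo_order n D (pd i (f * g)) = holo_order n D (pd i f * g + f * pd i g)" for i
    by (rule holo_order_cong[OF assms(1)]) (simp add: has_derivative_complex_mult diff)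
  ultimately show ?case
    unfolding holo_order_Suc by (intro conjI ballI allI has_derivative_complex_mult(1) diff) simp_all
next
  case 0
  then have "complex_differentiable_at f x" "complex_differentiable_at g x" if "x \<in> D" for x
    using that by (auto simp: holo_order_0)
  then show ?case
    unfolding holo_order_0 by (intro ballI has_derivative_complex_mult(1))
qed

lemma holo_on_add [intro]: "open D \<Longrightarrow> holo_on D f \<Longrightarrow> holo_on D g \<Longrightarrow> holo_on D (f + g)"
  by (simp add: holo_on_iff_order holo_order_add)

lemma holo_on_mult [intro]: "open D \<Longrightarrow> holo_on D f \<Longrightarrow> holo_on D g \<Longrightarrow> holo_on D (f * g)"
  by (simp add: holo_on_iff_order holo_order_mult)

lemma holo_on_uminus [intro]: "open D \<Longrightarrow> holo_on D f \<Longrightarrow> holo_on D (- f)"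
  using holo_on_mult[of D "\<lambda>_. -1" f] holo_on_const[of D "-1"]
  by (simp add: fun_Compl_def times_fun_def)

lemma holo_on_sum [intro]: "open D \<Longrightarrow> (\<And>i. i \<in> I \<Longrightarrow> holo_on D (f i)) \<Longrightarrow> holo_on D (sum f I)"
  by (induction I rule: infinite_finite_induct) auto

lemma pd_add: "holo_on D f \<Longrightarrow> holo_on D g \<Longrightarrow> x \<in> D \<Longrightarrow> pd i (f + g) x = pd i f x + pd i g x"
  by (simp add: has_derivative_complex_add holo_on_complex_differentiable)

lemma pd_mult:
  "holo_on D f \<Longrightarrow> holo_on D g \<Longrightarrow> x \<in> D \<Longrightarrow> pd i (f * g) x = pd i f x * g x + f x * pd i g x"
  by (simp add: has_derivative_complex_mult holo_on_complex_differentiable)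

lemma pd_sum:
  assumes "open D" "\<And>j. j \<in> J \<Longrightarrow> holo_on D (f j)" "x \<in> D"
  shows "pd i (sum f J) x = (\<Sum>j\<in>J. pd i (f j) x)"
  using assms(2)
proof (induction J rule: infinite_finite_induct)
  case (insert j J)
  then have "pd i (f j + sum f J) x = pd i (f j) x + pd i (sum f J) x"
    by (intro pd_add[of D] holo_on_sum) (use assms in auto)
  with insert show ?case by (simp del: plus_fun_apply)
qed simp_all

text \<open>The quantity to be bounded is an increment of a function of one complex variable s along
  axis i. Its derivative is a difference of two first-order remainders of \<open>pd i f\<close> at
  x, bounded by 2 epsilon h and epsilon h; the length h of the increment supplies the last
  factor.\<close>

lemma second_difference_bound:
  fixes f :: "'n::finite scalar_fn"
  assumes "open D" "holo_on D f" "x \<in> D" "\<epsilon> > 0"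
  shows "\<exists>d>0. \<forall>h. 0 < h \<and> h < d \<longrightarrow>
    norm (f (x + axis i (of_real h) + axis j (of_real h)) - f (x + axis i (of_real h))
      - f (x + axis j (of_real h)) + f x - (of_real h)\<^sup>2 * pd j (pd i f) x) \<le> 3 * \<epsilon> * h\<^sup>2"
proof -
  obtain L where L: "(pd i f has_derivative L) (at x)" "\<And>c y. L (c *s y) = c * L y"
    using holo_on_complex_differentiable[OF holo_on_pd[OF assms(2)] assms(3)]
    unfolding complex_differentiable_at_def by blast
  interpret L: bounded_linear L using L(1) by (rule has_derivative_bounded_linear)
  obtain d1 where d1: "d1 > 0"
    "\<And>y. norm (y - x) < d1 \<Longrightarrow> norm (pd i f y - pd i f x - L (y - x)) \<le> \<epsilon> * norm (y - x)"
    using L(1) assms(4) unfolding has_derivative_at_alt by blast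
  obtain d2 where d2: "d2 > 0" "ball x d2 \<subseteq> D" using assms(1,3) openE by blast
  \<comment> \<open>The point x + h e_j + s e_i with norm s at most h lies within 2h of x; hence the
    half.\<close>
  define d where "d = min d1 d2 / 2"
  have "norm (f (x + axis i (of_real h) + axis j (of_real h)) - f (x + axis i (of_real h))
      - f (x + axis j (of_real h)) + f x - (of_real h)\<^sup>2 * pd j (pd i f) x) \<le> 3 * \<epsilon> * h\<^sup>2"
    if h: "0 < h" "h < d" for h :: real
  proof -
    let ?h = "complex_of_real h"
    define c where "c = pd j (pd i f) x"
    have c: "c = L (axis j 1)" unfolding c_def by (rule pd_eq[OF L])
    define S where "S = cball (0::complex) h"
    define \<psi> where "\<psi> s = f (x + axis j ?h + axis i s) - f (x + axis i s) - s * (?h * c)" for s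
    define \<psi>' where "\<psi>' s = pd i f (x + axis j ?h + axis i s) - pd i f (x + axis i s) - ?h * c" for s
    have near: "norm (axis j (of_real t) + axis i s :: complex^'n) \<le> t + norm s" if "0 \<le> t" for t s
      using norm_triangle_ineq[of "axis j (of_real t) :: complex^'n" "axis i s"] that
      by (simp add: norm_axis)
    have near0: "norm (axis j ?h + axis i s :: complex^'n) < min d1 d2"
      "norm (axis i s :: complex^'n) < min d1 d2" if "s \<in> S" for s
      using near[of h s] that h unfolding S_def d_def by (auto simp: norm_axis)
    have inD: "x + axis j ?h + axis i s \<in> D" "x + axis i s \<in> D" if "s \<in> S" for s
      using near0[OF that] d2(2) by (auto simp: subset_iff dist_norm norm_minus_commute
          algebra_simps simp flip: add_diff_eq)
    have "(\<psi> has_field_derivative \<psi>' s) (at s within S)" if s: "s \<in> S" for s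
    proof -
      have D: "((\<lambda>w. f (y + axis i w)) has_field_derivative pd i f (y + axis i s)) (at s)"
        if y: "y + axis i s \<in> D" for y
      proof -
        obtain f' where f': "(f has_derivative f') (at (y + axis i s))" "\<And>c y. f' (c *s y) = c * f' y"
          using holo_on_complex_differentiable[OF assms(2) y]
          unfolding complex_differentiable_at_def by blast
        from has_field_derivative_along_axis[OF f'] pd_eq[OF f'] show ?thesis by simp
      qed
      show ?thesis unfolding \<psi>_def \<psi>'_def
        by (rule has_field_derivative_at_within)
           (auto intro!: derivative_eq_intros D inD s)
    qed
    moreover have "norm (\<psi>' s) \<le> 3 * \<epsilon> * h" if s: "s \<in> S" for s
    proof -
      have Lij: "L (axis j ?h) = ?h * c" using L(2)[of ?h "axis j 1"] axis_scale[of j ?h] c by simp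
      \<comment> \<open>The linear parts differ by L (h e_j) = h c, exactly the term subtracted in
        \<open>\<psi>'\<close>.\<close>
      have "\<psi>' s = (pd i f (x + axis j ?h + axis i s) - pd i f x - L (axis j ?h + axis i s))
          - (pd i f (x + axis i s) - pd i f x - L (axis i s))"
        unfolding \<psi>'_def by (simp add: L.add Lij)
      also have "norm \<dots> \<le> \<epsilon> * norm (axis j ?h + axis i s :: complex^'n) + \<epsilon> * norm (axis i s :: complex^'n)"
        using d1(2)[of "x + axis j ?h + axis i s"] d1(2)[of "x + axis i s"] near0[OF s]
        by (intro order_trans[OF norm_triangle_ineq4 add_mono]) (auto simp: add.assoc)
      also have "\<dots> \<le> \<epsilon> * (h + h) + \<epsilon> * h"
        using near[of h s] s h assms(4) unfolding S_def
        by (intro add_mono mult_left_mono) (auto simp: norm_axis)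
      finally show ?thesis by simp
    qed
    ultimately have "norm (\<psi> ?h - \<psi> 0) \<le> 3 * \<epsilon> * h * norm (?h - 0)"
      by (rule field_differentiable_bound[where S = S, rotated]) (use h in \<open>auto simp: S_def\<close>)
    also have "\<psi> ?h - \<psi> 0 = f (x + axis i ?h + axis j ?h) - f (x + axis i ?h)
      - f (x + axis j ?h) + f x - ?h\<^sup>2 * c"
      unfolding \<psi>_def by (simp add: power2_eq_square algebra_simps axis_scale[of i 0])
    finally show ?thesis using h by (simp add: c_def power2_eq_square mult.assoc)
  qed
  moreover have "d > 0" using d1 d2 by (simp add: d_def)
  ultimately show ?thesis by blast
qed

text \<open>The second difference is symmetric in i and j and, divided by h^2, approximates both
  mixed derivatives.\<close>

lemma pd_commute:
  assumes "open D" "holo_on D f" "x \<in> D"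
  shows "pd i (pd j f) x = pd j (pd i f) x"
proof -
  have "norm (pd i (pd j f) x - pd j (pd i f) x) \<le> 0"
  proof (rule field_le_epsilon)
    fix e :: real assume e: "e > 0"
    \<comment> \<open>Two errors of 3 epsilon h^2 have to add up to e h^2.\<close>
    define \<epsilon> where "\<epsilon> = e / 6"
    have \<epsilon>: "\<epsilon> > 0" using e by (simp add: \<epsilon>_def)
    define A where "A h = f (x + axis i (of_real h) + axis j (of_real h)) - f (x + axis i (of_real h))
      - f (x + axis j (of_real h)) + f x" for h
    obtain d1 where d1: "d1 > 0"
      "\<And>h. 0 < h \<and> h < d1 \<Longrightarrow> norm (A h - (of_real h)\<^sup>2 * pd j (pd i f) x) \<le> 3 * \<epsilon> * h\<^sup>2"
      using second_difference_bound[OF assms \<epsilon>, of i j] unfolding A_def by blast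
    have A': "f (x + axis j (of_real h) + axis i (of_real h)) - f (x + axis j (of_real h))
      - f (x + axis i (of_real h)) + f x = A h" for h
      by (simp add: A_def add.assoc add.commute[of "axis i (complex_of_real h)"])
    obtain d2 where d2: "d2 > 0"
      "\<And>h. 0 < h \<and> h < d2 \<Longrightarrow> norm (A h - (of_real h)\<^sup>2 * pd i (pd j f) x) \<le> 3 * \<epsilon> * h\<^sup>2"
      using second_difference_bound[OF assms \<epsilon>, of j i] unfolding A' by blast
    define h where "h = min d1 d2 / 2"
    have h: "0 < h \<and> h < d1" "0 < h \<and> h < d2" using d1(1) d2(1) by (auto simp: h_def)
    have "h\<^sup>2 * norm (pd i (pd j f) x - pd j (pd i f) x)
        = norm ((A h - (of_real h)\<^sup>2 * pd j (pd i f) x) - (A h - (of_real h)\<^sup>2 * pd i (pd j f) x))"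
      by (simp add: norm_mult norm_power flip: right_diff_distrib)
    also have "\<dots> \<le> 3 * \<epsilon> * h\<^sup>2 + 3 * \<epsilon> * h\<^sup>2"
      by (rule order_trans[OF norm_triangle_ineq4]) (intro add_mono d1(2) d2(2) h)
    also have "\<dots> = h\<^sup>2 * e" by (simp add: \<epsilon>_def)
    finally show "norm (pd i (pd j f) x - pd j (pd i f) x) \<le> 0 + e"
      using h by simp
  qed
  then show ?thesis by simp
qed

section \<open>The free algebra and its subring with holomorphic coefficients\<close>

lemma single_sum_decomposition: "a = (\<Sum>w\<in>Poly_Mapping.keys a. Poly_Mapping.single w (Poly_Mapping.lookup a w))"
  by (rule poly_mapping_eqI)
     (auto simp: lookup_sum lookup_single when_def in_keys_iff sum.delta)

lemma zero_dring [simp]: "0 \<in> dring M"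
  by (auto simp: dring_def)

lemma single_dring [simp]: "Poly_Mapping.single w f \<in> dring M \<longleftrightarrow> holo_on (chart M) f"
proof
  assume "Poly_Mapping.single w f \<in> dring M"
  then have "holo_on (chart M) (Poly_Mapping.lookup (Poly_Mapping.single w f) w)"
    unfolding dring_def by blast
  then show "holo_on (chart M) f" by simp
qed (auto simp: dring_def lookup_single when_def)

lemma fn_dring [simp]: "fn f \<in> dring M \<longleftrightarrow> holo_on (chart M) f"
  by (simp add: fn_def)

lemma mon_dring [simp]: "mon w \<in> dring M"
  by (simp add: mon_def)

lemma one_dring [simp]: "1 \<in> dring M"
  using single_dring[of 0 1 M] by simp

lemma dring_lookup: "a \<in> dring M \<Longrightarrow> holo_on (chart M) (Poly_Mapping.lookup a w)"
  by (simp add: dring_def)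

lemma mon_Nil [simp]: "mon [] = 1"
  by (simp add: mon_def flip: zero_word_def)

lemma mon_append: "mon (u @ w) = mon u * mon w"
  by (simp add: mon_def mult_single plus_word_def)

lemma mon_Cons: "mon (g # w) = gen g * mon w"
  using mon_append[of "[g]" w] by simp

lemma single_eq_fn_mon: "Poly_Mapping.single w f = fn f * mon (letters w)"
  by (simp add: fn_def mon_def mult_single)

lemma fn_mult: "fn (f * g) = fn f * fn g"
  by (simp add: fn_def mult_single)

lemma fn_add: "fn (f + g) = fn f + fn g"
  by (simp add: fn_def single_add)

lemma fn_zero [simp]: "fn 0 = 0" and fn_one [simp]: "fn 1 = 1"
  by (simp_all add: fn_def)

lemma fn_central: "fn f * a = a * fn f"
  by (subst (1 2) single_sum_decomposition[of a])
     (simp add: fn_def sum_distrib_left sum_distrib_right mult_single mult.commute)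

definition parity_sign :: "nat \<Rightarrow> 'a::ab_group_add \<Rightarrow> 'a" where
  "parity_sign n x = (if even n then x else - x)"

lemma parity_sign_simps [simp]:
  "parity_sign n 0 = 0" "parity_sign 0 x = x" "parity_sign (Suc 0) x = - x"
  "parity_sign n (parity_sign n x) = x"
  by (auto simp: parity_sign_def)

lemma parity_sign_add: "parity_sign n (x + y) = parity_sign n x + parity_sign n y"
  and parity_sign_minus: "parity_sign n (- x) = - parity_sign n x"
  and parity_sign_diff: "parity_sign n (x - y) = parity_sign n x - parity_sign n y"
  and parity_sign_mult_left: "parity_sign n u * v = parity_sign n (u * v :: 'b::ring)"
  and parity_sign_mult_right: "u * parity_sign n v = parity_sign n (u * v :: 'b::ring)"
  and parity_sign_plus: "parity_sign (m + n) x = parity_sign m (parity_sign n x)"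
  by (auto simp: parity_sign_def)

lemma parity_sign_sum: "parity_sign n (sum f I) = (\<Sum>i\<in>I. parity_sign n (f i))"
  by (auto simp: parity_sign_def sum_negf)

lemma minus_one_power_mult: "(- 1) ^ n * (a::'b::ring_1) = parity_sign n a"
  by (auto simp: parity_sign_def minus_one_power_iff)

lemma super_degree_plus [simp]: "super_degree (u + w) = super_degree u + super_degree w"
  by (simp add: super_degree_def plus_word_def)

lemma super_degree_zero [simp]: "super_degree 0 = 0"
  by (simp add: super_degree_def zero_word_def)

text \<open>The rules generating \<open>relations\<close> contain no negation; it comes from
  multiplying by the constant -1 of \<open>dring M\<close>.\<close>

lemma uminus_relations: "a \<in> relations M \<Longrightarrow> - a \<in> relations M"
proof -
  assume a: "a \<in> relations M"
  have "(- 1 :: 'a superpoly) = Poly_Mapping.single 0 (- 1)"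
    by (simp add: single_uminus)
  moreover have "holo_on (chart M) (- 1)"
    using holo_on_const[of "chart M" "- 1"] by (simp add: fun_Compl_def one_fun_def)
  ultimately have "- 1 \<in> dring M" by simp
  from relations.lmult[OF a this] show ?thesis by simp
qed

lemma diff_relations: "a \<in> relations M \<Longrightarrow> b \<in> relations M \<Longrightarrow> a - b \<in> relations M"
  using relations.add[OF _ uminus_relations, of a M b] by simp

context
  fixes M :: "'n::finite frobenius_data"
  assumes open_chart: "open (chart M)"
begin

lemma add_dring: "a \<in> dring M \<Longrightarrow> b \<in> dring M \<Longrightarrow> a + b \<in> dring M"
  using open_chart by (auto simp: dring_def lookup_add simp del: plus_fun_apply)

lemma uminus_dring: "a \<in> dring M \<Longrightarrow> - a \<in> dring M"
  using open_chart by (auto simp: dring_def lookup_uminus)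

lemma diff_dring: "a \<in> dring M \<Longrightarrow> b \<in> dring M \<Longrightarrow> a - b \<in> dring M"
  using add_dring[OF _ uminus_dring, of a b] by simp

lemma sum_dring: "(\<And>i. i \<in> I \<Longrightarrow> f i \<in> dring M) \<Longrightarrow> sum f I \<in> dring M"
  by (induction I rule: infinite_finite_induct) (auto intro: add_dring)

lemma mult_dring:
  assumes "a \<in> dring M" "b \<in> dring M"
  shows "a * b \<in> dring M"
proof -
  have "a * b = (\<Sum>v\<in>Poly_Mapping.keys a. \<Sum>w\<in>Poly_Mapping.keys b.
      Poly_Mapping.single (v + w) (Poly_Mapping.lookup a v * Poly_Mapping.lookup b w))"
    by (subst single_sum_decomposition[of a], subst single_sum_decomposition[of b])
       (simp add: sum_product mult_single)
  also have "\<dots> \<in> dring M"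
    using assms open_chart by (intro sum_dring) (auto intro: dring_lookup)
  finally show ?thesis .
qed

end

text \<open>In the \<open>single\<close> case the word is a key of a, so hypotheses on the parity or
  the super degree of a reach every monomial, while the coefficient is arbitrary.\<close>

lemma dring_induct [consumes 2, case_names zero single add]:
  assumes "open (chart M)" "a \<in> dring M" "P 0"
    and "\<And>w f. w \<in> Poly_Mapping.keys a \<Longrightarrow> holo_on (chart M) f \<Longrightarrow> P (Poly_Mapping.single w f)"
    and "\<And>b c. b \<in> dring M \<Longrightarrow> c \<in> dring M \<Longrightarrow> P b \<Longrightarrow> P c \<Longrightarrow> P (b + c)"
  shows "P a"
proof -
  have "(\<Sum>w\<in>K. Poly_Mapping.single w (Poly_Mapping.lookup a w)) \<in> dring M \<and>
      P (\<Sum>w\<in>K. Poly_Mapping.single w (Poly_Mapping.lookup a w))"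
    if "finite K" "K \<subseteq> Poly_Mapping.keys a" for K
    using that
  proof (induction K)
    case (insert w K)
    then show ?case
      using assms(2,4,5) add_dring[OF assms(1)] by (auto simp: dring_lookup)
  qed (use assms(3) in simp)
  from this[of "Poly_Mapping.keys a"] show ?thesis
    using single_sum_decomposition[of a] by simp
qed

section \<open>The differential superalgebra as a ring type\<close>

text \<open>A type cannot depend on the manifold, so the type consists of families, indexed by all
  manifolds, of classes modulo the relations. The superalgebra of a fixed manifold embeds as a
  (non-unital) direct factor.\<close>

definition tau_rel :: "('n::finite frobenius_data \<Rightarrow> 'n superpoly) \<Rightarrow> ('n frobenius_data \<Rightarrow> 'n superpoly) \<Rightarrow> bool" where
  "tau_rel F G \<longleftrightarrow> (\<forall>M. open (chart M) \<longrightarrow> F M \<in> dring M \<and> G M \<in> dring M \<and> F M - G M \<in> relations M)"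

lemma part_equivp_tau_rel: "part_equivp tau_rel"
proof (rule part_equivpI)
  show "\<exists>F. tau_rel F F"
    by (rule exI[of _ "\<lambda>_. 0"]) (simp add: tau_rel_def relations.zero)
  show "symp tau_rel"
    unfolding symp_def tau_rel_def using uminus_relations by fastforce
  show "transp tau_rel"
    unfolding transp_def tau_rel_def using relations.add by fastforce
qed

quotient_type (overloaded) 'n tau_algebra = "'n::finite frobenius_data \<Rightarrow> 'n superpoly" / partial: tau_rel
  by (rule part_equivp_tau_rel)

instantiation tau_algebra :: (finite) ring
begin

lift_definition zero_tau_algebra :: "'a tau_algebra" is "\<lambda>_. 0"
  by (simp add: tau_rel_def relations.zero)

lift_definition plus_tau_algebra :: "'a tau_algebra \<Rightarrow> 'a tau_algebra \<Rightarrow> 'a tau_algebra"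
  is "\<lambda>F G M. F M + G M"
  unfolding tau_rel_def using relations.add add_dring by (fastforce simp: add_diff_add)

lift_definition uminus_tau_algebra :: "'a tau_algebra \<Rightarrow> 'a tau_algebra" is "\<lambda>F M. - F M"
  unfolding tau_rel_def using uminus_relations uminus_dring
  by (metis add.commute minus_diff_minus uminus_add_conv_diff)

lift_definition minus_tau_algebra :: "'a tau_algebra \<Rightarrow> 'a tau_algebra \<Rightarrow> 'a tau_algebra"
  is "\<lambda>F G M. F M - G M"
  unfolding tau_rel_def using diff_relations diff_dring by (fastforce simp: diff_diff_eq2 diff_add_eq algebra_simps)

lift_definition times_tau_algebra :: "'a tau_algebra \<Rightarrow> 'a tau_algebra \<Rightarrow> 'a tau_algebra"
  is "\<lambda>F G M. F M * G M"
proof -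
  fix F F' G G' :: "'a frobenius_data \<Rightarrow> 'a superpoly"
  assume r: "tau_rel F F'" "tau_rel G G'"
  have "F M * G M - F' M * G' M \<in> relations M" if "open (chart M)" for M
  proof -
    have "F M * G M - F' M * G' M = (F M - F' M) * G M + F' M * (G M - G' M)"
      by (simp add: algebra_simps)
    also have "\<dots> \<in> relations M"
      using r that unfolding tau_rel_def by (intro relations.add relations.lmult relations.rmult) auto
    finally show ?thesis .
  qed
  then show "tau_rel (\<lambda>M. F M * G M) (\<lambda>M. F' M * G' M)"
    using r mult_dring unfolding tau_rel_def by blast
qed

instance
proof
  fix a b c :: "'a tau_algebra"
  have eqI: "tau_rel F G" if "tau_rel F F" "F = G" for F G :: "'a frobenius_data \<Rightarrow> 'a superpoly"
    using that by simp
  note d = tau_rel_def relations.zero add_dring uminus_dring diff_dring mult_dring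
  show "a + b + c = a + (b + c)" by transfer (auto simp: d add.assoc)
  show "a + b = b + a" by transfer (auto simp: d add.commute)
  show "0 + a = a" by transfer (auto simp: d)
  show "- a + a = 0" by transfer (auto simp: d)
  show "a - b = a + - b" by transfer (auto simp: d)
  show "a * b * c = a * (b * c)" by transfer (auto simp: d mult.assoc)
  show "(a + b) * c = a * c + b * c" by transfer (auto simp: d distrib_right)
  show "a * (b + c) = a * b + a * c" by transfer (auto simp: d distrib_left)
qed

end

lemma tau_rel_component:
  "tau_rel (\<lambda>M'. if M' = M then a else 0) (\<lambda>M'. if M' = M then b else 0) \<longleftrightarrow>
     (open (chart M) \<longrightarrow> a \<in> dring M \<and> b \<in> dring M \<and> a - b \<in> relations M)" (is "?l \<longleftrightarrow> ?r")
proof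
  show "?l \<Longrightarrow> ?r" unfolding tau_rel_def by (drule spec[of _ M]) simp
  show "?r \<Longrightarrow> ?l" by (simp add: tau_rel_def relations.zero)
qed

text \<open>The value 0 outside \<open>dring M\<close> makes the class map total, so that laws such
  as \<open>\<phi>_cong\<close> and \<open>\<phi>_central\<close> hold without side
  conditions.\<close>

lift_definition cls :: "'n::finite frobenius_data \<Rightarrow> 'n superpoly \<Rightarrow> 'n tau_algebra" is
  "\<lambda>M a M'. if M' = M then if a \<in> dring M then a else 0 else 0"
  by (simp add: tau_rel_def relations.zero)

text \<open>Projection onto the factor of M. As the ring has no unit, the condition
  \<open>component M x = x\<close>, saying that x lies in this factor, replaces the unit
  laws.\<close>

lift_definition component :: "'n::finite frobenius_data \<Rightarrow> 'n tau_algebra \<Rightarrow> 'n tau_algebra" is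
  "\<lambda>M F M'. if M' = M then F M else 0"
  by (auto simp: tau_rel_def relations.zero)

lemma component_add: "component M (x + y) = component M x + component M y"
  by transfer (auto simp: tau_rel_def relations.zero add_dring)

lemma component_mult: "component M (x * y) = component M x * component M y"
  by transfer (auto simp: tau_rel_def relations.zero mult_dring)

lemma component_mult_left: "component M x * y = component M x * component M y"
  by transfer (auto simp: tau_rel_def relations.zero mult_dring)

lemma component_mult_right: "x * component M y = component M x * component M y"
  by transfer (auto simp: tau_rel_def relations.zero mult_dring)

lemma component_cls [simp]: "component M (cls M a) = cls M a"
  by transfer (auto simp: tau_rel_def relations.zero)

lemma cls_not_dring: "a \<notin> dring M \<Longrightarrow> cls M a = 0"
  by transfer (auto simp: tau_rel_def relations.zero)

lemma component_eq_cls: "open (chart M) \<Longrightarrow> \<exists>a\<in>dring M. cls M a = component M x"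
proof -
  have aux: "\<exists>a\<in>dring M. tau_rel (\<lambda>M'. if M' = M then if a \<in> dring M then a else 0 else 0)
      (\<lambda>M'. if M' = M then F M else 0)"
    if "tau_rel F F" "open (chart M)" for M :: "'b::finite frobenius_data" and F
    using that by (intro bexI[of _ "F M"]) (auto simp: tau_rel_def relations.zero)
  show "open (chart M) \<Longrightarrow> ?thesis" by transfer (rule aux)
qed

lemma abs_tau_algebra_eq_iff:
  assumes "tau_rel F F" "tau_rel G G"
  shows "abs_tau_algebra F = abs_tau_algebra G \<longleftrightarrow> tau_rel F G"
  using Quotient_rel[OF Quotient_tau_algebra, of F G] assms by blast

lemma cls_family:
  "tau_rel (\<lambda>M'. if M' = M then if a \<in> dring M then a else 0 else 0)
     (\<lambda>M'. if M' = M then if a \<in> dring M then a else 0 else 0)"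
  by (simp add: tau_rel_def relations.zero)

lemma cls_eq_iff:
  assumes "open (chart M)" "a \<in> dring M" "b \<in> dring M"
  shows "cls M a = cls M b \<longleftrightarrow> a - b \<in> relations M"
proof -
  have "tau_rel (\<lambda>M'. if M' = M then if a \<in> dring M then a else 0 else 0)
      (\<lambda>M'. if M' = M then if b \<in> dring M then b else 0 else 0) \<longleftrightarrow> a - b \<in> relations M"
    unfolding tau_rel_component using assms by simp
  then show ?thesis
    unfolding cls_def map_fun_apply id_apply abs_tau_algebra_eq_iff[OF cls_family cls_family] .
qed

lemma cls_add:
  assumes "open (chart M)" "a \<in> dring M" "b \<in> dring M"
  shows "cls M (a + b) = cls M a + cls M b"
proof -
  have "tau_rel (\<lambda>M'. if M' = M then if a + b \<in> dring M then a + b else 0 else 0)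
      (\<lambda>M'. (if M' = M then if a \<in> dring M then a else 0 else 0)
        + (if M' = M then if b \<in> dring M then b else 0 else 0))"
    using assms add_dring[OF assms] by (simp add: tau_rel_def relations.zero)
  then show ?thesis
    unfolding cls_def map_fun_apply id_apply plus_tau_algebra.abs_eq[OF cls_family cls_family]
    by (subst abs_tau_algebra_eq_iff) (auto simp: tau_rel_def relations.zero)
qed

lemma cls_mult:
  assumes "open (chart M)" "a \<in> dring M" "b \<in> dring M"
  shows "cls M (a * b) = cls M a * cls M b"
proof -
  have "tau_rel (\<lambda>M'. if M' = M then if a * b \<in> dring M then a * b else 0 else 0)
      (\<lambda>M'. (if M' = M then if a \<in> dring M then a else 0 else 0)
        * (if M' = M then if b \<in> dring M then b else 0 else 0))"
    using assms mult_dring[OF assms] by (simp add: tau_rel_def relations.zero)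
  then show ?thesis
    unfolding cls_def map_fun_apply id_apply times_tau_algebra.abs_eq[OF cls_family cls_family]
    by (subst abs_tau_algebra_eq_iff) (auto simp: tau_rel_def relations.zero)
qed

lemma cls_zero [simp]: "cls M 0 = 0"
  by transfer (auto simp: tau_rel_def relations.zero)

lemma cls_uminus:
  assumes "open (chart M)"
  shows "cls M (- a) = - cls M a"
proof (cases "a \<in> dring M")
  case True
  have "cls M a + cls M (- a) = cls M (a + - a)"
    by (rule cls_add[OF assms True uminus_dring[OF assms True], symmetric])
  also have "\<dots> = 0" unfolding right_minus by (rule cls_zero)
  finally show ?thesis by (rule minus_unique[symmetric])
next
  case False
  have "- a \<notin> dring M"
  proof
    assume "- a \<in> dring M"
    from uminus_dring[OF assms this] False show False by (simp only: minus_minus)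
  qed
  note e1 = cls_not_dring[OF this] and e2 = cls_not_dring[OF False]
  have "- cls M a = 0" unfolding e2 by (rule minus_zero)
  then show ?thesis by (rule trans[OF e1 sym])
qed

section \<open>Parity and positive super degree\<close>

lemma super_degree_Nil [simp]: "super_degree (Word []) = 0"
  and super_degree_Cons: "super_degree (Word (g # w)) = (if is_odd g then Suc else id) (super_degree (Word w))"
  by (simp_all add: super_degree_def)

locale tau_chart =
  fixes M :: "'n::finite frobenius_data"
  assumes open_chart: "open (chart M)"
begin

abbreviation "q \<equiv> cls M"
abbreviation "\<phi> f \<equiv> cls M (fn f)"
abbreviation "\<g> g \<equiv> cls M (gen g)"
abbreviation "holo \<equiv> holo_on (chart M)"

lemmas dring_intros = zero_dring one_dring mon_dring add_dring[OF open_chart]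
  uminus_dring[OF open_chart] diff_dring[OF open_chart] sum_dring[OF open_chart]
  mult_dring[OF open_chart]

lemmas q_eq_iff = cls_eq_iff[OF open_chart]
lemmas q_add = cls_add[OF open_chart]
lemmas q_mult = cls_mult[OF open_chart]
lemmas q_uminus = cls_uminus[OF open_chart]

lemma q_diff: "a \<in> dring M \<Longrightarrow> b \<in> dring M \<Longrightarrow> q (a - b) = q a - q b"
  using q_add[of a "- b"] by (simp add: q_uminus dring_intros)

lemma q_sum: "(\<And>i. i \<in> I \<Longrightarrow> f i \<in> dring M) \<Longrightarrow> q (sum f I) = (\<Sum>i\<in>I. q (f i))"
  by (induction I rule: infinite_finite_induct) (simp_all add: q_add dring_intros)

lemma q_eq_zero_iff: "a \<in> dring M \<Longrightarrow> q a = 0 \<longleftrightarrow> a \<in> relations M"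
  using q_eq_iff[of a 0] by (simp add: dring_intros)

lemma sreq_iff: "a \<in> dring M \<Longrightarrow> b \<in> dring M \<Longrightarrow> a \<approx>\<^bsub>M\<^esub> b \<longleftrightarrow> q a = q b"
  by (simp add: sreq_def q_eq_iff)

lemma holo_add: "holo f \<Longrightarrow> holo g \<Longrightarrow> holo (f + g)"
  and holo_mult: "holo f \<Longrightarrow> holo g \<Longrightarrow> holo (f * g)"
  and holo_uminus: "holo f \<Longrightarrow> holo (- f)"
  using open_chart by auto

lemma holo_sum: "(\<And>i. i \<in> I \<Longrightarrow> holo (f i)) \<Longrightarrow> holo (sum f I)"
  using open_chart by auto

lemma holo_lambda_mult: "holo (\<lambda>x. f x) \<Longrightarrow> holo (\<lambda>x. g x) \<Longrightarrow> holo (\<lambda>x. f x * g x)"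
  using holo_mult[of f g] by (simp add: times_fun_def)

lemma holo_lambda_add: "holo (\<lambda>x. f x) \<Longrightarrow> holo (\<lambda>x. g x) \<Longrightarrow> holo (\<lambda>x. f x + g x)"
  using holo_add[of f g] by (simp add: plus_fun_def)

lemma sum_fun_eq: "sum f I = (\<lambda>x. \<Sum>i\<in>I. f i x)"
  by (induction I rule: infinite_finite_induct) (auto simp: fun_eq_iff)

lemma holo_lambda_sum: "(\<And>i. i \<in> I \<Longrightarrow> holo (\<lambda>x. f i x)) \<Longrightarrow> holo (\<lambda>x. \<Sum>i\<in>I. f i x)"
  using holo_sum[of I f] by (simp add: sum_fun_eq)

lemma holo_cong: "(\<And>x. x \<in> chart M \<Longrightarrow> f x = g x) \<Longrightarrow> holo f \<longleftrightarrow> holo g"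
  by (rule holo_on_cong[OF open_chart])

text \<open>The rule \<open>chart_fn\<close> identifies functions that agree on the chart.
  Holomorphy depends only on those values too, so if it fails for one function it fails for both,
  and both classes are the default 0.\<close>

lemma \<phi>_cong:
  assumes "\<And>x. x \<in> chart M \<Longrightarrow> f x = g x"
  shows "\<phi> f = \<phi> g"
proof (cases "holo f")
  case True
  then have g: "holo g" using holo_cong[of f g] assms by simp
  have "fn f - fn g = fn (f - g)" by (simp add: fn_def single_diff)
  also have "\<dots> \<in> relations M"
  proof (rule relations.chart_fn)
    show "holo (f - g)" using holo_add[OF True holo_uminus[OF g]] by simp
  qed (simp add: assms)
  finally show ?thesis using True g by (simp add: q_eq_iff)
next
  case False
  then have "\<not> holo g" using holo_cong[of f g] assms by simp
  with False show ?thesis by (simp add: cls_not_dring)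
qed

lemma \<phi>_add: "holo f \<Longrightarrow> holo g \<Longrightarrow> \<phi> (f + g) = \<phi> f + \<phi> g"
  by (simp add: fn_add q_add)

lemma \<phi>_mult: "holo f \<Longrightarrow> holo g \<Longrightarrow> \<phi> (f * g) = \<phi> f * \<phi> g"
  by (simp add: fn_mult q_mult)

lemma \<phi>_sum: "(\<And>i. i \<in> I \<Longrightarrow> holo (f i)) \<Longrightarrow> \<phi> (sum f I) = (\<Sum>i\<in>I. \<phi> (f i))"
  by (induction I rule: infinite_finite_induct) (simp_all add: \<phi>_add holo_sum del: plus_fun_apply)

text \<open>A choice of representatives, through which \<open>dd\<close> and \<open>hat\<close>
  carry maps of the free algebra over to the quotient.\<close>

definition rep :: "'n tau_algebra \<Rightarrow> 'n superpoly" where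
  "rep x = (SOME a. a \<in> dring M \<and> q a = component M x)"

lemma rep_dring [simp]: "rep x \<in> dring M" and q_rep: "q (rep x) = component M x"
proof -
  have "rep x \<in> dring M \<and> q (rep x) = component M x"
    unfolding rep_def by (rule someI_ex) (use component_eq_cls[OF open_chart, of x] in blast)
  then show "rep x \<in> dring M" "q (rep x) = component M x" by auto
qed

lemma component_zero [simp]: "component M 0 = 0"
  using component_add[of M 0 0] by simp

lemma \<phi>_central: "\<phi> f * x = x * \<phi> f"
proof (cases "holo f")
  case True
  have "\<phi> f * x = component M (\<phi> f) * component M x" using component_mult_left[of M "\<phi> f" x] by simp
  also have "\<dots> = q (fn f * rep x)" using True by (simp add: q_mult q_rep)
  also have "\<dots> = component M x * component M (\<phi> f)"
    using True by (subst fn_central) (simp add: q_mult q_rep)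
  also have "\<dots> = x * \<phi> f" using component_mult_right[of x M "\<phi> f"] by simp
  finally show ?thesis .
qed (simp add: cls_not_dring)

lemma \<phi>_left_commute: "x * (\<phi> f * y) = \<phi> f * (x * y)"
  by (metis \<phi>_central mult.assoc)

text \<open>\<open>q 1\<close> is the unit of the factor of M only, so in the whole ring it acts as
  the projection.\<close>

lemma q_one_mult: "q 1 * x = component M x"
proof -
  have "q 1 * x = q 1 * component M x" using component_mult_left[of M "q 1" x] by simp
  also have "\<dots> = component M x" using q_mult[of 1 "rep x"] by (simp add: q_rep dring_intros)
  finally show ?thesis .
qed

lemma q_one_mult_q [simp]: "q 1 * q a = q a" "q 1 * (q a * x) = q a * x"
  by (simp_all add: q_one_mult mult.assoc[symmetric])

text \<open>Parity of a class means that some representative has it; 0 has every parity, and the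
  index counts only modulo 2.\<close>

definition par :: "nat \<Rightarrow> 'n tau_algebra \<Rightarrow> bool" where
  "par i x \<longleftrightarrow> (\<exists>a\<in>dring M. has_parity i a \<and> q a = x)"

text \<open>Unlike odd parity, this includes products of two odd elements. It is the form of
  positivity that the rule \<open>no_odd_constants\<close> asks for.\<close>

definition pos :: "'n tau_algebra \<Rightarrow> bool" where
  "pos x \<longleftrightarrow> (\<exists>a\<in>dring M. positive_degree a \<and> q a = x)"

lemma par_component: "par i x \<Longrightarrow> component M x = x"
  unfolding par_def by auto

lemma par_cong: "even (i + j) \<Longrightarrow> par i x \<longleftrightarrow> par j x"
proof -
  assume "even (i + j)"
  then have "has_parity i a \<longleftrightarrow> has_parity j a" for a :: "'n superpoly"
    unfolding has_parity_def by (auto simp: even_add)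
  then show ?thesis by (simp add: par_def)
qed

lemma par_zero [simp]: "par i 0"
  unfolding par_def by (rule bexI[of _ 0]) (simp_all add: has_parity_def)

lemma keys_add_subset: "Poly_Mapping.keys (a + b) \<subseteq> Poly_Mapping.keys a \<union> Poly_Mapping.keys b"
  by (rule Poly_Mapping.keys_add)

lemma par_add: "par i x \<Longrightarrow> par i y \<Longrightarrow> par i (x + y)"
  unfolding par_def
proof (elim bexE conjE)
  fix a b assume "a \<in> dring M" "has_parity i a" "q a = x" "b \<in> dring M" "has_parity i b" "q b = y"
  then show "\<exists>c\<in>dring M. has_parity i c \<and> q c = x + y"
    using keys_add_subset[of a b]
    by (intro bexI[of _ "a + b"]) (auto simp: has_parity_def q_add dring_intros)
qed

lemma par_uminus: "par i x \<Longrightarrow> par i (- x)"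
  unfolding par_def
proof (elim bexE conjE)
  fix a assume "a \<in> dring M" "has_parity i a" "q a = x"
  then show "\<exists>c\<in>dring M. has_parity i c \<and> q c = - x"
    by (intro bexI[of _ "- a"]) (auto simp: has_parity_def Poly_Mapping.keys_minus q_uminus dring_intros)
qed

lemma par_parity_sign: "par i x \<Longrightarrow> par i (parity_sign n x)"
  by (simp add: parity_sign_def par_uminus)

lemma par_sum: "(\<And>k. k \<in> K \<Longrightarrow> par i (f k)) \<Longrightarrow> par i (sum f K)"
  by (induction K rule: infinite_finite_induct) (auto intro: par_add)

lemma par_mult: "par i x \<Longrightarrow> par j y \<Longrightarrow> par (i + j) (x * y)"
  unfolding par_def
proof (elim bexE conjE)
  fix a b assume a: "a \<in> dring M" "has_parity i a" "q a = x"
    and b: "b \<in> dring M" "has_parity j b" "q b = y"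
  have "has_parity (i + j) (a * b)"
    unfolding has_parity_def
  proof
    fix w assume "w \<in> Poly_Mapping.keys (a * b)"
    then obtain u v where "w = u + v" "u \<in> Poly_Mapping.keys a" "v \<in> Poly_Mapping.keys b"
      using keys_mult[of a b] by blast
    then show "even (super_degree w + (i + j))"
      using a(2) b(2) unfolding has_parity_def by (auto simp: even_add)
  qed
  then show "\<exists>c\<in>dring M. has_parity (i + j) c \<and> q c = x * y"
    using a b by (intro bexI[of _ "a * b"]) (auto simp: q_mult dring_intros)
qed

lemma has_parity_single: "has_parity i (Poly_Mapping.single w f) \<longleftrightarrow> f = 0 \<or> even (super_degree w + i)"
  by (auto simp: has_parity_def)

lemma par_\<phi> [simp]: "par 0 (\<phi> f)"
proof (cases "holo f")
  case True
  then show ?thesis unfolding par_def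
    by (intro bexI[of _ "fn f"]) (auto simp: fn_def has_parity_single)
qed (simp add: cls_not_dring)

lemma par_\<phi>_mult: "par i x \<Longrightarrow> par i (\<phi> f * x)"
  using par_mult[OF par_\<phi>, of i x f] by simp

lemma has_parity_mon: "has_parity (super_degree (Word w)) (mon w)"
  by (simp add: mon_def has_parity_single)

lemma par_mon: "par (super_degree (Word w)) (q (mon w))"
  unfolding par_def using has_parity_mon by (intro bexI[of _ "mon w"]) auto

lemma par_gen: "par (if is_odd g then 1 else 0) (\<g> g)"
  using par_mon[of "[g]"] by (simp add: super_degree_Cons split: if_splits)

lemma pos_zero [simp]: "pos 0"
  unfolding pos_def by (rule bexI[of _ 0]) (simp_all add: positive_degree_def)

lemma pos_add: "pos x \<Longrightarrow> pos y \<Longrightarrow> pos (x + y)"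
  unfolding pos_def
proof (elim bexE conjE)
  fix a b assume "a \<in> dring M" "positive_degree a" "q a = x" "b \<in> dring M" "positive_degree b" "q b = y"
  then show "\<exists>c\<in>dring M. positive_degree c \<and> q c = x + y"
    using keys_add_subset[of a b]
    by (intro bexI[of _ "a + b"]) (auto simp: positive_degree_def q_add dring_intros)
qed

lemma pos_uminus: "pos x \<Longrightarrow> pos (- x)"
  unfolding pos_def
proof (elim bexE conjE)
  fix a assume "a \<in> dring M" "positive_degree a" "q a = x"
  then show "\<exists>c\<in>dring M. positive_degree c \<and> q c = - x"
    by (intro bexI[of _ "- a"]) (auto simp: positive_degree_def Poly_Mapping.keys_minus q_uminus dring_intros)
qed

lemma pos_diff: "pos x \<Longrightarrow> pos y \<Longrightarrow> pos (x - y)"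
  using pos_add[OF _ pos_uminus, of x y] by simp

lemma pos_parity_sign: "pos x \<Longrightarrow> pos (parity_sign n x)"
  by (simp add: parity_sign_def pos_uminus)

lemma pos_sum: "(\<And>k. k \<in> K \<Longrightarrow> pos (f k)) \<Longrightarrow> pos (sum f K)"
  by (induction K rule: infinite_finite_induct) (auto intro: pos_add)

lemma pos_mult_left: "pos x \<Longrightarrow> pos (x * y)" and pos_mult_right: "pos x \<Longrightarrow> pos (y * x)"
proof -
  assume "pos x"
  then obtain a where a: "a \<in> dring M" "positive_degree a" "q a = x" unfolding pos_def by auto
  have "positive_degree (a * rep y)" "positive_degree (rep y * a)"
    using a(2) keys_mult[of a "rep y"] keys_mult[of "rep y" a]
    unfolding positive_degree_def by (auto dest!: subsetD)
  moreover have "q (a * rep y) = x * y" "q (rep y * a) = y * x"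
    using a component_mult_left[of M x y] component_mult_right[of y M x]
    by (auto simp: q_mult q_rep)
  ultimately show "pos (x * y)" "pos (y * x)"
    unfolding pos_def using a(1) by (metis mult_dring[OF open_chart] rep_dring)+
qed

lemma par_odd_pos: "par i x \<Longrightarrow> odd i \<Longrightarrow> pos x"
proof -
  assume "par i x" "odd i"
  then obtain a where a: "a \<in> dring M" "has_parity i a" "q a = x" unfolding par_def by auto
  have "positive_degree a"
    using a(2) \<open>odd i\<close> unfolding has_parity_def positive_degree_def by (auto intro: odd_pos)
  then show ?thesis using a unfolding pos_def by auto
qed

lemma pos_gen: "is_odd g \<Longrightarrow> pos (\<g> g)"
  using par_odd_pos[OF par_gen, of g] by simp

lemma pos_mon: "super_degree (Word w) > 0 \<Longrightarrow> pos (q (mon w))"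
  unfolding pos_def by (intro bexI[of _ "mon w"]) (auto simp: positive_degree_def mon_def)

lemma gen_supercommute:
  "\<g> g * \<g> g' = parity_sign (if is_odd g \<and> is_odd g' then 1 else 0) (\<g> g' * \<g> g)"
proof -
  have "q (gen g * gen g') = q ((if is_odd g \<and> is_odd g' then - 1 else 1) * (gen g' * gen g))"
    using relations.supercommute[of g g' M] by (subst q_eq_iff) (auto intro: dring_intros)
  then show ?thesis by (auto simp: q_mult q_uminus dring_intros)
qed

lemma gen_mon_supercommute:
  "\<g> g * q (mon w) = parity_sign (super_degree (Word [g]) * super_degree (Word w)) (q (mon w) * \<g> g)"
proof (induction w)
  case Nil
  have "q 1 * \<g> g = \<g> g" "\<g> g * q 1 = \<g> g"
    using q_mult[of 1 "gen g"] q_mult[of "gen g" 1] by (simp_all add: dring_intros)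
  then show ?case by simp
next
  case (Cons h w)
  have "\<g> g * q (mon (h # w)) = \<g> g * \<g> h * q (mon w)"
    by (simp add: mon_Cons[of h w] q_mult mult.assoc dring_intros)
  also have "\<dots> = parity_sign (super_degree (Word [g]) * super_degree (Word [h])) (\<g> h * (\<g> g * q (mon w)))"
    unfolding gen_supercommute[of g h]
    by (simp add: parity_sign_mult_left mult.assoc super_degree_Cons parity_sign_def)
  also have "\<dots> = parity_sign (super_degree (Word [g]) * super_degree (Word (h # w))) (\<g> h * (q (mon w) * \<g> g))"
    unfolding Cons
    by (auto simp: parity_sign_mult_right super_degree_Cons parity_sign_def)
  finally show ?case by (simp add: mon_Cons[of h w] q_mult mult.assoc dring_intros)
qed

lemma mon_supercommute:
  "q (mon v) * q (mon w) = parity_sign (super_degree (Word v) * super_degree (Word w)) (q (mon w) * q (mon v))"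
proof (induction v)
  case Nil
  then show ?case using q_mult[of 1 "mon w"] q_mult[of "mon w" 1] by (simp add: dring_intros)
next
  case (Cons g v)
  have "q (mon (g # v)) * q (mon w) = \<g> g * (q (mon v) * q (mon w))"
    by (simp add: mon_Cons[of g v] q_mult mult.assoc dring_intros)
  also have "\<dots> = parity_sign (super_degree (Word v) * super_degree (Word w)) (\<g> g * q (mon w) * q (mon v))"
    unfolding Cons by (simp add: parity_sign_mult_right mult.assoc)
  also have "\<dots> = parity_sign (super_degree (Word (g # v)) * super_degree (Word w)) (q (mon w) * (\<g> g * q (mon v)))"
    unfolding gen_mon_supercommute[of g w]
    by (auto simp: parity_sign_mult_left mult.assoc super_degree_Cons parity_sign_def)
  finally show ?case by (simp add: mon_Cons[of g v] q_mult dring_intros)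
qed

lemma q_single: "holo f \<Longrightarrow> q (Poly_Mapping.single w f) = \<phi> f * q (mon (letters w))"
  by (simp add: single_eq_fn_mon q_mult)

text \<open>By bilinearity only monomials have to be compared. Their sign is governed by the super
  degrees of the words, which agree modulo 2 with i and j because the words are keys of homogeneous
  representatives.\<close>

lemma supercommute:
  assumes "par i x" "par j y"
  shows "x * y = parity_sign (i * j) (y * x)"
proof -
  obtain a b where a: "a \<in> dring M" "has_parity i a" "q a = x"
    and b: "b \<in> dring M" "has_parity j b" "q b = y"
    using assms unfolding par_def by auto
  have "q a * q b = parity_sign (i * j) (q b * q a)"
    using open_chart a(1)
  proof (induction rule: dring_induct)
    case (single v f)
    note v = single
    show ?case using open_chart b(1)
    proof (induction rule: dring_induct)
      case (single w g)
      let ?v = "q (mon (letters v))" and ?w = "q (mon (letters w))"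
      have "even (super_degree v + i)" "even (super_degree w + j)"
        using v single a(2) b(2) by (auto simp: has_parity_def)
      then have s: "parity_sign (super_degree v * super_degree w) z = parity_sign (i * j) z" for z :: "'n tau_algebra"
        by (auto simp: parity_sign_def)
      have "?v * ?w = parity_sign (i * j) (?w * ?v)"
        using mon_supercommute[of "letters v" "letters w"] by (simp add: s)
      then have "\<phi> f * ?v * (\<phi> g * ?w) = parity_sign (i * j) (\<phi> f * (\<phi> g * (?w * ?v)))"
        by (simp only: mult.assoc \<phi>_left_commute[of ?v g] parity_sign_mult_right)
      also have "\<phi> f * (\<phi> g * (?w * ?v)) = \<phi> g * ?w * (\<phi> f * ?v)"
        by (simp only: mult.assoc \<phi>_left_commute[of ?w f] \<phi>_left_commute[of "\<phi> f" g])
      finally show ?case using v(2) single(2) by (simp only: q_single)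
    qed (simp_all add: q_add distrib_left distrib_right parity_sign_add)
  qed (simp_all add: q_add distrib_left distrib_right parity_sign_add)
  then show ?thesis using a b by simp
qed

lemma no_odd_constants_q:
  assumes "a \<in> dring M" "positive_degree a" "dx M a \<in> relations M"
  shows "q a = 0"
  using relations.no_odd_constants[OF assms] assms(1) by (simp add: q_eq_zero_iff)

end

section \<open>Derivations given on generators\<close>

abbreviation gdeg :: "'n gen \<Rightarrow> nat" where
  "gdeg g \<equiv> (if is_odd g then 1 else 0)"

lemma super_degree_Cons_gdeg: "super_degree (Word (g # w)) = gdeg g + super_degree (Word w)"
  by (simp add: super_degree_Cons)

lemma word_letters [simp]: "Word (letters w) = w"
  by (cases w) simp

lemma letters_plus [simp]: "letters (u + w) = letters u @ letters w"
  by (simp add: plus_word_def)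

lemma parity_sign_commute: "parity_sign m (parity_sign n x) = parity_sign n (parity_sign m x)"
  by (simp add: parity_sign_def)

text \<open>The prescribed values lie in the quotient, but D below is defined on the free algebra,
  where a derivation may take any values on generators. Whether it respects the relations is a
  separate question, answered for flows by \<open>twist_D_relations\<close>.\<close>

locale tau_derivation = tau_chart M for M :: "'n::finite frobenius_data" +
  fixes e :: nat and d :: "'n gen \<Rightarrow> 'n tau_algebra"
  assumes par_d: "par (e + gdeg g) (d g)"
begin

primrec dword :: "'n gen list \<Rightarrow> 'n tau_algebra" where
  "dword [] = 0"
| "dword (g # w) = d g * q (mon w) + parity_sign (e * gdeg g) (\<g> g * dword w)"

definition dfn :: "'n scalar_fn \<Rightarrow> 'n tau_algebra" where
  "dfn f = (\<Sum>\<alpha>\<in>UNIV. \<phi> (pd \<alpha> f) * d (V \<alpha> 0))"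

definition dterm :: "'n gen word \<Rightarrow> 'n scalar_fn \<Rightarrow> 'n tau_algebra" where
  "dterm w f = dfn f * q (mon (letters w)) + \<phi> f * dword (letters w)"

definition D :: "'n superpoly \<Rightarrow> 'n tau_algebra" where
  "D a = (\<Sum>w\<in>Poly_Mapping.keys a. dterm w (Poly_Mapping.lookup a w))"

text \<open>The projection to the quotient, preceded by the e-th power of the parity automorphism.
  With it the Leibniz rule \<open>D_mult\<close> holds for all elements, homogeneous or not.\<close>

definition twist :: "'n superpoly \<Rightarrow> 'n tau_algebra" where
  "twist a = (\<Sum>w\<in>Poly_Mapping.keys a. parity_sign (e * super_degree w) (\<phi> (Poly_Mapping.lookup a w) * q (mon (letters w))))"

lemma dfn_add: "holo f \<Longrightarrow> holo g \<Longrightarrow> dfn (f + g) = dfn f + dfn g"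
proof -
  assume h: "holo f" "holo g"
  have "\<phi> (pd \<alpha> (f + g)) = \<phi> (pd \<alpha> f) + \<phi> (pd \<alpha> g)" for \<alpha>
    using \<phi>_cong[of "pd \<alpha> (f + g)" "pd \<alpha> f + pd \<alpha> g"] h
    by (simp add: pd_add \<phi>_add holo_on_pd del: plus_fun_apply) (simp add: pd_add)
  then show ?thesis by (simp add: dfn_def distrib_right sum.distrib)
qed

lemma dfn_mult: "holo f \<Longrightarrow> holo g \<Longrightarrow> dfn (f * g) = dfn f * \<phi> g + \<phi> f * dfn g"
proof -
  assume h: "holo f" "holo g"
  have "\<phi> (pd \<alpha> (f * g)) = \<phi> (pd \<alpha> f * g + f * pd \<alpha> g)" for \<alpha>
    by (rule \<phi>_cong) (simp add: pd_mult[OF h])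
  then have "\<phi> (pd \<alpha> (f * g)) = \<phi> (pd \<alpha> f) * \<phi> g + \<phi> f * \<phi> (pd \<alpha> g)" for \<alpha>
    using h by (simp add: \<phi>_add \<phi>_mult holo_on_pd holo_mult)
  then have "dfn (f * g) = (\<Sum>\<alpha>\<in>UNIV. \<phi> (pd \<alpha> f) * (\<phi> g * d (V \<alpha> 0)) + \<phi> f * (\<phi> (pd \<alpha> g) * d (V \<alpha> 0)))"
    by (simp add: dfn_def distrib_right mult.assoc)
  then show ?thesis
    by (simp add: dfn_def sum.distrib sum_distrib_left sum_distrib_right mult.assoc \<phi>_central[of g])
qed

lemma dfn_cong: "(\<And>x. x \<in> chart M \<Longrightarrow> f x = g x) \<Longrightarrow> dfn f = dfn g"
  unfolding dfn_def by (intro sum.cong refl arg_cong2[where f = "(*)"] \<phi>_cong pd_cong[OF open_chart]) auto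

lemma dfn_zero [simp]: "dfn 0 = 0"
proof -
  have "pd \<alpha> (0::'n scalar_fn) = 0" for \<alpha> by (simp add: fun_eq_iff)
  then show ?thesis by (simp add: dfn_def)
qed

lemma dfn_const [simp]: "dfn (\<lambda>_. c) = 0"
proof -
  have "pd \<alpha> (\<lambda>_::complex^'n. c) = 0" for \<alpha> by (simp add: fun_eq_iff pd_const)
  then show ?thesis by (simp add: dfn_def)
qed

lemma dfn_one [simp]: "dfn 1 = 0"
  using dfn_const[of 1] by (simp add: one_fun_def)

lemma dfn_sum: "(\<And>i. i \<in> I \<Longrightarrow> holo (f i)) \<Longrightarrow> dfn (sum f I) = (\<Sum>i\<in>I. dfn (f i))"
  by (induction I rule: infinite_finite_induct) (simp_all add: dfn_add holo_sum del: plus_fun_apply)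

lemma dterm_add: "holo f \<Longrightarrow> holo g \<Longrightarrow> dterm w (f + g) = dterm w f + dterm w g"
  by (simp add: dterm_def dfn_add \<phi>_add algebra_simps)

lemma dterm_zero [simp]: "dterm w 0 = 0"
  by (simp add: dterm_def)

lemma D_superset:
  assumes "finite K" "Poly_Mapping.keys a \<subseteq> K"
  shows "D a = (\<Sum>w\<in>K. dterm w (Poly_Mapping.lookup a w))"
  unfolding D_def by (rule sum.mono_neutral_left) (use assms in \<open>auto simp: in_keys_iff\<close>)

lemma twist_superset:
  assumes "finite K" "Poly_Mapping.keys a \<subseteq> K"
  shows "twist a = (\<Sum>w\<in>K. parity_sign (e * super_degree w) (\<phi> (Poly_Mapping.lookup a w) * q (mon (letters w))))"
  unfolding twist_def by (rule sum.mono_neutral_left) (use assms in \<open>auto simp: in_keys_iff\<close>)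

lemma D_add: "a \<in> dring M \<Longrightarrow> b \<in> dring M \<Longrightarrow> D (a + b) = D a + D b"
  using D_superset[of "Poly_Mapping.keys a \<union> Poly_Mapping.keys b" "a + b"]
    D_superset[of "Poly_Mapping.keys a \<union> Poly_Mapping.keys b" a]
    D_superset[of "Poly_Mapping.keys a \<union> Poly_Mapping.keys b" b] keys_add_subset[of a b]
  by (simp add: lookup_add dterm_add dring_lookup sum.distrib del: plus_fun_apply)

lemma twist_add: "a \<in> dring M \<Longrightarrow> b \<in> dring M \<Longrightarrow> twist (a + b) = twist a + twist b"
  using twist_superset[of "Poly_Mapping.keys a \<union> Poly_Mapping.keys b" "a + b"]
    twist_superset[of "Poly_Mapping.keys a \<union> Poly_Mapping.keys b" a]
    twist_superset[of "Poly_Mapping.keys a \<union> Poly_Mapping.keys b" b] keys_add_subset[of a b]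
  by (simp add: lookup_add \<phi>_add dring_lookup sum.distrib distrib_right parity_sign_add del: plus_fun_apply)

lemma D_zero [simp]: "D 0 = 0" and twist_zero [simp]: "twist 0 = 0"
  by (simp_all add: D_def twist_def)

lemma D_single: "D (Poly_Mapping.single w f) = dterm w f"
  by (simp add: D_def)

lemma twist_single: "holo f \<Longrightarrow> twist (Poly_Mapping.single w f) = parity_sign (e * super_degree w) (q (Poly_Mapping.single w f))"
  by (simp add: twist_def q_single)

lemma D_uminus: "a \<in> dring M \<Longrightarrow> D (- a) = - D a"
  using D_add[of a "- a"] by (simp add: dring_intros eq_neg_iff_add_eq_0 add.commute)

lemma D_diff: "a \<in> dring M \<Longrightarrow> b \<in> dring M \<Longrightarrow> D (a - b) = D a - D b"
  using D_add[of a "- b"] by (simp add: D_uminus dring_intros)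

lemma D_sum: "(\<And>i. i \<in> I \<Longrightarrow> f i \<in> dring M) \<Longrightarrow> D (sum f I) = (\<Sum>i\<in>I. D (f i))"
  by (induction I rule: infinite_finite_induct) (simp_all add: D_add dring_intros)

lemma d_component [simp]: "component M (d g) = d g"
  using par_component[OF par_d] .

lemma mult_q_one: "component M x = x \<Longrightarrow> x * q 1 = x"
  using q_one_mult[of x] \<phi>_central[of 1 x] by simp

lemma dfn_component [simp]: "component M (dfn f) = dfn f"
proof -
  have "component M (\<Sum>i\<in>I. \<phi> (f i) * d (g i)) = (\<Sum>i\<in>I. \<phi> (f i) * d (g i))"
    for I :: "'n set" and f g
    by (induction I rule: infinite_finite_induct) (simp_all add: component_add component_mult)
  then show ?thesis by (simp add: dfn_def)
qed

lemma D_fn [simp]: "D (fn f) = dfn f"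
  by (simp add: fn_def D_single dterm_def zero_word_def mult_q_one)

lemma D_gen [simp]: "D (gen g) = d g"
  by (simp add: mon_def[of "[g]"] D_single dterm_def mult_q_one q_one_mult)

lemma par_dfn: "par e (dfn f)"
  unfolding dfn_def using par_\<phi>_mult[OF par_d[of "V _ 0"]] by (intro par_sum) simp

lemma par_dword: "par (e + super_degree (Word w)) (dword w)"
proof (induction w)
  case (Cons g w)
  have "par (e + gdeg g + super_degree (Word w)) (d g * q (mon w))"
    by (rule par_mult[OF par_d par_mon])
  moreover have "par (gdeg g + (e + super_degree (Word w))) (\<g> g * dword w)"
    by (rule par_mult[OF par_gen Cons])
  ultimately show ?case
    unfolding dword.simps super_degree_Cons_gdeg
    by (intro par_add par_parity_sign) (simp_all only: ac_simps)
qed simp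

lemma dword_append:
  "dword (v @ w) = dword v * q (mon w) + parity_sign (e * super_degree (Word v)) (q (mon v) * dword w)"
proof (induction v)
  case Nil
  have "component M (dword w) = dword w" using par_component[OF par_dword] .
  then show ?case by (simp add: q_one_mult)
next
  case (Cons g v)
  have "dword ((g # v) @ w) = d g * q (mon v) * q (mon w)
      + parity_sign (e * gdeg g) (\<g> g * (dword v * q (mon w) + parity_sign (e * super_degree (Word v)) (q (mon v) * dword w)))"
    by (simp only: append_Cons dword.simps Cons mon_append q_mult[OF mon_dring mon_dring] mult.assoc)
  also have "\<dots> = dword (g # v) * q (mon w) + parity_sign (e * super_degree (Word (g # v))) (q (mon (g # v)) * dword w)"
    unfolding dword.simps super_degree_Cons_gdeg mon_Cons[of g v] q_mult[OF mon_dring mon_dring]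
    by (simp add: distrib_left distrib_right parity_sign_add parity_sign_mult_left parity_sign_mult_right
        parity_sign_plus mult.assoc add.assoc del: dword.simps)
  finally show ?case .
qed

lemma dterm_mult:
  assumes "holo f" "holo g"
  shows "dterm (v + w) (f * g) = dterm v f * (\<phi> g * q (mon (letters w)))
    + parity_sign (e * super_degree v) (\<phi> f * q (mon (letters v)) * dterm w g)"
proof -
  let ?v = "q (mon (letters v))" and ?w = "q (mon (letters w))"
  let ?s = "parity_sign (e * super_degree v)"
  \<comment> \<open>Coefficients are collected in front of the words, so the derivative of g, of
    parity e, arrives to the left of v; moving it behind v yields the sign of the Leibniz
    rule.\<close>
  have c: "dfn g * ?v = ?s (?v * dfn g)"
    using supercommute[OF par_dfn par_mon[of "letters v"], of g] by simp
  have "dterm (v + w) (f * g) = (dfn f * \<phi> g + \<phi> f * dfn g) * (?v * ?w)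
      + \<phi> f * \<phi> g * (dword (letters v) * ?w + ?s (?v * dword (letters w)))"
    unfolding dterm_def dfn_mult[OF assms] \<phi>_mult[OF assms] letters_plus mon_append
      dword_append q_mult[OF mon_dring mon_dring] word_letters ..
  also have "\<dots> = dfn f * (\<phi> g * (?v * ?w)) + \<phi> f * (dfn g * ?v * ?w)
      + (\<phi> f * (\<phi> g * (dword (letters v) * ?w)) + \<phi> f * (\<phi> g * ?s (?v * dword (letters w))))"
    by (simp only: distrib_left distrib_right mult.assoc)
  also have "\<phi> f * (dfn g * ?v * ?w) = ?s (\<phi> f * ?v * (dfn g * ?w))"
    by (simp only: c parity_sign_mult_left parity_sign_mult_right mult.assoc)
  also have "dfn f * (\<phi> g * (?v * ?w)) = dfn f * ?v * (\<phi> g * ?w)"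
    by (simp only: mult.assoc \<phi>_left_commute[of ?v g])
  also have "\<phi> f * (\<phi> g * (dword (letters v) * ?w)) = \<phi> f * dword (letters v) * (\<phi> g * ?w)"
    by (simp only: mult.assoc \<phi>_left_commute[of "dword (letters v)" g])
  also have "\<phi> f * (\<phi> g * ?s (?v * dword (letters w))) = ?s (\<phi> f * ?v * (\<phi> g * dword (letters w)))"
    by (simp only: mult.assoc \<phi>_left_commute[of ?v g] parity_sign_mult_right)
  finally show ?thesis
    by (simp add: dterm_def distrib_left distrib_right parity_sign_add add.assoc add.left_commute
        del: times_fun_apply)
qed

lemma D_mult:
  assumes "a \<in> dring M" "b \<in> dring M"
  shows "D (a * b) = D a * q b + twist a * D b"
  using open_chart assms(1)
proof (induction rule: dring_induct)
  case (single v f)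
  note v = single
  show ?case using open_chart assms(2)
  proof (induction rule: dring_induct)
    case (single w g)
    then show ?case using v dterm_mult[of f g v w]
      by (simp add: mult_single D_single twist_single q_single parity_sign_mult_left)
  next
    case (add a b)
    with v show ?case by (simp add: D_add q_add distrib_left dring_intros)
  qed simp
next
  case (add a b)
  with assms show ?case by (simp add: D_add q_add twist_add distrib_right dring_intros algebra_simps)
qed simp

lemma twist_mult:
  assumes "a \<in> dring M" "b \<in> dring M"
  shows "twist (a * b) = twist a * twist b"
  using open_chart assms(1)
proof (induction rule: dring_induct)
  case (single v f)
  note v = single
  show ?case using open_chart assms(2)
  proof (induction rule: dring_induct)
    case (single w g)
    then show ?case using v
      by (simp add: mult_single twist_single holo_mult q_mult[symmetric] parity_sign_mult_left
          parity_sign_mult_right parity_sign_plus distrib_left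
          parity_sign_commute[of "e * super_degree v"])
  next
    case (add a b)
    with v show ?case by (simp add: twist_add distrib_left dring_intros)
  qed simp
next
  case (add a b)
  with assms show ?case by (simp add: twist_add distrib_right dring_intros)
qed simp

lemma twist_homogeneous:
  assumes "a \<in> dring M" "has_parity i a"
  shows "twist a = parity_sign (e * i) (q a)"
  using open_chart assms(1)
proof (induction rule: dring_induct)
  case (single w f)
  then have "even (super_degree w + i)" using assms(2) by (auto simp: has_parity_def)
  with single show ?case by (simp add: twist_single parity_sign_def)
qed (simp_all add: twist_add q_add parity_sign_add)

lemma twist_fn [simp]: "twist (fn f) = \<phi> f"
  by (cases "f = 0") (simp_all add: twist_def fn_def mult_q_one zero_word_def)

lemma twist_gen: "twist (gen g) = parity_sign (e * gdeg g) (\<g> g)"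
  using twist_homogeneous[of "gen g" "gdeg g"] has_parity_mon[of "[g]"]
  by (cases "is_odd g") (simp_all add: super_degree_Cons)

lemma D_mult_homogeneous:
  "a \<in> dring M \<Longrightarrow> b \<in> dring M \<Longrightarrow> has_parity i a \<Longrightarrow> D (a * b) = D a * q b + parity_sign (e * i) (q a * D b)"
  by (simp add: D_mult twist_homogeneous parity_sign_mult_left)

lemma D_fn_mult: "holo f \<Longrightarrow> b \<in> dring M \<Longrightarrow> D (fn f * b) = dfn f * q b + \<phi> f * D b"
  by (simp add: D_mult)

lemma D_gen_mult: "b \<in> dring M \<Longrightarrow> D (gen g * b) = d g * q b + parity_sign (e * gdeg g) (\<g> g * D b)"
  by (simp add: D_mult twist_gen parity_sign_mult_left)

lemma D_mon: "D (mon w) = dword w"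
  using par_component[OF par_dword[of w]] by (simp add: mon_def D_single dterm_def q_one_mult)

lemma par_D:
  assumes "a \<in> dring M" "has_parity i a"
  shows "par (e + i) (D a)"
  using open_chart assms(1)
proof (induction rule: dring_induct)
  case (single w f)
  then have "even (e + super_degree w + (e + i))" using assms(2) by (auto simp: has_parity_def)
  note pc = par_cong[OF this]
  have "par (e + super_degree w) (dfn f * q (mon (letters w)))"
    using par_mult[OF par_dfn par_mon[of "letters w"]] by simp
  moreover have "par (e + super_degree w) (\<phi> f * dword (letters w))"
    using par_\<phi>_mult[OF par_dword[of "letters w"]] by simp
  ultimately show ?case unfolding D_single dterm_def pc[symmetric] by (rule par_add)
qed (simp_all add: D_add par_add)

text \<open>In each Leibniz term of a word with an odd letter, either an odd letter survives or it
  was the one replaced by its value, which is positive by assumption.\<close>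

lemma pos_D:
  assumes "\<And>g. is_odd g \<Longrightarrow> pos (d g)" "a \<in> dring M" "positive_degree a"
  shows "pos (D a)"
  using open_chart assms(2)
proof (induction rule: dring_induct)
  case (single w f)
  then have w: "super_degree w > 0" using assms(3) by (auto simp: positive_degree_def)
  have "pos (dword v)" if "super_degree (Word v) > 0" for v
    using that
  proof (induction v)
    case (Cons g v)
    show ?case
    proof (cases "is_odd g")
      case True
      then show ?thesis
        by (simp add: pos_add pos_mult_left assms(1) pos_parity_sign pos_gen)
    next
      case False
      then have "super_degree (Word v) > 0" using Cons.prems by (simp add: super_degree_Cons)
      then show ?thesis
        by (simp add: pos_add pos_mult_right pos_mon pos_parity_sign Cons.IH)
    qed
  qed simp
  with w pos_mon[of "letters w"] show ?case
    by (simp add: D_single dterm_def pos_add pos_mult_right)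
qed (simp_all add: D_add pos_add)

lemma pos_twist:
  assumes "a \<in> dring M" "positive_degree a"
  shows "pos (twist a)"
  using open_chart assms(1)
proof (induction rule: dring_induct)
  case (single w f)
  then have "super_degree w > 0" using assms(2) by (auto simp: positive_degree_def)
  with pos_mon[of "letters w"] single show ?case
    by (simp add: twist_single q_single pos_parity_sign pos_mult_right)
qed (simp_all add: twist_add pos_add)

end

section \<open>Identities on a Frobenius manifold\<close>

lemma sum_rotate: "(\<Sum>k\<in>A. \<Sum>a\<in>B. \<Sum>b\<in>C. t k a b) = (\<Sum>a\<in>B. \<Sum>b\<in>C. \<Sum>k\<in>A. t k a b)"
  by (subst sum.swap, rule sum.cong[OF refl], rule sum.swap)

locale calibrated_frobenius =
  fixes M :: "'n::finite frobenius_data"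
  assumes frobenius: "frobenius_manifold M"
    and calibration: "calibration M"
    and two_point: "two_point_functions M"

sublocale calibrated_frobenius \<subseteq> tau_chart
  by standard (use frobenius in \<open>simp add: frobenius_manifold_def\<close>)

context calibrated_frobenius
begin

abbreviation "X0 \<equiv> chart M"
abbreviation "\<eta> \<equiv> eta M"
abbreviation "\<eta>I \<equiv> etaI M"
abbreviation "\<mu> \<equiv> spec M"
abbreviation "F3 \<alpha> \<beta> \<gamma> \<equiv> pd \<alpha> (pd \<beta> (pd \<gamma> (potential M)))"

section \<open>Third derivatives of the potential and the flat metric\<close>

lemma holo_potential: "holo (potential M)"
  using frobenius by (simp add: frobenius_manifold_def)

lemma holo_F3: "holo (F3 \<alpha> \<beta> \<gamma>)"
  by (intro holo_on_pd holo_potential)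

lemma F3_swap12: "x \<in> X0 \<Longrightarrow> F3 \<alpha> \<beta> \<gamma> x = F3 \<beta> \<alpha> \<gamma> x"
  by (rule pd_commute[OF open_chart]) (auto intro: holo_on_pd holo_potential)

lemma F3_swap23: "x \<in> X0 \<Longrightarrow> F3 \<alpha> \<beta> \<gamma> x = F3 \<alpha> \<gamma> \<beta> x"
  by (rule pd_cong[OF open_chart]) (auto intro: pd_commute[OF open_chart] holo_potential)

lemma F4_swap: "x \<in> X0 \<Longrightarrow> pd \<epsilon> (F3 \<xi> \<zeta> \<gamma>) x = pd \<zeta> (F3 \<xi> \<epsilon> \<gamma>) x"
proof -
  assume x: "x \<in> X0"
  have "pd \<epsilon> (F3 \<xi> \<zeta> \<gamma>) x = pd \<epsilon> (F3 \<zeta> \<xi> \<gamma>) x"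
    by (rule pd_cong[OF open_chart x]) (rule F3_swap12)
  also have "\<dots> = pd \<zeta> (F3 \<epsilon> \<xi> \<gamma>) x"
    by (rule pd_commute[OF open_chart _ x]) (auto intro: holo_on_pd holo_potential)
  also have "\<dots> = pd \<zeta> (F3 \<xi> \<epsilon> \<gamma>) x"
    by (rule pd_cong[OF open_chart x]) (rule F3_swap12)
  finally show ?thesis .
qed

lemma unit_F3: "x \<in> X0 \<Longrightarrow> F3 (unit_idx M) \<alpha> \<beta> x = \<eta> \<alpha> \<beta>"
  using frobenius by (simp add: frobenius_manifold_def)

lemma chart_nonempty: "\<exists>x. x \<in> X0"
  using frobenius by (auto simp: frobenius_manifold_def)

text \<open>The metric is a slice of the symmetric third derivatives of the potential, evaluated at
  any one point of the chart.\<close>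

lemma eta_sym: "\<eta> \<alpha> \<beta> = \<eta> \<beta> \<alpha>"
  using chart_nonempty unit_F3 F3_swap23 by metis

lemma eta_inverse: "metric M ** matrix_inv (metric M) = mat 1" "matrix_inv (metric M) ** metric M = mat 1"
proof -
  have "invertible (metric M)" using frobenius by (simp add: frobenius_manifold_def)
  then show "metric M ** matrix_inv (metric M) = mat 1" "matrix_inv (metric M) ** metric M = mat 1"
    unfolding invertible_def matrix_inv_def by (metis (mono_tags, lifting) someI_ex)+
qed

lemma eta_etaI: "(\<Sum>\<beta>\<in>UNIV. \<eta> \<alpha> \<beta> * \<eta>I \<beta> \<gamma>) = (if \<alpha> = \<gamma> then 1 else 0)"
  using arg_cong[OF eta_inverse(1), of "\<lambda>A. A $ \<alpha> $ \<gamma>"] by (simp add: matrix_matrix_mult_def mat_def)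

lemma etaI_eta: "(\<Sum>\<beta>\<in>UNIV. \<eta>I \<alpha> \<beta> * \<eta> \<beta> \<gamma>) = (if \<alpha> = \<gamma> then 1 else 0)"
  using arg_cong[OF eta_inverse(2), of "\<lambda>A. A $ \<alpha> $ \<gamma>"] by (simp add: matrix_matrix_mult_def mat_def)

lemma etaI_sym: "\<eta>I \<alpha> \<beta> = \<eta>I \<beta> \<alpha>"
proof -
  have "\<eta>I \<alpha> \<beta> = (\<Sum>\<delta>\<in>UNIV. (\<Sum>\<gamma>\<in>UNIV. \<eta>I \<beta> \<gamma> * \<eta> \<gamma> \<delta>) * \<eta>I \<alpha> \<delta>)"
    by (simp add: etaI_eta if_distrib[where f = "\<lambda>c. c * _"] cong: if_cong)
  also have "\<dots> = (\<Sum>\<gamma>\<in>UNIV. \<eta>I \<beta> \<gamma> * (\<Sum>\<delta>\<in>UNIV. \<eta>I \<alpha> \<delta> * \<eta> \<delta> \<gamma>))"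
    by (simp add: sum_distrib_left sum_distrib_right, subst sum.swap)
       (simp add: eta_sym mult_ac)
  also have "\<dots> = \<eta>I \<beta> \<alpha>"
    by (simp add: etaI_eta if_distrib[where f = "\<lambda>c. _ * c"] cong: if_cong)
  finally show ?thesis .
qed

lemma cup_F3: "x \<in> X0 \<Longrightarrow> cup M \<alpha> \<beta> \<gamma> x = (\<Sum>\<zeta>\<in>UNIV. \<Sum>\<xi>\<in>UNIV. \<eta>I \<alpha> \<zeta> * \<eta>I \<beta> \<xi> * F3 \<xi> \<zeta> \<gamma> x)"
  by (simp add: cup_def cmul_def sum_distrib_left mult.assoc)

lemma cup_sym: "x \<in> X0 \<Longrightarrow> cup M \<alpha> \<beta> \<gamma> x = cup M \<beta> \<alpha> \<gamma> x"
  unfolding cup_F3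
  by (subst sum.swap) (auto intro!: sum.cong simp: F3_swap12)

lemma cmul_sym: "x \<in> X0 \<Longrightarrow> cmul M \<gamma> \<alpha> \<beta> x = cmul M \<gamma> \<beta> \<alpha> x"
  unfolding cmul_def by (intro sum.cong refl) (simp add: F3_swap23)

lemma holo_cmul: "holo (cmul M \<gamma> \<alpha> \<beta>)"
proof -
  have "cmul M \<gamma> \<alpha> \<beta> = (\<lambda>x. \<Sum>\<zeta>\<in>UNIV. \<eta>I \<gamma> \<zeta> * F3 \<zeta> \<alpha> \<beta> x)"
    by (simp add: fun_eq_iff cmul_def)
  then show ?thesis by (simp only:) (intro holo_lambda_sum holo_lambda_mult holo_on_const holo_F3)
qed

lemma holo_cup: "holo (cup M \<alpha> \<beta> \<gamma>)"
proof -
  have "cup M \<alpha> \<beta> \<gamma> = (\<lambda>x. \<Sum>\<zeta>\<in>UNIV. \<eta>I \<alpha> \<zeta> * cmul M \<beta> \<zeta> \<gamma> x)"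
    by (simp add: fun_eq_iff cup_def)
  then show ?thesis by (simp only:) (intro holo_lambda_sum holo_lambda_mult holo_on_const holo_cmul)
qed

lemma holo_euler: "holo (euler M \<alpha>)"
proof -
  have "euler M \<alpha> = (\<lambda>x. (1 - charge M / 2 - \<mu> \<alpha>) * x $ \<alpha> + eshift M \<alpha>)"
    by (simp add: fun_eq_iff euler_def)
  then show ?thesis by (simp only:) (intro holo_lambda_add holo_lambda_mult holo_on_const holo_on_coord)
qed

lemma holo_gup: "holo (gup M \<alpha> \<beta>)"
proof -
  have "gup M \<alpha> \<beta> = (\<lambda>x. \<Sum>\<epsilon>\<in>UNIV. euler M \<epsilon> x * cup M \<alpha> \<beta> \<epsilon> x)"
    by (simp add: fun_eq_iff gup_def)
  then show ?thesis by (simp only:) (intro holo_lambda_sum holo_lambda_mult holo_cup holo_euler)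
qed

lemma holo_Gam: "holo (Gam M \<alpha> \<beta> \<gamma>)"
proof -
  have "Gam M \<alpha> \<beta> \<gamma> = (\<lambda>x. (1/2 - \<mu> \<beta>) * cup M \<alpha> \<beta> \<gamma> x)"
    by (simp add: fun_eq_iff Gam_def)
  then show ?thesis by (simp only:) (intro holo_lambda_mult holo_cup holo_on_const)
qed

lemma holo_hfun: "holo (hfun M \<alpha> p)"
  using calibration by (simp add: calibration_def)

lemma pd_lincomb:
  assumes "\<And>i. i \<in> I \<Longrightarrow> holo (f i)" "x \<in> X0"
  shows "pd \<gamma> (\<lambda>x. \<Sum>i\<in>I. c i * f i x) x = (\<Sum>i\<in>I. c i * pd \<gamma> (f i) x)"
proof -
  have h: "holo (\<lambda>x. c i * f i x)" if "i \<in> I" for i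
    by (intro holo_lambda_mult holo_on_const assms that)
  have "pd \<gamma> (\<lambda>x. c i * f i x) x = c i * pd \<gamma> (f i) x" if "i \<in> I" for i
    using pd_mult[of X0 "\<lambda>_. c i" "f i" x \<gamma>] assms that by (simp add: pd_const times_fun_def holo_on_const)
  then show ?thesis
    using pd_sum[OF open_chart, of I "\<lambda>i x. c i * f i x" x \<gamma>] h assms(2) by (simp add: sum_fun_eq)
qed

lemma cup_cmul: "x \<in> X0 \<Longrightarrow> cup M \<alpha> \<beta> \<gamma> x = (\<Sum>\<zeta>\<in>UNIV. \<eta>I \<beta> \<zeta> * cmul M \<alpha> \<zeta> \<gamma> x)"
  using cup_sym[of x \<alpha> \<beta> \<gamma>] by (simp add: cup_def[of M \<beta> \<alpha>])

text \<open>Associativity and commutativity together say that multiplications by two flat fields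
  commute (\<open>comm\<close>). Raising the two indices that label these fields gives associativity
  of the product on covectors.\<close>

lemma cup_assoc:
  assumes x: "x \<in> X0"
  shows "(\<Sum>\<kappa>\<in>UNIV. cup M \<alpha> \<beta> \<kappa> x * cup M \<kappa> \<delta> \<epsilon> x) = (\<Sum>\<kappa>\<in>UNIV. cup M \<beta> \<delta> \<kappa> x * cup M \<alpha> \<kappa> \<epsilon> x)"
proof -
  have A: "(\<Sum>\<kappa>\<in>UNIV. cmul M \<beta> \<zeta> \<kappa> x * cmul M \<kappa> \<xi> \<epsilon> x) = (\<Sum>\<kappa>\<in>UNIV. cmul M \<kappa> \<zeta> \<xi> x * cmul M \<beta> \<kappa> \<epsilon> x)" for \<zeta> \<xi>
  proof -
    have "(\<Sum>\<kappa>\<in>UNIV. cmul M \<kappa> \<zeta> \<xi> x * cmul M \<beta> \<kappa> \<epsilon> x) = (\<Sum>\<kappa>\<in>UNIV. cmul M \<kappa> \<xi> \<epsilon> x * cmul M \<beta> \<zeta> \<kappa> x)"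
      using frobenius x unfolding frobenius_manifold_def by blast
    then show ?thesis by (simp add: mult.commute)
  qed
  have comm: "(\<Sum>\<kappa>\<in>UNIV. cmul M \<beta> \<zeta> \<kappa> x * cmul M \<kappa> \<xi> \<epsilon> x) = (\<Sum>\<kappa>\<in>UNIV. cmul M \<beta> \<xi> \<kappa> x * cmul M \<kappa> \<zeta> \<epsilon> x)" for \<zeta> \<xi>
    unfolding A by (simp add: cmul_sym[OF x])
  have "(\<Sum>\<kappa>\<in>UNIV. cup M \<alpha> \<beta> \<kappa> x * cup M \<kappa> \<delta> \<epsilon> x)
      = (\<Sum>\<kappa>\<in>UNIV. \<Sum>\<zeta>\<in>UNIV. \<Sum>\<xi>\<in>UNIV. \<eta>I \<alpha> \<zeta> * \<eta>I \<delta> \<xi> * (cmul M \<beta> \<zeta> \<kappa> x * cmul M \<kappa> \<xi> \<epsilon> x))"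
    by (simp add: cup_def[of M \<alpha> \<beta>] cup_cmul[OF x, of _ \<delta>] sum_product mult_ac)
       (rule sum.cong[OF refl], rule sum.swap)
  also have "\<dots> = (\<Sum>\<zeta>\<in>UNIV. \<Sum>\<xi>\<in>UNIV. \<eta>I \<alpha> \<zeta> * \<eta>I \<delta> \<xi> * (\<Sum>\<kappa>\<in>UNIV. cmul M \<beta> \<zeta> \<kappa> x * cmul M \<kappa> \<xi> \<epsilon> x))"
    unfolding sum_distrib_left by (rule sum_rotate)
  also have "\<dots> = (\<Sum>\<zeta>\<in>UNIV. \<Sum>\<xi>\<in>UNIV. \<eta>I \<alpha> \<zeta> * \<eta>I \<delta> \<xi> * (\<Sum>\<kappa>\<in>UNIV. cmul M \<beta> \<xi> \<kappa> x * cmul M \<kappa> \<zeta> \<epsilon> x))"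
    unfolding comm ..
  also have "\<dots> = (\<Sum>\<kappa>\<in>UNIV. \<Sum>\<zeta>\<in>UNIV. \<Sum>\<xi>\<in>UNIV. \<eta>I \<alpha> \<zeta> * \<eta>I \<delta> \<xi> * (cmul M \<beta> \<xi> \<kappa> x * cmul M \<kappa> \<zeta> \<epsilon> x))"
    unfolding sum_distrib_left by (rule sum_rotate[symmetric])
  also have "\<dots> = (\<Sum>\<kappa>\<in>UNIV. cup M \<beta> \<delta> \<kappa> x * cup M \<alpha> \<kappa> \<epsilon> x)"
    unfolding cup_cmul[OF x, of \<beta> \<delta>] cup_def[of M \<alpha>] sum_product
    by (rule sum.cong[OF refl], subst sum.swap) (simp add: mult_ac)
  finally show ?thesis .
qed

text \<open>Lowering the first index of $c^{\alpha\beta}_\gamma$ gives $c^\beta_{\delta\gamma}$, which is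
  symmetric in $\delta$, $\gamma$.\<close>

lemma eta_cup: "x \<in> X0 \<Longrightarrow> (\<Sum>\<alpha>\<in>UNIV. \<eta> \<delta> \<alpha> * cup M \<alpha> \<beta> \<gamma> x) = cmul M \<beta> \<delta> \<gamma> x"
proof -
  have "(\<Sum>\<alpha>\<in>UNIV. \<eta> \<delta> \<alpha> * cup M \<alpha> \<beta> \<gamma> x) = (\<Sum>\<zeta>\<in>UNIV. (\<Sum>\<alpha>\<in>UNIV. \<eta> \<delta> \<alpha> * \<eta>I \<alpha> \<zeta>) * cmul M \<beta> \<zeta> \<gamma> x)"
    by (simp add: cup_def sum_distrib_left sum_distrib_right mult.assoc) (rule sum.swap)
  also have "\<dots> = cmul M \<beta> \<delta> \<gamma> x"
    by (simp add: eta_etaI if_distrib[where f = "\<lambda>c. c * _"] cong: if_cong)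
  finally show ?thesis .
qed

lemma eta_cup_swap:
  "x \<in> X0 \<Longrightarrow> (\<Sum>\<alpha>\<in>UNIV. \<eta> \<delta> \<alpha> * cup M \<alpha> \<beta> \<gamma> x) = (\<Sum>\<alpha>\<in>UNIV. \<eta> \<gamma> \<alpha> * cup M \<alpha> \<beta> \<delta> x)"
  by (simp add: eta_cup cmul_sym)

text \<open>The unit field with its index lowered is the unit of the product on covectors; it is the
  differential of \<open>hfun M (unit_idx M) 0\<close>.\<close>

lemma unit_cup: "x \<in> X0 \<Longrightarrow> (\<Sum>\<alpha>\<in>UNIV. \<eta> (unit_idx M) \<alpha> * cup M \<alpha> \<beta> \<gamma> x) = (if \<beta> = \<gamma> then 1 else 0)"
proof -
  assume x: "x \<in> X0"
  have "F3 \<zeta> (unit_idx M) \<gamma> x = \<eta> \<zeta> \<gamma>" for \<zeta>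
    using F3_swap12[OF x, of \<zeta>] unit_F3[OF x] by simp
  then show ?thesis using etaI_eta[of \<beta> \<gamma>] by (simp add: eta_cup[OF x] cmul_def)
qed

text \<open>Both sides are the third derivative of the potential with all three indices raised. On
  covectors this becomes the invariance \<open>pairing_star\<close>.\<close>

lemma etaI_cup: "x \<in> X0 \<Longrightarrow> (\<Sum>\<gamma>\<in>UNIV. \<eta>I \<gamma> \<delta> * cup M \<alpha> \<beta> \<gamma> x) = (\<Sum>\<gamma>\<in>UNIV. \<eta>I \<alpha> \<gamma> * cup M \<beta> \<delta> \<gamma> x)"
proof -
  assume x: "x \<in> X0"
  have "(\<Sum>\<gamma>\<in>UNIV. \<eta>I \<gamma> \<delta> * cup M \<alpha> \<beta> \<gamma> x) = (\<Sum>\<gamma>\<in>UNIV. \<Sum>\<zeta>\<in>UNIV. \<eta>I \<delta> \<gamma> * (\<eta>I \<alpha> \<zeta> * cmul M \<beta> \<zeta> \<gamma> x))"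
    by (simp add: cup_def sum_distrib_left etaI_sym[of _ \<delta>])
  also have "\<dots> = (\<Sum>\<zeta>\<in>UNIV. \<Sum>\<gamma>\<in>UNIV. \<eta>I \<alpha> \<zeta> * (\<eta>I \<delta> \<gamma> * cmul M \<beta> \<gamma> \<zeta> x))"
    by (subst sum.swap) (simp add: cmul_sym[OF x, of _ _ ] mult_ac)
  also have "\<dots> = (\<Sum>\<gamma>\<in>UNIV. \<eta>I \<alpha> \<gamma> * cup M \<beta> \<delta> \<gamma> x)"
    by (simp add: cup_cmul[OF x] sum_distrib_left)
  finally show ?thesis .
qed

text \<open>The fourth derivative of the potential with the indices delta, alpha, beta raised, as it
  arises when a derivation acts on the structure constants. The index delta is contracted with a
  velocity; interchanging it with alpha lets two velocities be exchanged in
  \<open>C4_swap\<close>.\<close>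

definition Kfun :: "'n \<Rightarrow> 'n \<Rightarrow> 'n \<Rightarrow> 'n \<Rightarrow> 'n scalar_fn" where
  "Kfun \<delta> \<alpha> \<beta> \<gamma> = (\<lambda>x. \<Sum>\<epsilon>\<in>UNIV. \<eta>I \<epsilon> \<delta> * pd \<epsilon> (cup M \<alpha> \<beta> \<gamma>) x)"

lemma pd_cup: 
  assumes x: "x \<in> X0"
  shows "pd \<epsilon> (cup M \<alpha> \<beta> \<gamma>) x = (\<Sum>\<zeta>\<in>UNIV. \<Sum>\<xi>\<in>UNIV. \<eta>I \<alpha> \<zeta> * \<eta>I \<beta> \<xi> * pd \<epsilon> (F3 \<xi> \<zeta> \<gamma>) x)"
proof -
  have "pd \<epsilon> (cup M \<alpha> \<beta> \<gamma>) x = pd \<epsilon> (\<lambda>x. \<Sum>z\<in>UNIV\<times>UNIV. (\<eta>I \<alpha> (fst z) * \<eta>I \<beta> (snd z)) * F3 (snd z) (fst z) \<gamma> x) x"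
    by (rule pd_cong[OF open_chart x]) (simp add: cup_F3 sum.cartesian_product split_def)
  also have "\<dots> = (\<Sum>z\<in>UNIV\<times>UNIV. (\<eta>I \<alpha> (fst z) * \<eta>I \<beta> (snd z)) * pd \<epsilon> (F3 (snd z) (fst z) \<gamma>) x)"
    by (rule pd_lincomb[OF holo_F3 x])
  finally show ?thesis by (simp add: sum.cartesian_product split_def)
qed

lemma Kfun_swap: "x \<in> X0 \<Longrightarrow> Kfun \<delta> \<alpha> \<beta> \<gamma> x = Kfun \<alpha> \<delta> \<beta> \<gamma> x"
proof -
  assume x: "x \<in> X0"
  have "Kfun \<delta> \<alpha> \<beta> \<gamma> x = (\<Sum>\<epsilon>\<in>UNIV. \<Sum>\<zeta>\<in>UNIV. \<Sum>\<xi>\<in>UNIV. \<eta>I \<delta> \<epsilon> * \<eta>I \<alpha> \<zeta> * \<eta>I \<beta> \<xi> * pd \<epsilon> (F3 \<xi> \<zeta> \<gamma>) x)" for \<delta> \<alpha>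
    by (simp add: Kfun_def pd_cup[OF x] sum_distrib_left etaI_sym[of _ \<delta>] mult.assoc)
  then show ?thesis
    by (simp only:, subst (2) sum.swap) (simp add: F4_swap[OF x] mult_ac)
qed

text \<open>The intersection form with its first index lowered: the matrix of multiplication by the
  Euler field, by which \<open>Uop\<close> acts on covectors.\<close>

definition Ufun :: "'n \<Rightarrow> 'n \<Rightarrow> 'n scalar_fn" where
  "Ufun \<beta> \<delta> = (\<lambda>x. \<Sum>\<alpha>\<in>UNIV. \<eta> \<delta> \<alpha> * gup M \<alpha> \<beta> x)"

lemma holo_Ufun: "holo (Ufun \<beta> \<delta>)"
  unfolding Ufun_def by (intro holo_lambda_sum holo_lambda_mult holo_on_const holo_gup)

lemma Ufun_euler:
  assumes x: "x \<in> X0"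
  shows "Ufun \<beta> \<delta> x = (\<Sum>\<epsilon>\<in>UNIV. (\<Sum>\<kappa>\<in>UNIV. \<eta> \<epsilon> \<kappa> * euler M \<kappa> x) * cup M \<epsilon> \<beta> \<delta> x)"
proof -
  have "Ufun \<beta> \<delta> x = (\<Sum>\<kappa>\<in>UNIV. euler M \<kappa> x * (\<Sum>\<alpha>\<in>UNIV. \<eta> \<delta> \<alpha> * cup M \<alpha> \<beta> \<kappa> x))"
    by (simp add: Ufun_def gup_def sum_distrib_left mult_ac) (rule sum.swap)
  also have "\<dots> = (\<Sum>\<kappa>\<in>UNIV. euler M \<kappa> x * (\<Sum>\<epsilon>\<in>UNIV. \<eta> \<kappa> \<epsilon> * cup M \<epsilon> \<beta> \<delta> x))"
    by (simp add: eta_cup_swap[OF x, of \<delta>])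
  also have "\<dots> = (\<Sum>\<epsilon>\<in>UNIV. (\<Sum>\<kappa>\<in>UNIV. \<eta> \<epsilon> \<kappa> * euler M \<kappa> x) * cup M \<epsilon> \<beta> \<delta> x)"
    by (simp add: sum_distrib_left sum_distrib_right mult_ac, subst sum.swap, intro sum.cong refl)
       (simp add: eta_sym)
  finally show ?thesis .
qed

lemma pd_euler: "x \<in> X0 \<Longrightarrow> pd \<epsilon> (euler M \<alpha>) x = (if \<epsilon> = \<alpha> then 1 - charge M / 2 - \<mu> \<alpha> else 0)"
proof -
  assume x: "x \<in> X0"
  have e: "euler M \<alpha> = (\<lambda>_. 1 - charge M / 2 - \<mu> \<alpha>) * (\<lambda>x. x $ \<alpha>) + (\<lambda>_. eshift M \<alpha>)"
    by (simp add: fun_eq_iff euler_def)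
  show ?thesis unfolding e using x
    by (simp add: pd_add[of X0] pd_mult[of X0] holo_mult holo_on_const pd_const del: plus_fun_apply times_fun_apply)
qed

text \<open>The Lie derivative condition, rewritten as homogeneity of the structure constants; the
  Euler field is affine with diagonal linear part, so each index contributes its own weight.\<close>

lemma euler_cmul:
  assumes x: "x \<in> X0"
  shows "(\<Sum>\<epsilon>\<in>UNIV. euler M \<epsilon> x * pd \<epsilon> (cmul M \<gamma> \<alpha> \<beta>) x)
    = (charge M / 2 - \<mu> \<gamma> + \<mu> \<alpha> + \<mu> \<beta>) * cmul M \<gamma> \<alpha> \<beta> x"
proof -
  have "lie_mult M \<gamma> \<alpha> \<beta> x = cmul M \<gamma> \<alpha> \<beta> x"
    using frobenius x by (simp add: frobenius_manifold_def)
  then have "(\<Sum>\<epsilon>\<in>UNIV. euler M \<epsilon> x * pd \<epsilon> (cmul M \<gamma> \<alpha> \<beta>) x)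
      - (1 - charge M / 2 - \<mu> \<gamma>) * cmul M \<gamma> \<alpha> \<beta> x + (1 - charge M / 2 - \<mu> \<alpha>) * cmul M \<gamma> \<alpha> \<beta> x
      + (1 - charge M / 2 - \<mu> \<beta>) * cmul M \<gamma> \<alpha> \<beta> x = cmul M \<gamma> \<alpha> \<beta> x"
    unfolding lie_mult_def pd_euler[OF x]
    by (simp add: sum.distrib sum_subtractf if_distrib[where f = "\<lambda>c. c * _"] cong: if_cong)
  then show ?thesis by (simp add: algebra_simps)
qed

lemma pd_cmul_swap: "x \<in> X0 \<Longrightarrow> pd \<gamma> (cmul M \<beta> \<zeta> \<epsilon>) x = pd \<epsilon> (cmul M \<beta> \<zeta> \<gamma>) x"
proof -
  assume x: "x \<in> X0"
  have p: "pd \<gamma> (cmul M \<beta> \<zeta> \<epsilon>) x = (\<Sum>\<xi>\<in>UNIV. \<eta>I \<beta> \<xi> * pd \<gamma> (F3 \<xi> \<zeta> \<epsilon>) x)" for \<gamma> \<epsilon>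
  proof -
    have "cmul M \<beta> \<zeta> \<epsilon> = (\<lambda>x. \<Sum>\<xi>\<in>UNIV. \<eta>I \<beta> \<xi> * F3 \<xi> \<zeta> \<epsilon> x)" by (simp add: fun_eq_iff cmul_def)
    then show ?thesis by (simp add: pd_lincomb holo_F3 x)
  qed
  have "pd \<gamma> (F3 \<xi> \<zeta> \<epsilon>) x = pd \<epsilon> (F3 \<xi> \<zeta> \<gamma>) x" for \<xi>
  proof -
    have "pd \<gamma> (F3 \<xi> \<zeta> \<epsilon>) x = pd \<gamma> (F3 \<xi> \<epsilon> \<zeta>) x"
      by (rule pd_cong[OF open_chart x]) (rule F3_swap23)
    also have "\<dots> = pd \<epsilon> (F3 \<xi> \<gamma> \<zeta>) x" by (rule F4_swap[OF x])
    also have "\<dots> = pd \<epsilon> (F3 \<xi> \<zeta> \<gamma>) x"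
      by (rule pd_cong[OF open_chart x]) (rule F3_swap23)
    finally show ?thesis .
  qed
  then show ?thesis by (simp add: p)
qed

text \<open>If the derivative falls on the Euler field it gives the weight 1 - d/2 - mu_gamma. If it
  falls on the structure constants, \<open>pd_cmul_swap\<close> turns it into the derivative along
  the Euler field, of weight d/2 - mu_beta + mu_delta + mu_gamma. The charge and mu_gamma
  cancel.\<close>

lemma pd_Ufun:
  assumes x: "x \<in> X0"
  shows "pd \<gamma> (Ufun \<beta> \<delta>) x = (1 + \<mu> \<delta> - \<mu> \<beta>) * cmul M \<beta> \<delta> \<gamma> x"
proof -
  have U: "Ufun \<beta> \<delta> y = sum (\<lambda>\<epsilon>. euler M \<epsilon> * cmul M \<beta> \<delta> \<epsilon>) UNIV y" if "y \<in> X0" for y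
    using that
    by (simp add: Ufun_def gup_def sum_distrib_left sum_fun_eq eta_cup[symmetric] mult_ac) (rule sum.swap)
  have "pd \<gamma> (Ufun \<beta> \<delta>) x = pd \<gamma> (sum (\<lambda>\<epsilon>. euler M \<epsilon> * cmul M \<beta> \<delta> \<epsilon>) UNIV) x"
    by (rule pd_cong[OF open_chart x U])
  also have "\<dots> = (\<Sum>\<epsilon>\<in>UNIV. pd \<gamma> (euler M \<epsilon> * cmul M \<beta> \<delta> \<epsilon>) x)"
    by (rule pd_sum[OF open_chart _ x]) (rule holo_mult[OF holo_euler holo_cmul])
  also have "\<dots> = (\<Sum>\<epsilon>\<in>UNIV. pd \<gamma> (euler M \<epsilon>) x * cmul M \<beta> \<delta> \<epsilon> x) + (\<Sum>\<epsilon>\<in>UNIV. euler M \<epsilon> x * pd \<gamma> (cmul M \<beta> \<delta> \<epsilon>) x)"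
    by (simp only: pd_mult[OF holo_euler holo_cmul x] sum.distrib)
  also have "(\<Sum>\<epsilon>\<in>UNIV. euler M \<epsilon> x * pd \<gamma> (cmul M \<beta> \<delta> \<epsilon>) x) = (charge M / 2 - \<mu> \<beta> + \<mu> \<delta> + \<mu> \<gamma>) * cmul M \<beta> \<delta> \<gamma> x"
    by (simp only: pd_cmul_swap[OF x, of \<gamma>] euler_cmul[OF x])
  also have "(\<Sum>\<epsilon>\<in>UNIV. pd \<gamma> (euler M \<epsilon>) x * cmul M \<beta> \<delta> \<epsilon> x) = (1 - charge M / 2 - \<mu> \<gamma>) * cmul M \<beta> \<delta> \<gamma> x"
    by (simp add: pd_euler[OF x] if_distrib[where f = "\<lambda>c. c * _"] cong: if_cong)
  finally show ?thesis by (simp add: algebra_simps)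
qed

section \<open>The functions h and their derivatives\<close>

lemma hfun_0: "x \<in> X0 \<Longrightarrow> hfun M \<alpha> 0 x = (\<Sum>\<gamma>\<in>UNIV. \<eta> \<alpha> \<gamma> * x $ \<gamma>)"
  using calibration by (simp add: calibration_def)

lemma pd_hfun_0: "x \<in> X0 \<Longrightarrow> pd \<beta> (hfun M \<alpha> 0) x = \<eta> \<alpha> \<beta>"
proof -
  assume x: "x \<in> X0"
  have "pd \<beta> (hfun M \<alpha> 0) x = pd \<beta> (\<lambda>x. \<Sum>\<gamma>\<in>UNIV. \<eta> \<alpha> \<gamma> * x $ \<gamma>) x"
    by (rule pd_cong[OF open_chart x hfun_0])
  also have "\<dots> = \<eta> \<alpha> \<beta>"
    by (subst pd_lincomb[where f = "\<lambda>i x. x $ i", OF holo_on_coord x]) (simp add: if_distrib[where f = "\<lambda>c. _ * c"] cong: if_cong)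
  finally show ?thesis .
qed

lemma pd_pd_hfun_Suc: "x \<in> X0 \<Longrightarrow> pd \<alpha> (pd \<beta> (hfun M \<gamma> (Suc p))) x = (\<Sum>\<kappa>\<in>UNIV. cmul M \<kappa> \<alpha> \<beta> x * pd \<kappa> (hfun M \<gamma> p) x)"
  using calibration by (simp add: calibration_def)

lemma pd_unit_hfun: "x \<in> X0 \<Longrightarrow> pd (unit_idx M) (hfun M \<alpha> (Suc p)) x = hfun M \<alpha> p x"
  using calibration by (simp add: calibration_def)

end

section \<open>Calculus of covectors\<close>

context tau_chart
begin

lemma \<phi>_sum_mult:
  assumes "\<And>k. holo (f k)" "\<And>k. holo (g k)"
  shows "(\<Sum>k\<in>I. \<phi> (f k) * (\<phi> (g k) * z)) = \<phi> (\<lambda>x. \<Sum>k\<in>I. f k x * g k x) * z"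
proof -
  have "(\<lambda>x. \<Sum>k\<in>I. f k x * g k x) = (\<Sum>k\<in>I. f k * g k)"
    by (simp add: sum_fun_eq)
  then show ?thesis using assms
    by (simp add: \<phi>_sum holo_mult \<phi>_mult sum_distrib_right mult.assoc del: times_fun_apply)
qed

end

context calibrated_frobenius
begin

lemma dx_gen_dring [simp]: "dx_gen M g \<in> dring M"
proof (cases g)
  case (Ph \<alpha> p n)
  have "holo (\<lambda>x. pd \<beta> (hfun M \<alpha> p) x * \<eta>I \<beta> \<gamma>)" for \<beta> \<gamma>
    by (intro holo_lambda_mult holo_on_const holo_on_pd holo_hfun)
  then show ?thesis by (simp add: Ph dring_intros)
qed (simp_all add: holo_hfun)

lemma has_parity_add: "has_parity i a \<Longrightarrow> has_parity i b \<Longrightarrow> has_parity i (a + b)"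
  using keys_add_subset[of a b] unfolding has_parity_def by blast

lemma has_parity_sum: "(\<And>k. k \<in> K \<Longrightarrow> has_parity i (f k)) \<Longrightarrow> has_parity i (sum f K)"
  by (induction K rule: infinite_finite_induct) (auto intro: has_parity_add simp: has_parity_def[of _ 0])

lemma has_parity_fn_gen: "has_parity (gdeg g) (fn f * gen g)"
  by (simp add: fn_def mon_def mult_single has_parity_single super_degree_Cons)

lemma has_parity_dx_gen: "has_parity (gdeg g) (dx_gen M g)"
proof (cases g)
  case (Ph \<alpha> p n)
  show ?thesis unfolding Ph dx_gen.simps
    using has_parity_fn_gen[of "Sg _ n 1"] by (intro has_parity_sum) simp
qed (simp_all add: mon_def fn_def has_parity_single super_degree_Cons)

end

text \<open>The derivation \<open>dx\<close> is itself an instance of the general construction, so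
  the whole calculus of D applies to it under the prefix x.\<close>

sublocale calibrated_frobenius \<subseteq> x: tau_derivation M 0 "\<lambda>g. cls M (dx_gen M g)"
proof
  fix g show "par (0 + gdeg g) (q (dx_gen M g))"
    unfolding par_def using has_parity_dx_gen[of g] by (intro bexI[of _ "dx_gen M g"]) auto
qed

context calibrated_frobenius
begin

lemma dx_word_dring [simp]: "dx_word M w \<in> dring M"
  by (induction w) (simp_all add: dring_intros)

lemma q_dx_word: "q (dx_word M w) = x.dword w"
  by (induction w) (simp_all add: q_add q_mult dring_intros)

lemma dx_dring: "a \<in> dring M \<Longrightarrow> dx M a \<in> dring M"
  unfolding dx_def
  by (intro dring_intros) (auto intro!: holo_on_pd dring_lookup)

lemma q_dx: "a \<in> dring M \<Longrightarrow> q (dx M a) = x.D a"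
  unfolding dx_def x.D_def x.dterm_def x.dfn_def
  by (subst q_sum)
     (auto intro!: dring_intros holo_on_pd dring_lookup sum.cong
       simp: q_add q_mult q_sum q_dx_word dring_lookup holo_on_pd dring_intros)

lemma xD_cong: "a \<in> dring M \<Longrightarrow> b \<in> dring M \<Longrightarrow> q a = q b \<Longrightarrow> x.D a = x.D b"
proof -
  assume ab: "a \<in> dring M" "b \<in> dring M" "q a = q b"
  then have "dx M (a - b) \<in> relations M" by (intro relations.dx_closed) (simp add: q_eq_iff)
  then have "x.D (a - b) = 0"
    using ab q_eq_zero_iff[of "dx M (a - b)"] by (simp add: q_dx dx_dring dring_intros)
  then show ?thesis using ab by (simp add: x.D_diff)
qed

definition dd :: "'n tau_algebra \<Rightarrow> 'n tau_algebra" where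
  "dd x = x.D (rep x)"

lemma dd_q: "a \<in> dring M \<Longrightarrow> dd (q a) = x.D a"
  unfolding dd_def by (rule xD_cong) (simp_all add: q_rep)

lemma dd_gen [simp]: "dd (\<g> g) = q (dx_gen M g)"
  by (simp add: dd_q)

lemma dd_\<phi>: "holo f \<Longrightarrow> dd (\<phi> f) = x.dfn f"
  by (simp add: dd_q)

lemma dd_add: "dd (x + y) = dd x + dd y"
  unfolding dd_def x.D_add[OF rep_dring rep_dring, symmetric]
  by (rule xD_cong) (simp_all add: q_rep q_add dring_intros component_add)

lemma dd_zero [simp]: "dd 0 = 0"
  using dd_add[of 0 0] by simp

lemma dd_uminus: "dd (- x) = - dd x"
  using dd_add[of "- x" x] by (simp add: eq_neg_iff_add_eq_0)

lemma dd_diff: "dd (x - y) = dd x - dd y"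
  using dd_add[of x "- y"] by (simp add: dd_uminus)

lemma dd_sum: "dd (sum f I) = (\<Sum>i\<in>I. dd (f i))"
  by (induction I rule: infinite_finite_induct) (simp_all add: dd_add)

lemma dd_parity_sign: "dd (parity_sign n x) = parity_sign n (dd x)"
  by (simp add: parity_sign_def dd_uminus)

lemma xtwist: "a \<in> dring M \<Longrightarrow> x.twist a = q a"
  by (subst single_sum_decomposition[of a], subst q_sum)
     (auto simp: x.twist_def q_single dring_lookup)

lemma par_dd: "par i x \<Longrightarrow> par i (dd x)"
  using x.par_D[of _ i] unfolding par_def[of _ x] by (auto simp: dd_q)

lemma xD_component: "a \<in> dring M \<Longrightarrow> component M (x.D a) = x.D a"
  using q_dx[of a] component_cls[of M "dx M a"] by simp

lemma dd_component [simp]: "component M (dd x) = dd x"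
  by (simp add: dd_def xD_component)

lemma dd_mult: "dd (x * y) = dd x * y + x * dd y"
proof -
  have "dd (x * y) = x.D (rep x * rep y)"
    unfolding dd_def by (rule xD_cong) (simp_all add: q_rep q_mult dring_intros component_mult)
  also have "\<dots> = component M (dd x) * component M y + component M x * component M (dd y)"
    by (simp add: x.D_mult xtwist q_rep) (simp add: dd_def)
  finally show ?thesis
    using component_mult_left[of M "dd x" y] component_mult_right[of x M "dd y"] by simp
qed

lemma pos_dd: "pos x \<Longrightarrow> pos (dd x)"
proof -
  assume "pos x"
  then obtain a where a: "a \<in> dring M" "positive_degree a" "q a = x" by (auto simp: pos_def)
  have "pos (q (dx_gen M g))" if "is_odd g" for g
    using par_odd_pos[OF x.par_d[of g]] that by simp
  from x.pos_D[OF this a(1,2)] show ?thesis using a by (auto simp: dd_q)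
qed

lemma no_odd_constants: "pos x \<Longrightarrow> dd x = 0 \<Longrightarrow> x = 0"
proof -
  assume "pos x" and z: "dd x = 0"
  then obtain a where a: "a \<in> dring M" "positive_degree a" "q a = x" by (auto simp: pos_def)
  have "q (dx M a) = 0" using a z by (auto simp: q_dx dd_q)
  then show ?thesis
    using no_odd_constants_q[OF a(1,2)] a by (simp add: q_eq_zero_iff dx_dring)
qed

text \<open>The product written with a circle in the introduction. Entries may be odd, so the order
  of the factors is kept.\<close>

definition star :: "('n \<Rightarrow> 'n tau_algebra) \<Rightarrow> ('n \<Rightarrow> 'n tau_algebra) \<Rightarrow> 'n \<Rightarrow> 'n tau_algebra" where
  "star X Y \<gamma> = (\<Sum>\<alpha>\<in>UNIV. \<Sum>\<beta>\<in>UNIV. \<phi> (cup M \<alpha> \<beta> \<gamma>) * (X \<alpha> * Y \<beta>))"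

definition scal :: "('n \<Rightarrow> complex) \<Rightarrow> ('n \<Rightarrow> 'n tau_algebra) \<Rightarrow> 'n \<Rightarrow> 'n tau_algebra" where
  "scal c X \<gamma> = \<phi> (\<lambda>_. c \<gamma>) * X \<gamma>"

text \<open>\<open>Nm (sig k)\<close> is rho_k. The pair arises from splitting the factor of
  \<open>pd_Ufun\<close> as (1/2 + mu_delta) + (1/2 - mu_beta): one part scales the result of a
  product, the other its second factor.\<close>

abbreviation "Np \<equiv> scal (\<lambda>\<gamma>. 1/2 + \<mu> \<gamma>)"
abbreviation "Nm \<equiv> scal (\<lambda>\<gamma>. 1/2 - \<mu> \<gamma>)"

definition Uop :: "('n \<Rightarrow> 'n tau_algebra) \<Rightarrow> 'n \<Rightarrow> 'n tau_algebra" where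
  "Uop X \<delta> = (\<Sum>\<beta>\<in>UNIV. \<phi> (Ufun \<beta> \<delta>) * X \<beta>)"

text \<open>The part of the derivative of \<open>star X Y\<close> that comes from the structure
  constants; u is the velocity covector of the derivation.\<close>

definition C4 :: "('n \<Rightarrow> 'n tau_algebra) \<Rightarrow> ('n \<Rightarrow> 'n tau_algebra) \<Rightarrow> ('n \<Rightarrow> 'n tau_algebra) \<Rightarrow> 'n \<Rightarrow> 'n tau_algebra" where
  "C4 u X Y \<gamma> = (\<Sum>\<delta>\<in>UNIV. \<Sum>\<alpha>\<in>UNIV. \<Sum>\<beta>\<in>UNIV. \<phi> (Kfun \<delta> \<alpha> \<beta> \<gamma>) * (u \<delta> * (X \<alpha> * Y \<beta>)))"

definition pairing :: "('n \<Rightarrow> 'n tau_algebra) \<Rightarrow> ('n \<Rightarrow> 'n tau_algebra) \<Rightarrow> 'n tau_algebra" where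
  "pairing X Y = (\<Sum>\<alpha>\<in>UNIV. \<Sum>\<beta>\<in>UNIV. \<phi> (\<lambda>_. \<eta>I \<alpha> \<beta>) * (X \<alpha> * Y \<beta>))"

abbreviation parv :: "nat \<Rightarrow> ('n \<Rightarrow> 'n tau_algebra) \<Rightarrow> bool" where
  "parv i X \<equiv> (\<forall>\<alpha>. par i (X \<alpha>))"

abbreviation ddv :: "('n \<Rightarrow> 'n tau_algebra) \<Rightarrow> 'n \<Rightarrow> 'n tau_algebra" where
  "ddv X \<equiv> (\<lambda>\<alpha>. dd (X \<alpha>))"

section \<open>Algebraic laws of the covector operations\<close>

lemma star_add_left: "star (X + Y) Z = star X Z + star Y Z"
  and star_add_right: "star X (Y + Z) = star X Y + star X Z"
  and star_uminus_left: "star (- X) Z = - star X Z"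
  and star_uminus_right: "star X (- Z) = - star X Z"
  and star_diff_right: "star X (Y - Z) = star X Y - star X Z"
  and star_zero_left: "star 0 X = 0"
  and star_zero_right: "star X 0 = 0"
  by (auto simp: fun_eq_iff star_def algebra_simps sum.distrib sum_negf sum_subtractf fun_Compl_def)

lemma star_sum_right: "star X (sum f I) = (\<Sum>i\<in>I. star X (f i))"
  by (induction I rule: infinite_finite_induct) (simp_all add: star_zero_right star_add_right del: plus_fun_apply zero_fun_apply)

lemma Uop_add: "Uop (X + Y) = Uop X + Uop Y" and Uop_uminus: "Uop (- X) = - Uop X"
  and Uop_diff: "Uop (X - Y) = Uop X - Uop Y" and Uop_zero: "Uop 0 = 0"
  by (auto simp: fun_eq_iff Uop_def algebra_simps sum.distrib sum_negf sum_subtractf fun_Compl_def)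

lemma Uop_sum: "Uop (sum f I) = (\<Sum>i\<in>I. Uop (f i))"
  by (induction I rule: infinite_finite_induct) (simp_all add: Uop_zero Uop_add del: plus_fun_apply zero_fun_apply)

lemma dd_const_mult: "dd (\<phi> (\<lambda>_. c) * x) = \<phi> (\<lambda>_. c) * dd x"
  by (simp add: dd_mult dd_\<phi> holo_on_const)

lemma ddv_scal: "ddv (scal c X) = scal c (ddv X)"
  by (simp add: fun_eq_iff scal_def dd_const_mult)

lemma parv_star: "parv i X \<Longrightarrow> parv j Y \<Longrightarrow> parv (i + j) (star X Y)"
  unfolding star_def by (intro allI par_sum par_\<phi>_mult par_mult) auto

lemma parv_scal: "parv i X \<Longrightarrow> parv i (scal c X)"
  unfolding scal_def by (intro allI par_\<phi>_mult) auto

lemma star_assoc: "star (star X Y) Z = star X (star Y Z)"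
proof
  fix \<epsilon>
  have "star (star X Y) Z \<epsilon> = (\<Sum>\<kappa>\<in>UNIV. \<Sum>\<delta>\<in>UNIV. \<Sum>\<alpha>\<in>UNIV. \<Sum>\<beta>\<in>UNIV.
      \<phi> (cup M \<alpha> \<beta> \<kappa>) * (\<phi> (cup M \<kappa> \<delta> \<epsilon>) * (X \<alpha> * (Y \<beta> * Z \<delta>))))"
    by (simp only: star_def sum_distrib_left sum_distrib_right mult.assoc \<phi>_left_commute[of "\<phi> (cup M _ _ \<epsilon>)"])
  also have "\<dots> = (\<Sum>\<kappa>\<in>UNIV. \<Sum>\<alpha>\<in>UNIV. \<Sum>\<beta>\<in>UNIV. \<Sum>\<delta>\<in>UNIV.
      \<phi> (cup M \<alpha> \<beta> \<kappa>) * (\<phi> (cup M \<kappa> \<delta> \<epsilon>) * (X \<alpha> * (Y \<beta> * Z \<delta>))))"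
    by (rule sum.cong[OF refl], rule sum_rotate)
  also have "\<dots> = (\<Sum>\<alpha>\<in>UNIV. \<Sum>\<beta>\<in>UNIV. \<Sum>\<delta>\<in>UNIV. \<Sum>\<kappa>\<in>UNIV.
      \<phi> (cup M \<alpha> \<beta> \<kappa>) * (\<phi> (cup M \<kappa> \<delta> \<epsilon>) * (X \<alpha> * (Y \<beta> * Z \<delta>))))"
    by (subst sum_rotate, rule sum.cong[OF refl], rule sum.cong[OF refl], rule sum.swap)
  also have "\<dots> = (\<Sum>\<alpha>\<in>UNIV. \<Sum>\<beta>\<in>UNIV. \<Sum>\<delta>\<in>UNIV.
      \<phi> (\<lambda>x. \<Sum>\<kappa>\<in>UNIV. cup M \<alpha> \<beta> \<kappa> x * cup M \<kappa> \<delta> \<epsilon> x) * (X \<alpha> * (Y \<beta> * Z \<delta>)))"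
    by (simp only: \<phi>_sum_mult holo_cup)
  also have "\<dots> = (\<Sum>\<alpha>\<in>UNIV. \<Sum>\<beta>\<in>UNIV. \<Sum>\<delta>\<in>UNIV.
      \<phi> (\<lambda>x. \<Sum>\<kappa>\<in>UNIV. cup M \<beta> \<delta> \<kappa> x * cup M \<alpha> \<kappa> \<epsilon> x) * (X \<alpha> * (Y \<beta> * Z \<delta>)))"
    by (simp only: \<phi>_cong[OF cup_assoc])
  also have "\<dots> = (\<Sum>\<alpha>\<in>UNIV. \<Sum>\<beta>\<in>UNIV. \<Sum>\<delta>\<in>UNIV. \<Sum>\<kappa>\<in>UNIV.
      \<phi> (cup M \<beta> \<delta> \<kappa>) * (\<phi> (cup M \<alpha> \<kappa> \<epsilon>) * (X \<alpha> * (Y \<beta> * Z \<delta>))))"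
    by (simp only: \<phi>_sum_mult holo_cup)
  also have "\<dots> = (\<Sum>\<alpha>\<in>UNIV. \<Sum>\<kappa>\<in>UNIV. \<Sum>\<beta>\<in>UNIV. \<Sum>\<delta>\<in>UNIV.
      \<phi> (cup M \<beta> \<delta> \<kappa>) * (\<phi> (cup M \<alpha> \<kappa> \<epsilon>) * (X \<alpha> * (Y \<beta> * Z \<delta>))))"
    by (rule sum.cong[OF refl], rule sum_rotate[symmetric])
  also have "\<dots> = star X (star Y Z) \<epsilon>"
    by (simp only: star_def sum_distrib_left sum_distrib_right mult.assoc
        \<phi>_left_commute[of "X _"] \<phi>_left_commute[of "\<phi> (cup M _ _ \<epsilon>)"])
  finally show "star (star X Y) Z \<epsilon> = star X (star Y Z) \<epsilon>" .
qed

lemma star_commute: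
  assumes "parv i X" "parv j Y"
  shows "star X Y \<gamma> = parity_sign (i * j) (star Y X \<gamma>)"
proof -
  have "star X Y \<gamma> = (\<Sum>\<beta>\<in>UNIV. \<Sum>\<alpha>\<in>UNIV. \<phi> (cup M \<alpha> \<beta> \<gamma>) * (X \<alpha> * Y \<beta>))"
    unfolding star_def by (rule sum.swap)
  also have "\<dots> = (\<Sum>\<beta>\<in>UNIV. \<Sum>\<alpha>\<in>UNIV. parity_sign (i * j) (\<phi> (cup M \<beta> \<alpha> \<gamma>) * (Y \<beta> * X \<alpha>)))"
  proof (intro sum.cong refl)
    fix \<alpha> \<beta>
    show "\<phi> (cup M \<alpha> \<beta> \<gamma>) * (X \<alpha> * Y \<beta>) = parity_sign (i * j) (\<phi> (cup M \<beta> \<alpha> \<gamma>) * (Y \<beta> * X \<alpha>))"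
      using supercommute[of i "X \<alpha>" j "Y \<beta>"] assms \<phi>_cong[of "cup M \<alpha> \<beta> \<gamma>" "cup M \<beta> \<alpha> \<gamma>"] cup_sym
      by (simp add: parity_sign_mult_right)
  qed
  finally show ?thesis by (simp add: star_def parity_sign_sum)
qed

lemma star_commute_even: "parv 0 X \<Longrightarrow> parv j Y \<Longrightarrow> star X Y = star Y X"
  by (rule ext) (simp add: star_commute[of 0 X j Y])

lemma star_commute_odd: "parv 1 X \<Longrightarrow> parv 1 Y \<Longrightarrow> star X Y = - star Y X"
  by (rule ext) (simp add: star_commute[of 1 X 1 Y] fun_Compl_def)

definition Ev :: "'n \<Rightarrow> 'n tau_algebra" where
  "Ev \<epsilon> = \<phi> (\<lambda>x. \<Sum>\<kappa>\<in>UNIV. \<eta> \<epsilon> \<kappa> * euler M \<kappa> x)"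

text \<open>Written as multiplication by the lowered Euler field, U is compatible with products by
  mere associativity and commutativity.\<close>

lemma Uop_star: "Uop X = star Ev X"
proof
  fix \<delta>
  have h: "holo (\<lambda>x. \<Sum>\<kappa>\<in>UNIV. \<eta> \<epsilon> \<kappa> * euler M \<kappa> x)" for \<epsilon>
    by (intro holo_lambda_sum holo_lambda_mult holo_on_const holo_euler)
  have "star Ev X \<delta> = (\<Sum>\<epsilon>\<in>UNIV. \<Sum>\<beta>\<in>UNIV. Ev \<epsilon> * (\<phi> (cup M \<epsilon> \<beta> \<delta>) * X \<beta>))"
    by (simp only: star_def \<phi>_left_commute[of "Ev _"])
  also have "\<dots> = (\<Sum>\<beta>\<in>UNIV. \<Sum>\<epsilon>\<in>UNIV. Ev \<epsilon> * (\<phi> (cup M \<epsilon> \<beta> \<delta>) * X \<beta>))"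
    by (rule sum.swap)
  also have "\<dots> = (\<Sum>\<beta>\<in>UNIV. \<phi> (\<lambda>x. \<Sum>\<epsilon>\<in>UNIV. (\<Sum>\<kappa>\<in>UNIV. \<eta> \<epsilon> \<kappa> * euler M \<kappa> x) * cup M \<epsilon> \<beta> \<delta> x) * X \<beta>)"
    by (simp only: Ev_def \<phi>_sum_mult h holo_cup)
  also have "\<dots> = Uop X \<delta>"
    unfolding Uop_def by (intro sum.cong refl arg_cong2[where f = "(*)"] \<phi>_cong) (simp add: Ufun_euler)
  finally show "Uop X \<delta> = star Ev X \<delta>" ..
qed

lemma Uop_star_left: "Uop (star X Y) = star (Uop X) Y"
  by (simp add: Uop_star star_assoc)

lemma Uop_star_right: "parv i X \<Longrightarrow> Uop (star X Y) = star X (Uop Y)"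
proof -
  assume "parv i X"
  moreover have "parv 0 Ev" by (simp add: Ev_def)
  ultimately have "star Ev X = star X Ev" by (rule star_commute_even[rotated])
  then show ?thesis by (metis Uop_star star_assoc)
qed

text \<open>\<open>Kfun\<close> is symmetric in the indices of u and X, and X is even, so u moves
  past it without a sign.\<close>

lemma C4_swap:
  assumes "parv 0 X" "parv j u"
  shows "C4 u X Y = C4 X u Y"
proof
  fix \<gamma>
  have "C4 u X Y \<gamma> = (\<Sum>\<alpha>\<in>UNIV. \<Sum>\<delta>\<in>UNIV. \<Sum>\<beta>\<in>UNIV. \<phi> (Kfun \<delta> \<alpha> \<beta> \<gamma>) * (u \<delta> * (X \<alpha> * Y \<beta>)))"
    unfolding C4_def by (rule sum.swap)
  also have "\<dots> = C4 X u Y \<gamma>"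
    unfolding C4_def
  proof (intro sum.cong refl)
    fix \<alpha> \<delta> \<beta>
    have "u \<delta> * (X \<alpha> * Y \<beta>) = X \<alpha> * (u \<delta> * Y \<beta>)"
      using supercommute[of 0 "X \<alpha>" j "u \<delta>"] assms by (simp add: mult.assoc[symmetric])
    then show "\<phi> (Kfun \<delta> \<alpha> \<beta> \<gamma>) * (u \<delta> * (X \<alpha> * Y \<beta>)) = \<phi> (Kfun \<alpha> \<delta> \<beta> \<gamma>) * (X \<alpha> * (u \<delta> * Y \<beta>))"
      using \<phi>_cong[of "Kfun \<delta> \<alpha> \<beta> \<gamma>" "Kfun \<alpha> \<delta> \<beta> \<gamma>"] Kfun_swap by simp
  qed
  finally show "C4 u X Y \<gamma> = C4 X u Y \<gamma>" .
qed

text \<open>Invariance of the Frobenius form, from \<open>etaI_cup\<close>. The outer factors keep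
  their order, so no parity assumption enters.\<close>

lemma pairing_star: "pairing (star X Y) Z = pairing X (star Y Z)"
proof -
  have "pairing (star X Y) Z = (\<Sum>\<kappa>\<in>UNIV. \<Sum>\<delta>\<in>UNIV. \<Sum>\<alpha>\<in>UNIV. \<Sum>\<beta>\<in>UNIV.
      \<phi> (\<lambda>_. \<eta>I \<kappa> \<delta>) * (\<phi> (cup M \<alpha> \<beta> \<kappa>) * (X \<alpha> * (Y \<beta> * Z \<delta>))))"
    by (simp only: star_def pairing_def sum_distrib_left sum_distrib_right mult.assoc)
  also have "\<dots> = (\<Sum>\<kappa>\<in>UNIV. \<Sum>\<alpha>\<in>UNIV. \<Sum>\<beta>\<in>UNIV. \<Sum>\<delta>\<in>UNIV.
      \<phi> (\<lambda>_. \<eta>I \<kappa> \<delta>) * (\<phi> (cup M \<alpha> \<beta> \<kappa>) * (X \<alpha> * (Y \<beta> * Z \<delta>))))"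
    by (rule sum.cong[OF refl], rule sum_rotate)
  also have "\<dots> = (\<Sum>\<alpha>\<in>UNIV. \<Sum>\<beta>\<in>UNIV. \<Sum>\<delta>\<in>UNIV. \<Sum>\<kappa>\<in>UNIV.
      \<phi> (\<lambda>_. \<eta>I \<kappa> \<delta>) * (\<phi> (cup M \<alpha> \<beta> \<kappa>) * (X \<alpha> * (Y \<beta> * Z \<delta>))))"
    by (subst sum_rotate, rule sum.cong[OF refl], rule sum.cong[OF refl], rule sum.swap)
  also have "\<dots> = (\<Sum>\<alpha>\<in>UNIV. \<Sum>\<beta>\<in>UNIV. \<Sum>\<delta>\<in>UNIV.
      \<phi> (\<lambda>x. \<Sum>\<kappa>\<in>UNIV. \<eta>I \<kappa> \<delta> * cup M \<alpha> \<beta> \<kappa> x) * (X \<alpha> * (Y \<beta> * Z \<delta>)))"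
    by (simp only: \<phi>_sum_mult holo_cup holo_on_const)
  also have "\<dots> = (\<Sum>\<alpha>\<in>UNIV. \<Sum>\<beta>\<in>UNIV. \<Sum>\<delta>\<in>UNIV.
      \<phi> (\<lambda>x. \<Sum>\<kappa>\<in>UNIV. \<eta>I \<alpha> \<kappa> * cup M \<beta> \<delta> \<kappa> x) * (X \<alpha> * (Y \<beta> * Z \<delta>)))"
    by (simp only: \<phi>_cong[OF etaI_cup])
  also have "\<dots> = (\<Sum>\<alpha>\<in>UNIV. \<Sum>\<beta>\<in>UNIV. \<Sum>\<delta>\<in>UNIV. \<Sum>\<kappa>\<in>UNIV.
      \<phi> (\<lambda>_. \<eta>I \<alpha> \<kappa>) * (\<phi> (cup M \<beta> \<delta> \<kappa>) * (X \<alpha> * (Y \<beta> * Z \<delta>))))"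
    by (simp only: \<phi>_sum_mult holo_cup holo_on_const)
  also have "\<dots> = (\<Sum>\<alpha>\<in>UNIV. \<Sum>\<kappa>\<in>UNIV. \<Sum>\<beta>\<in>UNIV. \<Sum>\<delta>\<in>UNIV.
      \<phi> (\<lambda>_. \<eta>I \<alpha> \<kappa>) * (\<phi> (cup M \<beta> \<delta> \<kappa>) * (X \<alpha> * (Y \<beta> * Z \<delta>))))"
    by (rule sum.cong[OF refl], rule sum_rotate[symmetric])
  also have "\<dots> = pairing X (star Y Z)"
    by (simp only: star_def pairing_def sum_distrib_left mult.assoc \<phi>_left_commute[of "X _"])
  finally show ?thesis .
qed

lemma dd_pairing: "dd (pairing X Y) = pairing (ddv X) Y + pairing X (ddv Y)"
  by (simp add: pairing_def dd_sum dd_const_mult dd_mult[of "X _"] distrib_left sum.distrib)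

definition dh :: "'n \<Rightarrow> nat \<Rightarrow> 'n \<Rightarrow> 'n tau_algebra" where
  "dh \<alpha> p \<kappa> = \<phi> (pd \<kappa> (hfun M \<alpha> p))"

text \<open>\<open>dh_pred \<alpha> p\<close> is the differential of $h_{\alpha,p-1}$, with $h_{\alpha,-1}$ constant.\<close>

definition dh_pred :: "'n \<Rightarrow> nat \<Rightarrow> 'n \<Rightarrow> 'n tau_algebra" where
  "dh_pred \<alpha> p = (case p of 0 \<Rightarrow> 0 | Suc r \<Rightarrow> dh \<alpha> r)"

lemma parv_dh [simp]: "parv 0 (dh \<alpha> p)"
  by (simp add: dh_def)

lemma \<phi>_const_delta:
  fixes X :: "'n \<Rightarrow> 'n tau_algebra"
  shows "(\<Sum>\<beta>\<in>UNIV. \<phi> (\<lambda>_. if \<alpha> = \<beta> then 1 else 0) * X \<beta>) = component M (X \<alpha>)"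
proof -
  have "\<phi> (\<lambda>_. if \<alpha> = \<beta> then 1 else 0) * X \<beta> = (if \<alpha> = \<beta> then component M (X \<beta>) else 0)" for \<beta>
    by (auto simp: q_one_mult zero_fun_def[symmetric] one_fun_def[symmetric])
  then show ?thesis by (simp only: sum.delta' finite_UNIV) simp
qed

text \<open>The gradient of h_{alpha,0} is a row of the metric and cancels the inverse metric in the
  pairing. This makes the values of a flow on Phi_{alpha,0} and on sigma agree.\<close>

lemma pairing_dh_0: "(\<And>\<beta>. component M (Y \<beta>) = Y \<beta>) \<Longrightarrow> pairing (dh \<alpha> 0) Y = Y \<alpha>"
proof -
  assume Y: "\<And>\<beta>. component M (Y \<beta>) = Y \<beta>"
  have dh: "dh \<alpha> 0 \<kappa> = \<phi> (\<lambda>_. \<eta> \<alpha> \<kappa>)" for \<kappa>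
    unfolding dh_def by (rule \<phi>_cong) (rule pd_hfun_0)
  have "pairing (dh \<alpha> 0) Y = (\<Sum>\<beta>\<in>UNIV. \<Sum>\<kappa>\<in>UNIV. \<phi> (\<lambda>_. \<eta> \<alpha> \<kappa>) * (\<phi> (\<lambda>_. \<eta>I \<kappa> \<beta>) * Y \<beta>))"
    unfolding pairing_def dh by (subst sum.swap) (simp only: \<phi>_left_commute[of "\<phi> (\<lambda>_. \<eta> \<alpha> _)"])
  also have "\<dots> = (\<Sum>\<beta>\<in>UNIV. \<phi> (\<lambda>_. if \<alpha> = \<beta> then 1 else 0) * Y \<beta>)"
    by (simp only: \<phi>_sum_mult holo_on_const eta_etaI)
  finally show ?thesis by (simp add: \<phi>_const_delta Y)
qed

text \<open>The x-derivative of v with its index lowered, since products are taken of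
  covectors.\<close>

definition vx :: "'n \<Rightarrow> 'n tau_algebra" where
  "vx \<delta> = (\<Sum>\<beta>\<in>UNIV. \<phi> (\<lambda>_. \<eta> \<delta> \<beta>) * \<g> (V \<beta> 1))"

definition sig :: "nat \<Rightarrow> 'n \<Rightarrow> 'n tau_algebra" where
  "sig k \<alpha> = \<g> (Sg \<alpha> k 0)"

definition sig1 :: "nat \<Rightarrow> 'n \<Rightarrow> 'n tau_algebra" where
  "sig1 k \<alpha> = \<g> (Sg \<alpha> k 1)"

lemma ddv_sig: "ddv (sig k) = sig1 k"
  by (simp add: sig_def sig1_def fun_eq_iff)

lemma parv_sig [simp]: "parv 1 (sig k)" and parv_sig1 [simp]: "parv 1 (sig1 k)"
  using par_gen[of "Sg _ k _"] by (simp_all add: sig_def sig1_def)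

lemma parv_vx [simp]: "parv 0 vx"
  using par_gen[of "V _ 1"] unfolding vx_def by (auto intro!: par_sum par_\<phi>_mult)

end

section \<open>The velocity covector of a derivation\<close>

locale tau_velocity = calibrated_frobenius M + tau_derivation M e d
  for M :: "'n::finite frobenius_data" and e d
begin

definition vel :: "'n \<Rightarrow> 'n tau_algebra" where
  "vel \<delta> = (\<Sum>\<beta>\<in>UNIV. \<phi> (\<lambda>_. \<eta> \<delta> \<beta>) * d (V \<beta> 0))"

lemma parv_vel: "parv e vel"
  using par_d[of "V _ 0"] unfolding vel_def by (auto intro!: par_sum par_\<phi>_mult)

lemma raise_vel: "(\<Sum>\<delta>\<in>UNIV. \<phi> (\<lambda>_. \<eta>I \<alpha> \<delta>) * vel \<delta>) = d (V \<alpha> 0)"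
proof -
  have "(\<Sum>\<delta>\<in>UNIV. \<phi> (\<lambda>_. \<eta>I \<alpha> \<delta>) * vel \<delta>)
      = (\<Sum>\<beta>\<in>UNIV. \<Sum>\<delta>\<in>UNIV. \<phi> (\<lambda>_. \<eta>I \<alpha> \<delta>) * (\<phi> (\<lambda>_. \<eta> \<delta> \<beta>) * d (V \<beta> 0)))"
    unfolding vel_def sum_distrib_left by (rule sum.swap)
  also have "\<dots> = (\<Sum>\<beta>\<in>UNIV. \<phi> (\<lambda>_. if \<alpha> = \<beta> then 1 else 0) * d (V \<beta> 0))"
    by (simp only: \<phi>_sum_mult holo_on_const etaI_eta)
  finally show ?thesis by (simp add: \<phi>_const_delta)
qed

lemma dfn_vel:
  assumes "holo f"
  shows "dfn f = (\<Sum>\<delta>\<in>UNIV. \<phi> (\<lambda>x. \<Sum>\<epsilon>\<in>UNIV. \<eta>I \<epsilon> \<delta> * pd \<epsilon> f x) * vel \<delta>)"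
proof -
  have "dfn f = (\<Sum>\<delta>\<in>UNIV. \<Sum>\<alpha>\<in>UNIV. \<phi> (\<lambda>_. \<eta>I \<alpha> \<delta>) * (\<phi> (pd \<alpha> f) * vel \<delta>))"
    unfolding dfn_def raise_vel[symmetric] sum_distrib_left
    by (subst sum.swap) (simp only: \<phi>_left_commute[of "\<phi> (pd _ f)"])
  also have "\<dots> = (\<Sum>\<delta>\<in>UNIV. \<phi> (\<lambda>x. \<Sum>\<epsilon>\<in>UNIV. \<eta>I \<epsilon> \<delta> * pd \<epsilon> f x) * vel \<delta>)"
    using assms by (subst \<phi>_sum_mult) auto
  finally show ?thesis .
qed

lemma dfn_cup: "dfn (cup M \<alpha> \<beta> \<gamma>) = (\<Sum>\<delta>\<in>UNIV. \<phi> (Kfun \<delta> \<alpha> \<beta> \<gamma>) * vel \<delta>)"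
  unfolding dfn_vel[OF holo_cup] Kfun_def ..

text \<open>Second derivatives of h_p are structure constants contracted with the gradient of
  h_{p-1}. For p = 0 the gradient is constant, in accordance with the value 0 of
  \<open>dh_pred \<alpha> 0\<close>.\<close>

lemma dfn_dh: "dfn (pd \<beta> (hfun M \<alpha> p)) = star (dh_pred \<alpha> p) vel \<beta>"
proof (cases p)
  case 0
  have "dfn (pd \<beta> (hfun M \<alpha> 0)) = dfn (\<lambda>_. \<eta> \<alpha> \<beta>)"
    by (rule dfn_cong) (rule pd_hfun_0)
  then show ?thesis by (simp add: 0 dh_pred_def star_zero_left)
next
  case (Suc r)
  have c: "(\<Sum>\<epsilon>\<in>UNIV. \<eta>I \<epsilon> \<delta> * pd \<epsilon> (pd \<beta> (hfun M \<alpha> p)) x) = (\<Sum>\<kappa>\<in>UNIV. pd \<kappa> (hfun M \<alpha> r) x * cup M \<kappa> \<delta> \<beta> x)"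
    if "x \<in> X0" for x \<delta>
    using that unfolding Suc pd_pd_hfun_Suc[OF that]
    by (simp add: cup_cmul sum_distrib_left mult_ac etaI_sym[of _ \<delta>]) (rule sum.swap)
  have "dfn (pd \<beta> (hfun M \<alpha> p)) = (\<Sum>\<delta>\<in>UNIV. \<phi> (\<lambda>x. \<Sum>\<kappa>\<in>UNIV. pd \<kappa> (hfun M \<alpha> r) x * cup M \<kappa> \<delta> \<beta> x) * vel \<delta>)"
    unfolding dfn_vel[OF holo_on_pd[OF holo_hfun]]
    by (simp only: \<phi>_cong[OF c])
  also have "\<dots> = (\<Sum>\<delta>\<in>UNIV. \<Sum>\<kappa>\<in>UNIV. \<phi> (pd \<kappa> (hfun M \<alpha> r)) * (\<phi> (cup M \<kappa> \<delta> \<beta>) * vel \<delta>))"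
    by (subst \<phi>_sum_mult) (auto intro: holo_hfun holo_cup)
  also have "\<dots> = star (dh \<alpha> r) vel \<beta>"
    unfolding star_def by (subst sum.swap) (simp only: dh_def \<phi>_left_commute[of "\<phi> (pd _ _)"])
  finally show ?thesis by (simp add: Suc dh_pred_def)
qed

lemma dfn_Ufun: "(\<Sum>\<beta>\<in>UNIV. dfn (Ufun \<beta> \<delta>) * X \<beta>) = (Np (star vel X) + star vel (Nm X)) \<delta>"
proof -
  have c: "(\<Sum>\<gamma>\<in>UNIV. \<eta>I \<gamma> \<epsilon> * pd \<gamma> (Ufun \<beta> \<delta>) x) = ((1/2 + \<mu> \<delta>) + (1/2 - \<mu> \<beta>)) * cup M \<epsilon> \<beta> \<delta> x"
    if "x \<in> X0" for x \<epsilon> \<beta>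
    using that by (simp add: pd_Ufun cup_def sum_distrib_left mult_ac etaI_sym[of _ \<epsilon>] cmul_sym[of x _ \<delta>])
      (simp add: algebra_simps)
  have "(\<Sum>\<beta>\<in>UNIV. dfn (Ufun \<beta> \<delta>) * X \<beta>)
      = (\<Sum>\<beta>\<in>UNIV. \<Sum>\<epsilon>\<in>UNIV. \<phi> (((\<lambda>_. 1/2 + \<mu> \<delta>) + (\<lambda>_. 1/2 - \<mu> \<beta>)) * cup M \<epsilon> \<beta> \<delta>) * (vel \<epsilon> * X \<beta>))"
    unfolding dfn_vel[OF holo_Ufun] sum_distrib_right mult.assoc
    by (intro sum.cong refl arg_cong2[where f = "(*)"] \<phi>_cong) (simp add: c)
  also have "\<dots> = (\<Sum>\<beta>\<in>UNIV. \<Sum>\<epsilon>\<in>UNIV. \<phi> (\<lambda>_. 1/2 + \<mu> \<delta>) * (\<phi> (cup M \<epsilon> \<beta> \<delta>) * (vel \<epsilon> * X \<beta>))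
      + \<phi> (cup M \<epsilon> \<beta> \<delta>) * (vel \<epsilon> * (\<phi> (\<lambda>_. 1/2 - \<mu> \<beta>) * X \<beta>)))"
  proof (intro sum.cong refl)
    fix \<beta> \<epsilon>
    have "\<phi> (((\<lambda>_. 1/2 + \<mu> \<delta>) + (\<lambda>_. 1/2 - \<mu> \<beta>)) * cup M \<epsilon> \<beta> \<delta>)
      = (\<phi> (\<lambda>_. 1/2 + \<mu> \<delta>) + \<phi> (\<lambda>_. 1/2 - \<mu> \<beta>)) * \<phi> (cup M \<epsilon> \<beta> \<delta>)"
      by (simp only: \<phi>_mult \<phi>_add holo_add holo_on_const holo_cup)
    then show "\<phi> (((\<lambda>_. 1/2 + \<mu> \<delta>) + (\<lambda>_. 1/2 - \<mu> \<beta>)) * cup M \<epsilon> \<beta> \<delta>) * (vel \<epsilon> * X \<beta>)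
      = \<phi> (\<lambda>_. 1/2 + \<mu> \<delta>) * (\<phi> (cup M \<epsilon> \<beta> \<delta>) * (vel \<epsilon> * X \<beta>))
      + \<phi> (cup M \<epsilon> \<beta> \<delta>) * (vel \<epsilon> * (\<phi> (\<lambda>_. 1/2 - \<mu> \<beta>) * X \<beta>))"
      by (simp only: distrib_right mult.assoc \<phi>_left_commute[of "vel \<epsilon>" "\<lambda>_. 1/2 - \<mu> \<beta>"]
          \<phi>_left_commute[of "\<phi> (cup M \<epsilon> \<beta> \<delta>)" "\<lambda>_. 1/2 - \<mu> \<beta>"])
  qed
  also have "\<dots> = (Np (star vel X) + star vel (Nm X)) \<delta>"
    unfolding plus_fun_apply scal_def star_def sum_distrib_left
    by (simp only: sum.distrib) (subst (1 2) sum.swap, rule refl)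
  finally show ?thesis .
qed

end

sublocale calibrated_frobenius \<subseteq> x: tau_velocity M 0 "\<lambda>g. cls M (dx_gen M g)"
  by unfold_locales

context calibrated_frobenius
begin

lemma x_vel: "x.vel = vx"
  by (simp add: fun_eq_iff x.vel_def vx_def)

lemma dd_star: "ddv (star X Y) = star (ddv X) Y + star X (ddv Y) + C4 vx X Y"
proof
  fix \<gamma>
  have "dd (star X Y \<gamma>) = (\<Sum>\<alpha>\<in>UNIV. \<Sum>\<beta>\<in>UNIV. x.dfn (cup M \<alpha> \<beta> \<gamma>) * (X \<alpha> * Y \<beta>)
      + (\<phi> (cup M \<alpha> \<beta> \<gamma>) * (dd (X \<alpha>) * Y \<beta>) + \<phi> (cup M \<alpha> \<beta> \<gamma>) * (X \<alpha> * dd (Y \<beta>))))"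
    by (simp add: star_def dd_sum dd_mult[of "\<phi> _"] dd_mult[of "X _"] dd_\<phi> holo_cup distrib_left)
  also have "\<dots> = (\<Sum>\<alpha>\<in>UNIV. \<Sum>\<beta>\<in>UNIV. x.dfn (cup M \<alpha> \<beta> \<gamma>) * (X \<alpha> * Y \<beta>)) + (star (ddv X) Y \<gamma> + star X (ddv Y) \<gamma>)"
    by (simp add: star_def sum.distrib)
  also have "(\<Sum>\<alpha>\<in>UNIV. \<Sum>\<beta>\<in>UNIV. x.dfn (cup M \<alpha> \<beta> \<gamma>) * (X \<alpha> * Y \<beta>)) = C4 vx X Y \<gamma>"
    unfolding C4_def x.dfn_cup x_vel sum_distrib_right mult.assoc by (rule sum_rotate[symmetric])
  finally show "dd (star X Y \<gamma>) = (star (ddv X) Y + star X (ddv Y) + C4 vx X Y) \<gamma>"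
    by (simp add: algebra_simps)
qed

lemma dd_Uop: "ddv (Uop X) = Uop (ddv X) + (Np (star vx X) + star vx (Nm X))"
proof
  fix \<delta>
  have "dd (Uop X \<delta>) = (\<Sum>\<beta>\<in>UNIV. x.dfn (Ufun \<beta> \<delta>) * X \<beta>) + Uop (ddv X) \<delta>"
    by (simp add: Uop_def dd_sum dd_mult dd_\<phi> holo_Ufun sum.distrib)
  then show "dd (Uop X \<delta>) = (Uop (ddv X) + (Np (star vx X) + star vx (Nm X))) \<delta>"
    unfolding x.dfn_Ufun x_vel by (simp add: add.commute)
qed

end

section \<open>Derivations preserving the relations\<close>

context calibrated_frobenius
begin

definition lower :: "('n \<Rightarrow> 'n tau_algebra) \<Rightarrow> 'n \<Rightarrow> 'n tau_algebra" where
  "lower a \<delta> = (\<Sum>\<gamma>\<in>UNIV. \<phi> (\<lambda>_. \<eta> \<delta> \<gamma>) * a \<gamma>)"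

definition raise :: "('n \<Rightarrow> 'n tau_algebra) \<Rightarrow> 'n \<Rightarrow> 'n tau_algebra" where
  "raise a \<alpha> = (\<Sum>\<gamma>\<in>UNIV. \<phi> (\<lambda>_. \<eta>I \<alpha> \<gamma>) * a \<gamma>)"

lemma raise_lower: "raise (lower a) \<alpha> = component M (a \<alpha>)"
proof -
  have "raise (lower a) \<alpha> = (\<Sum>\<beta>\<in>UNIV. \<Sum>\<delta>\<in>UNIV. \<phi> (\<lambda>_. \<eta>I \<alpha> \<delta>) * (\<phi> (\<lambda>_. \<eta> \<delta> \<beta>) * a \<beta>))"
    unfolding raise_def lower_def sum_distrib_left by (rule sum.swap)
  also have "\<dots> = (\<Sum>\<beta>\<in>UNIV. \<phi> (\<lambda>_. if \<alpha> = \<beta> then 1 else 0) * a \<beta>)"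
    by (simp only: \<phi>_sum_mult holo_on_const etaI_eta)
  finally show ?thesis by (simp add: \<phi>_const_delta)
qed

lemma lower_raise: "lower (raise a) \<alpha> = component M (a \<alpha>)"
proof -
  have "lower (raise a) \<alpha> = (\<Sum>\<beta>\<in>UNIV. \<Sum>\<delta>\<in>UNIV. \<phi> (\<lambda>_. \<eta> \<alpha> \<delta>) * (\<phi> (\<lambda>_. \<eta>I \<delta> \<beta>) * a \<beta>))"
    unfolding raise_def lower_def sum_distrib_left by (rule sum.swap)
  also have "\<dots> = (\<Sum>\<beta>\<in>UNIV. \<phi> (\<lambda>_. if \<alpha> = \<beta> then 1 else 0) * a \<beta>)"
    by (simp only: \<phi>_sum_mult holo_on_const eta_etaI)
  finally show ?thesis by (simp add: \<phi>_const_delta)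
qed

lemma lower_add: "lower (a + b) = lower a + lower b" and lower_diff: "lower (a - b) = lower a - lower b"
  by (simp_all add: fun_eq_iff lower_def distrib_left right_diff_distrib sum.distrib sum_subtractf)

text \<open>\<open>L\<close> is either the embedding of functions or the action of a derivation on functions.\<close>

lemma lower_Gam:
  assumes lin: "\<And>(c::'n \<Rightarrow> complex) f. (\<And>\<alpha>. holo (f \<alpha>)) \<Longrightarrow> L (\<lambda>x. \<Sum>\<alpha>\<in>UNIV. c \<alpha> * f \<alpha> x) = (\<Sum>\<alpha>\<in>UNIV. \<phi> (\<lambda>_. c \<alpha>) * L (f \<alpha>))"
    and scale: "\<And>c f. holo f \<Longrightarrow> L (\<lambda>x. c * f x) = \<phi> (\<lambda>_. c) * L f"
    and cong: "\<And>f g. (\<And>x. x \<in> X0 \<Longrightarrow> f x = g x) \<Longrightarrow> L f = L g"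
  shows "lower (\<lambda>\<alpha>. \<Sum>\<beta>\<in>UNIV. \<Sum>\<gamma>\<in>UNIV. L (Gam M \<alpha> \<beta> \<gamma>) * (a \<gamma> * b \<beta>)) \<delta>
    = (\<Sum>\<epsilon>\<in>UNIV. \<Sum>\<beta>\<in>UNIV. L (cup M \<epsilon> \<beta> \<delta>) * (lower a \<epsilon> * Nm b \<beta>))"
proof -
  \<comment> \<open>The factor 1/2 - mu_beta depends only on the index contracted with b, so it will
    be absorbed into \<open>Nm b\<close>.\<close>
  have Gam: "L (Gam M \<alpha> \<beta> \<gamma>) = \<phi> (\<lambda>_. 1/2 - \<mu> \<beta>) * L (cup M \<alpha> \<beta> \<gamma>)" for \<alpha> \<beta> \<gamma>
    unfolding scale[OF holo_cup, symmetric] by (rule cong) (simp add: Gam_def)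
  \<comment> \<open>Lowering the free index is traded for lowering the index contracted with a, by
    the symmetry \<open>eta_cup_swap\<close>.\<close>
  have low: "(\<Sum>\<alpha>\<in>UNIV. \<phi> (\<lambda>_. \<eta> \<delta> \<alpha>) * L (cup M \<alpha> \<beta> \<gamma>)) = (\<Sum>\<epsilon>\<in>UNIV. \<phi> (\<lambda>_. \<eta> \<gamma> \<epsilon>) * L (cup M \<epsilon> \<beta> \<delta>))" for \<beta> \<gamma>
  proof -
    have "(\<Sum>\<alpha>\<in>UNIV. \<phi> (\<lambda>_. \<eta> \<delta> \<alpha>) * L (cup M \<alpha> \<beta> \<gamma>)) = L (\<lambda>x. \<Sum>\<alpha>\<in>UNIV. \<eta> \<delta> \<alpha> * cup M \<alpha> \<beta> \<gamma> x)"
      by (rule lin[where c = "\<lambda>\<alpha>. \<eta> \<delta> \<alpha>" and f = "\<lambda>\<alpha>. cup M \<alpha> \<beta> \<gamma>", OF holo_cup, symmetric])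
    also have "\<dots> = L (\<lambda>x. \<Sum>\<epsilon>\<in>UNIV. \<eta> \<gamma> \<epsilon> * cup M \<epsilon> \<beta> \<delta> x)"
      by (rule cong) (rule eta_cup_swap)
    also have "\<dots> = (\<Sum>\<epsilon>\<in>UNIV. \<phi> (\<lambda>_. \<eta> \<gamma> \<epsilon>) * L (cup M \<epsilon> \<beta> \<delta>))"
      by (rule lin[where c = "\<lambda>\<alpha>. \<eta> \<gamma> \<alpha>" and f = "\<lambda>\<alpha>. cup M \<alpha> \<beta> \<delta>", OF holo_cup])
    finally show ?thesis .
  qed
  have "lower (\<lambda>\<alpha>. \<Sum>\<beta>\<in>UNIV. \<Sum>\<gamma>\<in>UNIV. L (Gam M \<alpha> \<beta> \<gamma>) * (a \<gamma> * b \<beta>)) \<delta>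
     = (\<Sum>\<beta>\<in>UNIV. \<Sum>\<gamma>\<in>UNIV. \<phi> (\<lambda>_. 1/2 - \<mu> \<beta>) * ((\<Sum>\<alpha>\<in>UNIV. \<phi> (\<lambda>_. \<eta> \<delta> \<alpha>) * L (cup M \<alpha> \<beta> \<gamma>)) * (a \<gamma> * b \<beta>)))"
    unfolding lower_def sum_distrib_left sum_distrib_right Gam mult.assoc
    by (subst sum_rotate) (simp only: \<phi>_left_commute[of "\<phi> (\<lambda>_. \<eta> \<delta> _)"])
  also have "\<dots> = (\<Sum>\<beta>\<in>UNIV. \<Sum>\<gamma>\<in>UNIV. \<Sum>\<epsilon>\<in>UNIV. \<phi> (\<lambda>_. 1/2 - \<mu> \<beta>) * (\<phi> (\<lambda>_. \<eta> \<gamma> \<epsilon>) * (L (cup M \<epsilon> \<beta> \<delta>) * (a \<gamma> * b \<beta>))))"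
    unfolding low sum_distrib_left sum_distrib_right mult.assoc ..
  also have "\<dots> = (\<Sum>\<beta>\<in>UNIV. \<Sum>\<epsilon>\<in>UNIV. \<Sum>\<gamma>\<in>UNIV. L (cup M \<epsilon> \<beta> \<delta>) * (\<phi> (\<lambda>_. \<eta> \<epsilon> \<gamma>) * a \<gamma> * (\<phi> (\<lambda>_. 1/2 - \<mu> \<beta>) * b \<beta>)))"
  proof (rule sum.cong[OF refl], subst sum.swap, intro sum.cong refl)
    fix \<beta> \<epsilon> \<gamma>
    let ?L = "L (cup M \<epsilon> \<beta> \<delta>)" and ?m = "\<phi> (\<lambda>_. 1/2 - \<mu> \<beta>)" and ?e = "\<phi> (\<lambda>_. \<eta> \<gamma> \<epsilon>)"
    have "?L * (?e * a \<gamma> * (?m * b \<beta>)) = ?L * (?e * (?m * (a \<gamma> * b \<beta>)))"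
      by (simp only: mult.assoc \<phi>_left_commute[of "a \<gamma>" "\<lambda>_. 1/2 - \<mu> \<beta>"])
    also have "\<dots> = ?e * (?m * (?L * (a \<gamma> * b \<beta>)))"
      by (simp only: \<phi>_left_commute[of ?L])
    also have "\<dots> = ?m * (?e * (?L * (a \<gamma> * b \<beta>)))"
      by (rule \<phi>_left_commute)
    finally show "?m * (?e * (?L * (a \<gamma> * b \<beta>))) = ?L * (\<phi> (\<lambda>_. \<eta> \<epsilon> \<gamma>) * a \<gamma> * (?m * b \<beta>))"
      by (simp only: eta_sym[of \<epsilon> \<gamma>])
  qed
  also have "\<dots> = (\<Sum>\<epsilon>\<in>UNIV. \<Sum>\<beta>\<in>UNIV. L (cup M \<epsilon> \<beta> \<delta>) * (lower a \<epsilon> * Nm b \<beta>))"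
    unfolding lower_def scal_def sum_distrib_left sum_distrib_right by (rule sum.swap)
  finally show ?thesis .
qed

lemma \<phi>_lincomb: "(\<And>\<alpha>::'n. holo (f \<alpha>)) \<Longrightarrow> \<phi> (\<lambda>x. \<Sum>\<alpha>\<in>UNIV. c \<alpha> * f \<alpha> x) = (\<Sum>\<alpha>\<in>UNIV. \<phi> (\<lambda>_. c \<alpha>) * \<phi> (f \<alpha>))"
proof -
  assume h: "\<And>\<alpha>::'n. holo (f \<alpha>)"
  have "(\<lambda>x. \<Sum>\<alpha>\<in>UNIV. c \<alpha> * f \<alpha> x) = (\<Sum>\<alpha>\<in>UNIV. (\<lambda>_. c \<alpha>) * f \<alpha>)" by (simp add: sum_fun_eq)
  then show ?thesis using h by (simp add: \<phi>_sum \<phi>_mult holo_mult holo_on_const del: times_fun_apply)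
qed

lemma \<phi>_scale: "holo f \<Longrightarrow> \<phi> (\<lambda>x. c * f x) = \<phi> (\<lambda>_. c) * \<phi> f"
  using \<phi>_mult[OF holo_on_const, of f c] by (simp add: times_fun_def)

lemma lower_Gam_star:
  "lower (\<lambda>\<alpha>. \<Sum>\<beta>\<in>UNIV. \<Sum>\<gamma>\<in>UNIV. \<phi> (Gam M \<alpha> \<beta> \<gamma>) * (a \<gamma> * b \<beta>)) = star (lower a) (Nm b)"
  by (rule ext, subst lower_Gam[where L = "\<lambda>f. \<phi> f"])
     (auto simp: star_def intro: \<phi>_lincomb \<phi>_scale \<phi>_cong)

lemma lower_gup: "lower (\<lambda>\<alpha>. \<Sum>\<beta>\<in>UNIV. \<phi> (gup M \<alpha> \<beta>) * b \<beta>) = Uop b"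
proof
  fix \<delta>
  have "lower (\<lambda>\<alpha>. \<Sum>\<beta>\<in>UNIV. \<phi> (gup M \<alpha> \<beta>) * b \<beta>) \<delta> = (\<Sum>\<beta>\<in>UNIV. \<Sum>\<alpha>\<in>UNIV. \<phi> (\<lambda>_. \<eta> \<delta> \<alpha>) * (\<phi> (gup M \<alpha> \<beta>) * b \<beta>))"
    unfolding lower_def sum_distrib_left by (rule sum.swap)
  then show "lower (\<lambda>\<alpha>. \<Sum>\<beta>\<in>UNIV. \<phi> (gup M \<alpha> \<beta>) * b \<beta>) \<delta> = Uop b \<delta>"
    by (simp only: \<phi>_sum_mult holo_on_const holo_gup Uop_def Ufun_def)
qed

lemma vx_lower: "vx = lower (\<lambda>\<gamma>. \<g> (V \<gamma> 1))"
  by (simp add: fun_eq_iff vx_def lower_def)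

definition rec_rel :: "'n \<Rightarrow> nat \<Rightarrow> 'n superpoly" where
  "rec_rel \<alpha> k = (\<Sum>\<beta>\<in>UNIV. fn (\<lambda>_. \<eta>I \<alpha> \<beta>) * gen (Sg \<beta> (Suc k) 1))
     - ((\<Sum>\<beta>\<in>UNIV. fn (gup M \<alpha> \<beta>) * gen (Sg \<beta> k 1))
        + (\<Sum>\<beta>\<in>UNIV. \<Sum>\<gamma>\<in>UNIV. fn (Gam M \<alpha> \<beta> \<gamma>) * gen (V \<gamma> 1) * gen (Sg \<beta> k 0)))"

lemma rec_rel_dring: "rec_rel \<alpha> k \<in> dring M"
  unfolding rec_rel_def by (intro dring_intros) (simp_all add: holo_on_const holo_gup holo_Gam)

lemma q_rec_rel:
  "q (rec_rel \<alpha> k) = raise (sig1 (Suc k)) \<alpha> - ((\<Sum>\<beta>\<in>UNIV. \<phi> (gup M \<alpha> \<beta>) * sig1 k \<beta>)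
     + (\<Sum>\<beta>\<in>UNIV. \<Sum>\<gamma>\<in>UNIV. \<phi> (Gam M \<alpha> \<beta> \<gamma>) * (\<g> (V \<gamma> 1) * sig k \<beta>)))"
  unfolding rec_rel_def raise_def sig_def sig1_def
  by (simp add: q_diff q_add q_sum q_mult dring_intros holo_on_const holo_gup holo_Gam mult.assoc)

lemma sig_recursion: "sig1 (Suc k) = Uop (sig1 k) + star vx (Nm (sig k))"
proof -
  define R where "R = (\<lambda>\<alpha>. raise (sig1 (Suc k)) \<alpha>)"
  define A where "A = (\<lambda>\<alpha>. \<Sum>\<beta>\<in>UNIV. \<phi> (gup M \<alpha> \<beta>) * sig1 k \<beta>)"
  define B where "B = (\<lambda>\<alpha>. \<Sum>\<beta>\<in>UNIV. \<Sum>\<gamma>\<in>UNIV. \<phi> (Gam M \<alpha> \<beta> \<gamma>) * (\<g> (V \<gamma> 1) * sig k \<beta>))"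
  have "q (rec_rel \<alpha> k) = 0" for \<alpha>
    using relations.bihamiltonian_recursion[of M \<alpha> k] rec_rel_dring[of \<alpha> k]
    by (simp add: q_eq_zero_iff rec_rel_def)
  then have "R = A + B"
    by (simp add: fun_eq_iff q_rec_rel R_def A_def B_def)
  then have "lower R = lower A + lower B" by (simp add: lower_add)
  moreover have "lower R = sig1 (Suc k)"
    unfolding R_def by (rule ext) (simp add: lower_raise sig1_def)
  moreover have "lower A = Uop (sig1 k)" unfolding A_def by (rule lower_gup)
  moreover have "lower B = star vx (Nm (sig k))"
    unfolding B_def vx_lower by (rule lower_Gam_star)
  ultimately show ?thesis by simp
qed

text \<open>One summand of \<open>dx M a\<close> as an element of the free algebra. D and
  \<open>twist\<close> act there, so they cannot be applied to its class
  \<open>x.dterm w f\<close>.\<close>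

definition dx_term :: "'n gen word \<Rightarrow> 'n scalar_fn \<Rightarrow> 'n superpoly" where
  "dx_term w f = (\<Sum>\<alpha>\<in>UNIV. fn (pd \<alpha> f) * gen (V \<alpha> 1)) * mon (letters w) + fn f * dx_word M (letters w)"

lemma dx_eq_sum: "dx M a = (\<Sum>w\<in>Poly_Mapping.keys a. dx_term w (Poly_Mapping.lookup a w))"
  by (simp add: dx_def dx_term_def)

lemma dx_term_dring: "holo f \<Longrightarrow> dx_term w f \<in> dring M"
  unfolding dx_term_def by (intro dring_intros) (auto intro: holo_on_pd)

lemma q_dx_term: "holo f \<Longrightarrow> q (dx_term w f) = x.dterm w f"
  unfolding dx_term_def x.dterm_def x.dfn_def
  by (simp add: q_add q_mult q_sum dring_intros holo_on_pd q_dx_word)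

lemma has_parity_mult: "has_parity i a \<Longrightarrow> has_parity j b \<Longrightarrow> has_parity (i + j) (a * b)"
  unfolding has_parity_def
proof
  fix w assume ab: "\<forall>w\<in>Poly_Mapping.keys a. even (super_degree w + i)" "\<forall>w\<in>Poly_Mapping.keys b. even (super_degree w + j)"
    and "w \<in> Poly_Mapping.keys (a * b)"
  then obtain u v where "w = u + v" "u \<in> Poly_Mapping.keys a" "v \<in> Poly_Mapping.keys b"
    using keys_mult[of a b] by blast
  then show "even (super_degree w + (i + j))" using ab by (auto simp: even_add)
qed

lemma has_parity_fn: "has_parity 0 (fn f)"
  by (simp add: fn_def has_parity_single)

lemma has_parity_dx_word: "has_parity (super_degree (Word w)) (dx_word M w)"
proof (induction w)
  case Nil
  then show ?case by (simp add: has_parity_def)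
next
  case (Cons g w)
  have "has_parity (gdeg g) (gen g)" using has_parity_mon[of "[g]"]
    by (cases "is_odd g") (simp_all add: super_degree_Cons)
  from has_parity_mult[OF this Cons] has_parity_mult[OF has_parity_dx_gen[of g] has_parity_mon[of w]]
  show ?case unfolding dx_word.simps super_degree_Cons_gdeg by (intro has_parity_add)
qed

lemma has_parity_dx_term: "has_parity (super_degree w) (dx_term w f)"
proof -
  have "has_parity 0 (\<Sum>\<alpha>\<in>UNIV. fn (pd \<alpha> f) * gen (V \<alpha> 1))"
    using has_parity_fn_gen[of "V _ 1"] by (intro has_parity_sum) simp
  from has_parity_mult[OF this has_parity_mon[of "letters w"]]
    has_parity_mult[OF has_parity_fn[of f] has_parity_dx_word[of "letters w"]]
  show ?thesis unfolding dx_term_def by (intro has_parity_add) simp_all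
qed

lemma relations_dring: "a \<in> relations M \<Longrightarrow> a \<in> dring M"
proof (induction rule: relations.induct)
  case (bihamiltonian_recursion \<alpha> k)
  then show ?case using rec_rel_dring[of \<alpha> k] by (simp add: rec_rel_def)
next
  case (supercommute g g')
  show ?case by (intro dring_intros) (simp add: dring_intros)
qed (auto intro: dring_intros dx_dring simp: holo_on_coord)

end

context tau_velocity
begin

lemma D_component:
  assumes "a \<in> dring M"
  shows "component M (D a) = D a"
  using open_chart assms
proof (induction rule: dring_induct)
  case (single w f)
  have "component M (dword (letters w)) = dword (letters w)" by (rule par_component[OF par_dword])
  then show ?case by (simp add: D_single dterm_def component_add component_mult)
qed (simp_all add: D_add component_add)

lemma twist_sum: "(\<And>i. i \<in> I \<Longrightarrow> f i \<in> dring M) \<Longrightarrow> twist (sum f I) = (\<Sum>i\<in>I. twist (f i))"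
  by (induction I rule: infinite_finite_induct) (simp_all add: twist_add dring_intros)

text \<open>The x-derivative keeps the parity of every word, so \<open>twist\<close> multiplies each
  summand by the sign of the word it came from.\<close>

lemma twist_dx: "a \<in> dring M \<Longrightarrow> twist (dx M a) = dd (twist a)"
proof -
  assume a: "a \<in> dring M"
  have "twist (dx M a) = (\<Sum>w\<in>Poly_Mapping.keys a. parity_sign (e * super_degree w) (x.dterm w (Poly_Mapping.lookup a w)))"
    unfolding dx_eq_sum using a
    by (simp add: twist_sum dx_term_dring dring_lookup twist_homogeneous[OF dx_term_dring has_parity_dx_term] q_dx_term)
  also have "\<dots> = dd (twist a)"
    using a by (simp add: twist_def dd_sum dd_parity_sign dring_lookup dd_mult dd_\<phi> dd_q x.D_mon x.dterm_def)
  finally show ?thesis .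
qed

lemma pairing_dh_vel: "pairing (dh \<alpha> p) vel = dfn (hfun M \<alpha> p)"
  unfolding dfn_def raise_vel[symmetric] pairing_def dh_def sum_distrib_left
  by (simp only: \<phi>_left_commute[of "\<phi> (pd _ _)"])

lemma dfn_scale: "holo f \<Longrightarrow> dfn (\<lambda>x. c * f x) = \<phi> (\<lambda>_. c) * dfn f"
  using dfn_mult[OF holo_on_const, of f c] by (simp add: times_fun_def)

lemma dfn_lincomb: "(\<And>\<alpha>::'n. holo (f \<alpha>)) \<Longrightarrow> dfn (\<lambda>x. \<Sum>\<alpha>\<in>UNIV. c \<alpha> * f \<alpha> x) = (\<Sum>\<alpha>\<in>UNIV. \<phi> (\<lambda>_. c \<alpha>) * dfn (f \<alpha>))"
proof -
  assume h: "\<And>\<alpha>::'n. holo (f \<alpha>)"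
  have "(\<lambda>x. \<Sum>\<alpha>\<in>UNIV. c \<alpha> * f \<alpha> x) = (\<Sum>\<alpha>\<in>UNIV. (\<lambda>x. c \<alpha> * f \<alpha> x))" by (simp add: sum_fun_eq)
  moreover have "holo (\<lambda>x. c \<alpha> * f \<alpha> x)" for \<alpha>
    by (intro holo_lambda_mult holo_on_const h)
  ultimately show ?thesis using h by (simp add: dfn_sum dfn_scale)
qed

end

text \<open>The last two conditions are the identities $v_x\circ\delta_k=u\circ w_k$ and
  $\delta_{k+1}=\mathcal U\delta_k+u\circ\rho_k$ of the introduction.\<close>

locale tau_flow = tau_velocity M e d
  for M :: "'n::finite frobenius_data" and e d +
  fixes del :: "nat \<Rightarrow> 'n \<Rightarrow> 'n tau_algebra"
  assumes d_V: "d (V \<alpha> (Suc s)) = dd (d (V \<alpha> s))"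
    and d_Sg: "d (Sg \<alpha> k (Suc s)) = dd (d (Sg \<alpha> k s))"
    and d_Sg_0: "d (Sg \<alpha> k 0) = del k \<alpha>"
    and d_Ff: "dd (d (Ff \<alpha> p)) = pairing (dh \<alpha> p) vel"
    and d_Ph: "d (Ph \<alpha> p n) = pairing (dh \<alpha> p) (del n)"
    and pos_del: "pos (del k \<alpha>)"
    and star_vx_del: "star vx (del k) = star vel (sig1 k)"
    and del_Suc: "del (Suc k) = Uop (del k) + star vel (Nm (sig k))"
begin

lemma del_component [simp]: "component M (del k \<alpha>) = del k \<alpha>"
  using d_component[of "Sg \<alpha> k 0"] by (simp add: d_Sg_0)

lemma ddv_vel: "ddv vel = lower (\<lambda>\<gamma>. d (V \<gamma> 1))"
  by (simp add: fun_eq_iff vel_def lower_def dd_sum dd_const_mult d_V)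

lemma pos_d: "is_odd g \<Longrightarrow> pos (d g)"
proof (cases g)
  case (Sg \<alpha> k s)
  show ?thesis unfolding Sg
    by (induction s) (simp_all add: d_Sg_0 d_Sg pos_del pos_dd)
next
  case (Ph \<alpha> p n)
  then show ?thesis unfolding Ph d_Ph pairing_def
    by (auto intro!: pos_sum pos_mult_right pos_del)
qed auto

lemma D_dx_gen: "D (dx_gen M g) = dd (d g)"
proof (cases g)
  case (Ff \<alpha> p)
  then show ?thesis by (simp add: d_Ff pairing_dh_vel)
next
  case (Ph \<alpha> p n)
  have h: "holo (\<lambda>x. \<eta>I \<beta> \<gamma> * pd \<beta> (hfun M \<alpha> p) x)" for \<beta> \<gamma>
    by (intro holo_lambda_mult holo_on_const holo_on_pd holo_hfun)
  have "D (dx_gen M g) = (\<Sum>\<beta>\<in>UNIV. \<Sum>\<gamma>\<in>UNIV.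
      dfn (\<lambda>x. \<eta>I \<beta> \<gamma> * pd \<beta> (hfun M \<alpha> p) x) * sig1 n \<gamma>
      + \<phi> (\<lambda>x. \<eta>I \<beta> \<gamma> * pd \<beta> (hfun M \<alpha> p) x) * d (Sg \<gamma> n 1))"
    using h by (simp add: Ph D_sum D_fn_mult dring_intros sig1_def mult.commute[of "pd _ _ _"])
  also have "\<dots> = pairing (star (dh_pred \<alpha> p) vel) (sig1 n) + pairing (dh \<alpha> p) (ddv (del n))"
    by (simp add: pairing_def dfn_scale \<phi>_scale holo_on_pd holo_hfun dfn_dh dh_def d_Sg d_Sg_0
        mult.assoc sum.distrib)
  \<comment> \<open>The identity v_x o delta_n = u o w_n exchanges the derivative of dh along the
    flow for its x-derivative.\<close>
  also have "pairing (star (dh_pred \<alpha> p) vel) (sig1 n) = pairing (star (dh_pred \<alpha> p) vx) (del n)"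
    by (simp add: pairing_star star_vx_del)
  also have "star (dh_pred \<alpha> p) vx = ddv (dh \<alpha> p)"
    by (rule ext) (simp add: dh_def dd_\<phi> holo_on_pd holo_hfun x.dfn_dh x_vel)
  finally show ?thesis by (simp add: Ph d_Ph dd_pairing)
qed (simp_all add: d_V d_Sg)

text \<open>With the free index lowered, the image of the recursion under D is compared with the
  x-derivative of the assumed formula for \<open>del (Suc k)\<close>.\<close>

lemma D_rec_rel: "D (rec_rel \<alpha> k) = 0"
proof -
  define A where "A = (\<lambda>\<alpha>. raise (ddv (del (Suc k))) \<alpha>)"
  define B1 where "B1 = (\<lambda>\<alpha>. \<Sum>\<beta>\<in>UNIV. dfn (gup M \<alpha> \<beta>) * sig1 k \<beta>)"
  define B2 where "B2 = (\<lambda>\<alpha>. \<Sum>\<beta>\<in>UNIV. \<phi> (gup M \<alpha> \<beta>) * ddv (del k) \<beta>)"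
  define C1 where "C1 = (\<lambda>\<alpha>. \<Sum>\<beta>\<in>UNIV. \<Sum>\<gamma>\<in>UNIV. dfn (Gam M \<alpha> \<beta> \<gamma>) * (\<g> (V \<gamma> 1) * sig k \<beta>))"
  define C2 where "C2 = (\<lambda>\<alpha>. \<Sum>\<beta>\<in>UNIV. \<Sum>\<gamma>\<in>UNIV. \<phi> (Gam M \<alpha> \<beta> \<gamma>) * (d (V \<gamma> 1) * sig k \<beta>))"
  define C3 where "C3 = (\<lambda>\<alpha>. \<Sum>\<beta>\<in>UNIV. \<Sum>\<gamma>\<in>UNIV. \<phi> (Gam M \<alpha> \<beta> \<gamma>) * (\<g> (V \<gamma> 1) * del k \<beta>))"
  have "D (rec_rel \<alpha> k) = A \<alpha> - (B1 \<alpha> + B2 \<alpha> + (C1 \<alpha> + C2 \<alpha> + C3 \<alpha>))" for \<alpha>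
    unfolding rec_rel_def A_def B1_def B2_def C1_def C2_def C3_def raise_def
    by (simp add: D_diff D_add D_sum D_fn_mult D_gen_mult q_mult dring_intros holo_on_const holo_gup holo_Gam
        mult.assoc d_Sg d_Sg_0 sig_def sig1_def sum.distrib distrib_left add.assoc)
  then have R: "(\<lambda>\<alpha>. D (rec_rel \<alpha> k)) = A - (B1 + B2 + (C1 + C2 + C3))"
    by (simp add: fun_eq_iff)
  have lA: "lower A = ddv (del (Suc k))"
    unfolding A_def by (rule ext) (simp add: lower_raise)
  have lB1: "lower B1 = Np (star vel (sig1 k)) + star vel (Nm (sig1 k))"
  proof
    fix \<delta>
    have "lower B1 \<delta> = (\<Sum>\<beta>\<in>UNIV. (\<Sum>\<alpha>\<in>UNIV. \<phi> (\<lambda>_. \<eta> \<delta> \<alpha>) * dfn (gup M \<alpha> \<beta>)) * sig1 k \<beta>)"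
      unfolding B1_def lower_def sum_distrib_left sum_distrib_right mult.assoc by (rule sum.swap)
    also have "\<dots> = (\<Sum>\<beta>\<in>UNIV. dfn (Ufun \<beta> \<delta>) * sig1 k \<beta>)"
      unfolding Ufun_def by (simp add: dfn_lincomb holo_gup)
    finally show "lower B1 \<delta> = (Np (star vel (sig1 k)) + star vel (Nm (sig1 k))) \<delta>"
      unfolding dfn_Ufun .
  qed
  have lB2: "lower B2 = Uop (ddv (del k))" unfolding B2_def by (rule lower_gup)
  have lC1: "lower C1 = C4 vel vx (Nm (sig k))"
  proof
    fix \<delta>
    have "lower C1 \<delta> = (\<Sum>\<epsilon>\<in>UNIV. \<Sum>\<beta>\<in>UNIV. dfn (cup M \<epsilon> \<beta> \<delta>) * (vx \<epsilon> * Nm (sig k) \<beta>))"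
      unfolding C1_def vx_lower
      by (rule lower_Gam) (auto intro: dfn_lincomb dfn_scale dfn_cong)
    also have "\<dots> = C4 vel vx (Nm (sig k)) \<delta>"
      unfolding C4_def dfn_cup sum_distrib_right mult.assoc by (rule sum_rotate[symmetric])
    finally show "lower C1 \<delta> = C4 vel vx (Nm (sig k)) \<delta>" .
  qed
  have lC2: "lower C2 = star (ddv vel) (Nm (sig k))"
    unfolding C2_def ddv_vel by (rule lower_Gam_star)
  have lC3: "lower C3 = star vx (Nm (del k))"
    unfolding C3_def vx_lower by (rule lower_Gam_star)
  have "ddv (del (Suc k)) = ddv (Uop (del k)) + ddv (star vel (Nm (sig k)))"
    by (simp add: del_Suc fun_eq_iff dd_add)
  \<comment> \<open>\<open>star_vx_del\<close> makes the two \<open>Np\<close> terms equal and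
    \<open>C4_swap\<close> the two derivatives of structure constants; all remaining terms already
    coincide.\<close>
  also have "\<dots> = Uop (ddv (del k)) + (Np (star vel (sig1 k)) + star vx (Nm (del k)))
      + (star (ddv vel) (Nm (sig k)) + star vel (Nm (sig1 k)) + C4 vel vx (Nm (sig k)))"
    unfolding dd_Uop dd_star ddv_scal ddv_sig star_vx_del C4_swap[OF parv_vx parv_vel] ..
  finally have "lower (\<lambda>\<alpha>. D (rec_rel \<alpha> k)) = 0"
    unfolding R lower_diff lower_add lA lB1 lB2 lC1 lC2 lC3 by (simp add: algebra_simps del: plus_fun_apply)
  \<comment> \<open>Raising undoes lowering on the factor of M, so nothing was lost by lowering the
    index.\<close>
  then have "raise (lower (\<lambda>\<alpha>. D (rec_rel \<alpha> k))) \<alpha> = 0"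
    by (simp add: raise_def)
  moreover have "component M (D (rec_rel \<alpha> k)) = D (rec_rel \<alpha> k)"
    by (rule D_component[OF rec_rel_dring])
  ultimately show ?thesis by (simp add: raise_lower)
qed

lemma D_dx_word: "D (dx_word M w) = dd (dword w)"
proof (induction w)
  case (Cons g w)
  have "twist (dx_gen M g) = parity_sign (e * gdeg g) (q (dx_gen M g))"
    by (rule twist_homogeneous[OF dx_gen_dring has_parity_dx_gen])
  then have "D (dx_word M (g # w)) = dd (d g) * q (mon w) + parity_sign (e * gdeg g) (q (dx_gen M g) * dword w)
      + (d g * q (dx_word M w) + parity_sign (e * gdeg g) (\<g> g * dd (dword w)))"
    using D_mult[OF dx_gen_dring[of g] mon_dring[of w]] D_gen_mult[OF dx_word_dring, of g w]
    by (simp only: dx_word.simps D_add D_dx_gen D_mon Cons mult_dring[OF open_chart]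
        dx_gen_dring mon_dring dx_word_dring parity_sign_mult_left)
  also have "\<dots> = dd (dword (g # w))"
    by (simp add: dd_add dd_mult dd_parity_sign dd_q x.D_mon q_dx_word parity_sign_add del: dx_gen.simps)
  finally show ?case .
qed simp

text \<open>Second derivatives of f occur contracted with v_x and with the velocity. Their symmetry
  exchanges the two contractions, without a sign because v_x is even.\<close>

lemma dd_dfn:
  assumes "holo f"
  shows "dd (dfn f) = (\<Sum>\<alpha>\<in>UNIV. dfn (pd \<alpha> f) * \<g> (V \<alpha> 1) + \<phi> (pd \<alpha> f) * d (V \<alpha> 1))"
proof -
  have "(\<Sum>\<alpha>\<in>UNIV. dd (\<phi> (pd \<alpha> f)) * d (V \<alpha> 0))
      = (\<Sum>\<alpha>\<in>UNIV. \<Sum>\<beta>\<in>UNIV. \<phi> (pd \<beta> (pd \<alpha> f)) * (\<g> (V \<beta> 1) * d (V \<alpha> 0)))"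
    using assms by (simp add: dd_\<phi> holo_on_pd x.dfn_def sum_distrib_right mult.assoc)
  also have "\<dots> = (\<Sum>\<beta>\<in>UNIV. \<Sum>\<alpha>\<in>UNIV. \<phi> (pd \<alpha> (pd \<beta> f)) * (d (V \<alpha> 0) * \<g> (V \<beta> 1)))"
  proof (subst sum.swap, intro sum.cong refl)
    fix \<alpha> \<beta>
    have "\<g> (V \<beta> 1) * d (V \<alpha> 0) = d (V \<alpha> 0) * \<g> (V \<beta> 1)"
      using supercommute[OF par_gen[of "V \<beta> 1"] par_d[of "V \<alpha> 0"]] by simp
    moreover have "\<phi> (pd \<beta> (pd \<alpha> f)) = \<phi> (pd \<alpha> (pd \<beta> f))"
      by (rule \<phi>_cong) (rule pd_commute[OF open_chart assms])
    ultimately show "\<phi> (pd \<beta> (pd \<alpha> f)) * (\<g> (V \<beta> 1) * d (V \<alpha> 0)) = \<phi> (pd \<alpha> (pd \<beta> f)) * (d (V \<alpha> 0) * \<g> (V \<beta> 1))"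
      by simp
  qed
  also have "\<dots> = (\<Sum>\<beta>\<in>UNIV. dfn (pd \<beta> f) * \<g> (V \<beta> 1))"
    by (simp add: dfn_def sum_distrib_right mult.assoc)
  finally show ?thesis
    using d_V[of _ 0] by (simp add: dfn_def[of f] dd_sum dd_mult sum.distrib)
qed

lemma D_dx_term:
  assumes "holo f"
  shows "D (dx_term w f) = dd (dterm w f)"
proof -
  let ?w = "letters w"
  have "D ((\<Sum>\<alpha>\<in>UNIV. fn (pd \<alpha> f) * gen (V \<alpha> 1)) * mon ?w)
      = (\<Sum>\<alpha>\<in>UNIV. dfn (pd \<alpha> f) * (\<g> (V \<alpha> 1) * q (mon ?w))
          + \<phi> (pd \<alpha> f) * (d (V \<alpha> 1) * q (mon ?w) + \<g> (V \<alpha> 1) * dword ?w))"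
    using assms by (simp add: sum_distrib_right mult.assoc D_sum D_fn_mult D_gen_mult q_mult dring_intros
        holo_on_pd D_mon)
  also have "\<dots> = dd (dfn f) * q (mon ?w) + x.dfn f * dword ?w"
    unfolding dd_dfn[OF assms] x.dfn_def
    by (simp add: sum_distrib_right sum.distrib distrib_left distrib_right mult.assoc add.assoc)
  finally have "D (dx_term w f) = dd (dfn f) * q (mon ?w) + x.dfn f * dword ?w
      + (dfn f * q (dx_word M ?w) + \<phi> f * dd (dword ?w))"
    unfolding dx_term_def using assms
    by (simp add: D_add D_fn_mult D_dx_word dring_intros holo_on_pd)
  then show ?thesis
    using assms by (simp add: dterm_def dd_add dd_mult dd_\<phi> dd_q x.D_mon q_dx_word)
qed

lemma D_dx: "a \<in> dring M \<Longrightarrow> D (dx M a) = dd (D a)"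
  unfolding dx_eq_sum D_def[of a] dd_sum
  by (subst D_sum) (simp_all add: dx_term_dring dring_lookup D_dx_term)

lemma twist_homogeneous_zero:
  "a \<in> relations M \<Longrightarrow> has_parity i a \<Longrightarrow> twist a = 0"
  using relations_dring[of a] q_eq_zero_iff[of a] by (simp add: twist_homogeneous)

lemma has_parity_uminus: "has_parity i a \<Longrightarrow> has_parity i (- a :: 'n superpoly)"
  by (simp add: has_parity_def Poly_Mapping.keys_minus)

lemma has_parity_diff: "has_parity i a \<Longrightarrow> has_parity i b \<Longrightarrow> has_parity i (a - b :: 'n superpoly)"
  using has_parity_add[OF _ has_parity_uminus, of i a b] by simp

lemma has_parity_gen: "has_parity (gdeg g) (gen g)"
  using has_parity_mon[of "[g]"] by (cases "is_odd g") (simp_all add: super_degree_Cons)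

lemma has_parity_rec_rel: "has_parity 1 (rec_rel \<alpha> k)"
proof -
  have "has_parity 1 (fn f * gen (Sg \<beta> j s))" for f \<beta> j s
    using has_parity_fn_gen[of "Sg \<beta> j s"] by simp
  moreover have "has_parity 1 (fn f * gen (V \<gamma> 1) * gen (Sg \<beta> j s))" for f \<beta> \<gamma> j s
    using has_parity_mult[OF has_parity_fn_gen[of "V \<gamma> 1" f] has_parity_mon[of "[Sg \<beta> j s]"]]
    by (simp add: super_degree_Cons)
  ultimately show ?thesis
    unfolding rec_rel_def by (intro has_parity_diff has_parity_add has_parity_sum)
qed

text \<open>For a in the ideal, D (b * a) = D b * q a + twist b * D a and D (a * b) = D a * q b +
  twist a * D b. The last term forces \<open>twist a = 0\<close> into the induction: a need not be
  homogeneous, so it cannot be read off from q a = 0.\<close>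

lemma twist_D_relations: "a \<in> relations M \<Longrightarrow> twist a = 0 \<and> D a = 0"
proof (induction rule: relations.induct)
  case zero
  show ?case by simp
next
  case (add a b)
  then show ?case by (simp add: twist_add D_add relations_dring)
next
  case (lmult a b)
  then have "q a = 0" "a \<in> dring M" using relations_dring[of a] by (auto simp: q_eq_zero_iff)
  with lmult show ?case by (simp add: twist_mult D_mult)
next
  case (rmult a b)
  then have "q a = 0" "a \<in> dring M" using relations_dring[of a] by (auto simp: q_eq_zero_iff)
  with rmult show ?case by (simp add: twist_mult D_mult)
next
  case (dx_closed a)
  then show ?case using relations_dring[of a] by (simp add: twist_dx D_dx)
next
  case (chart_fn a)
  have "dfn a = dfn 0" by (rule dfn_cong) (simp add: chart_fn)
  moreover have "\<phi> a = \<phi> 0" by (rule \<phi>_cong) (simp add: chart_fn)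
  ultimately show ?case by simp
next
  case (supercommute g g')
  let ?i = "gdeg g" and ?j = "gdeg g'"
  let ?c = "(if is_odd g \<and> is_odd g' then - 1 else 1) * (gen g' * gen g) :: 'n superpoly"
  have c: "?c = parity_sign (?i * ?j) (gen g' * gen g)" by (simp add: parity_sign_def)
  have "has_parity (?i + ?j) (gen g * gen g')" by (rule has_parity_mult[OF has_parity_gen has_parity_gen])
  moreover have "has_parity (?i + ?j) ?c"
    unfolding c using has_parity_mult[OF has_parity_gen[of g'] has_parity_gen[of g]] has_parity_uminus
    by (simp add: parity_sign_def add.commute)
  ultimately have "has_parity (?i + ?j) (gen g * gen g' - ?c)" by (rule has_parity_diff)
  then have t: "twist (gen g * gen g' - ?c) = 0"
    by (rule twist_homogeneous_zero[OF relations.supercommute])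
  have D_sign: "D (parity_sign n a) = parity_sign n (D a)" if "a \<in> dring M" for n a
    using that by (simp add: parity_sign_def D_uminus)
  have cd: "?c \<in> dring M" unfolding c by (simp add: parity_sign_def dring_intros)
  have "D (gen g * gen g') = d g * \<g> g' + parity_sign (e * ?i) (\<g> g * d g')"
    by (simp only: D_gen_mult mon_dring D_gen)
  also have "d g * \<g> g' = parity_sign ((e + ?i) * ?j) (\<g> g' * d g)"
    by (rule tau_chart.supercommute[OF tau_chart_axioms par_d par_gen])
  also have "\<g> g * d g' = parity_sign (?i * (e + ?j)) (d g' * \<g> g)"
    by (rule tau_chart.supercommute[OF tau_chart_axioms par_gen par_d])
  also have "parity_sign ((e + ?i) * ?j) (\<g> g' * d g) + parity_sign (e * ?i) (parity_sign (?i * (e + ?j)) (d g' * \<g> g))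
      = parity_sign (?i * ?j) (d g' * \<g> g + parity_sign (e * ?j) (\<g> g' * d g))"
    by (auto simp: parity_sign_def)
  also have "\<dots> = D ?c"
    unfolding c by (simp only: D_sign D_gen_mult mon_dring D_gen mult_dring[OF open_chart])
  finally have "D (gen g * gen g' - ?c) = 0"
    using cd by (simp only: D_diff mult_dring[OF open_chart] mon_dring) simp
  with t show ?case by blast
next
  case (coordinate \<alpha>)
  have "has_parity 0 (gen (V \<alpha> 0) - fn (\<lambda>x. x $ \<alpha>))"
    using has_parity_gen[of "V \<alpha> 0"] has_parity_fn by (intro has_parity_diff) simp_all
  then have t: "twist (gen (V \<alpha> 0) - fn (\<lambda>x. x $ \<alpha>)) = 0"
    by (rule twist_homogeneous_zero[OF relations.coordinate])
  have "pd \<beta> (\<lambda>x. x $ \<alpha>) = (\<lambda>_. if \<alpha> = \<beta> then 1 else 0)" for \<beta> :: 'n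
    by (auto simp: fun_eq_iff)
  then have "dfn (\<lambda>x. x $ \<alpha>) = d (V \<alpha> 0)"
    unfolding dfn_def by (simp only: \<phi>_const_delta d_component)
  with t show ?case by (simp add: D_diff holo_on_coord)
next
  case (bihamiltonian_recursion \<alpha> k)
  show ?case
    using twist_homogeneous_zero[OF relations.bihamiltonian_recursion has_parity_rec_rel[unfolded rec_rel_def]]
      D_rec_rel[unfolded rec_rel_def] by blast
next
  case (Phi_zero \<alpha> n)
  have "has_parity 1 (gen (Ph \<alpha> 0 n) - gen (Sg \<alpha> n 0) :: 'n superpoly)"
    using has_parity_gen[of "Ph \<alpha> 0 n"] has_parity_gen[of "Sg \<alpha> n 0"] by (intro has_parity_diff) simp_all
  then have t: "twist (gen (Ph \<alpha> 0 n) - gen (Sg \<alpha> n 0)) = 0"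
    by (rule twist_homogeneous_zero[OF relations.Phi_zero])
  have "d (Ph \<alpha> 0 n) = d (Sg \<alpha> n 0)"
    unfolding d_Ph d_Sg_0 by (rule pairing_dh_0) simp
  with t show ?case by (simp add: D_diff)
next
  case (no_odd_constants a)
  \<comment> \<open>By the induction hypothesis on \<open>dx M a\<close> both elements have
    x-derivative 0; being of positive degree, they vanish by the same rule applied in the
    quotient.\<close>
  have "pos (twist a)" "pos (D a)"
    using pos_twist pos_D[OF pos_d] no_odd_constants(1,2) by blast+
  moreover have "dd (twist a) = 0" "dd (D a) = 0"
    using no_odd_constants by (simp_all add: twist_dx D_dx)
  ultimately show ?case using calibrated_frobenius.no_odd_constants[OF calibrated_frobenius_axioms] by blast
qed

lemma D_cong: "a \<in> dring M \<Longrightarrow> b \<in> dring M \<Longrightarrow> q a = q b \<Longrightarrow> D a = D b"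
  using twist_D_relations[of "a - b"] by (simp add: q_eq_iff D_diff)

section \<open>Flows as superderivations on representatives\<close>

definition flow :: "'n superpoly \<Rightarrow> 'n superpoly" where
  "flow a = rep (D a)"

lemma flow_dring [simp]: "flow a \<in> dring M"
  by (simp add: flow_def)

lemma q_flow: "a \<in> dring M \<Longrightarrow> q (flow a) = D a"
  by (simp add: flow_def q_rep D_component)

lemma superderivation_flow: "superderivation M e flow"
  unfolding superderivation_def
proof (intro conjI ballI allI impI)
  fix a b assume ab: "a \<in> dring M" "b \<in> dring M" "a \<approx>\<^bsub>M\<^esub> b"
  then have "D a = D b" by (intro D_cong) (simp_all add: sreq_iff)
  then show "flow a \<approx>\<^bsub>M\<^esub> flow b" using ab by (simp add: sreq_iff q_flow)
next
  fix a b assume "a \<in> dring M" "b \<in> dring M"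
  then show "flow (a + b) \<approx>\<^bsub>M\<^esub> flow a + flow b" by (simp add: sreq_iff q_flow D_add q_add dring_intros)
next
  fix i a b assume ab: "a \<in> dring M" "b \<in> dring M" "has_parity i a"
  have "(- 1) ^ (e * i) * a * flow b = parity_sign (e * i) (a * flow b)"
    by (simp add: minus_one_power_mult parity_sign_mult_left)
  moreover have "q (parity_sign (e * i) (a * flow b)) = parity_sign (e * i) (q a * D b)"
    using ab by (simp add: parity_sign_def q_uminus q_mult q_flow)
  moreover have "parity_sign (e * i) (a * flow b) \<in> dring M"
    using ab by (simp add: parity_sign_def dring_intros)
  ultimately show "flow (a * b) \<approx>\<^bsub>M\<^esub> flow a * b + (- 1) ^ (e * i) * a * flow b"
    using ab by (simp add: sreq_iff q_flow D_mult_homogeneous q_add q_mult dring_intros)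
next
  fix i a assume a: "a \<in> dring M" "has_parity i a"
  then obtain b where "b \<in> dring M" "has_parity (e + i) b" "q b = D a" using par_D by (auto simp: par_def)
  then show "\<exists>b\<in>dring M. has_parity (e + i) b \<and> flow a \<approx>\<^bsub>M\<^esub> b"
    using a by (auto simp: sreq_iff q_flow)
next
  fix f assume h: "holo f"
  have "(\<Sum>\<alpha>\<in>UNIV. fn (pd \<alpha> f) * flow (gen (V \<alpha> 0))) \<in> dring M"
    using h by (intro dring_intros) (auto intro: holo_on_pd)
  then show "flow (fn f) \<approx>\<^bsub>M\<^esub> (\<Sum>\<alpha>\<in>UNIV. fn (pd \<alpha> f) * flow (gen (V \<alpha> 0)))"
    using h by (simp add: sreq_iff q_flow q_sum q_mult dring_intros holo_on_pd dfn_def)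
qed simp_all

lemma flow_dx: "a \<in> dring M \<Longrightarrow> flow (dx M a) \<approx>\<^bsub>M\<^esub> dx M (flow a)"
  by (simp add: sreq_iff q_flow dx_dring D_dx q_dx) (simp add: dd_q[symmetric] q_flow)

lemma flow_gen: "b \<in> dring M \<Longrightarrow> q b = d g \<Longrightarrow> flow (gen g) \<approx>\<^bsub>M\<^esub> b"
  by (simp add: sreq_iff q_flow)

end

section \<open>Existence of the flows\<close>

context calibrated_frobenius
begin

text \<open>The coefficient of z1^p z2^r in the pairing of the two gradients.\<close>

definition gram :: "'n \<Rightarrow> nat \<Rightarrow> 'n \<Rightarrow> nat \<Rightarrow> 'n scalar_fn" where
  "gram \<alpha> p \<beta> r = (\<Sum>\<gamma>\<in>UNIV. \<Sum>\<kappa>\<in>UNIV. (\<lambda>_. \<eta>I \<gamma> \<kappa>) * (pd \<gamma> (hfun M \<alpha> p) * pd \<kappa> (hfun M \<beta> r)))"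

lemma holo_gram: "holo (gram \<alpha> p \<beta> r)"
  unfolding gram_def by (intro holo_sum holo_mult holo_on_const holo_on_pd holo_hfun)

text \<open>The coefficients of z1^(p+1) z2^s in the defining identity. The exponent of z1 is
  positive, so the constant eta does not contribute; for s = 0 neither does the product with
  z2.\<close>

lemma Omega_recursion:
  assumes x: "x \<in> X0"
  shows "Omega M \<alpha> p \<beta> 0 x = gram \<alpha> (Suc p) \<beta> 0 x"
    and "Omega M \<alpha> p \<beta> (Suc r) x = gram \<alpha> (Suc p) \<beta> (Suc r) x - Omega M \<alpha> (Suc p) \<beta> r x"
proof -
  let ?A = "Abs_fps (\<lambda>p. Abs_fps (\<lambda>q. Omega M \<alpha> p \<beta> q x))"
  have eq: "(fps_X + fps_const fps_X) * ?A
        = (\<Sum>\<gamma>\<in>UNIV. \<Sum>\<kappa>\<in>UNIV. fps_const (fps_const (\<eta>I \<gamma> \<kappa>))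
             * Abs_fps (\<lambda>p. fps_const (pd \<gamma> (hfun M \<alpha> p) x))
             * fps_const (Abs_fps (\<lambda>q. pd \<kappa> (hfun M \<beta> q) x)))
          - fps_const (fps_const (\<eta> \<alpha> \<beta>))"
    using two_point x unfolding two_point_functions_def by blast
  have "fps_nth (fps_nth ((fps_X + fps_const fps_X) * ?A) (Suc p)) s
    = Omega M \<alpha> p \<beta> s x + (if s = 0 then 0 else Omega M \<alpha> (Suc p) \<beta> (s - 1) x)" for s
    by (simp add: distrib_right)
  then have "Omega M \<alpha> p \<beta> s x + (if s = 0 then 0 else Omega M \<alpha> (Suc p) \<beta> (s - 1) x) = gram \<alpha> (Suc p) \<beta> s x" for s
    unfolding eq by (simp add: fps_sum_nth gram_def sum_fun_eq mult.assoc)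
  from this[of 0] this[of "Suc r"]
  show "Omega M \<alpha> p \<beta> 0 x = gram \<alpha> (Suc p) \<beta> 0 x"
    and "Omega M \<alpha> p \<beta> (Suc r) x = gram \<alpha> (Suc p) \<beta> (Suc r) x - Omega M \<alpha> (Suc p) \<beta> r x"
    by (simp_all add: algebra_simps)
qed

text \<open>\<open>two_point_functions\<close> prescribes only values on the chart; holomorphy comes
  from solving the recursion, lowering r at the price of raising p.\<close>

lemma holo_Omega: "holo (Omega M \<alpha> p \<beta> r)"
proof (induction r arbitrary: p)
  case 0
  have "holo (Omega M \<alpha> p \<beta> 0) = holo (gram \<alpha> (Suc p) \<beta> 0)"
    by (rule holo_cong) (rule Omega_recursion(1))
  then show ?case by (simp add: holo_gram)
next
  case (Suc r)
  have "holo (gram \<alpha> (Suc p) \<beta> (Suc r) + - Omega M \<alpha> (Suc p) \<beta> r)"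
    by (intro holo_add holo_uminus holo_gram Suc)
  moreover have "holo (Omega M \<alpha> p \<beta> (Suc r)) = holo (gram \<alpha> (Suc p) \<beta> (Suc r) + - Omega M \<alpha> (Suc p) \<beta> r)"
    by (rule holo_cong) (simp add: Omega_recursion(2))
  ultimately show ?case by simp
qed

lemma Omega_unit: "x \<in> X0 \<Longrightarrow> Omega M \<alpha> p (unit_idx M) 0 x = hfun M \<alpha> p x"
proof -
  assume x: "x \<in> X0"
  have "Omega M \<alpha> p (unit_idx M) 0 x = (\<Sum>\<gamma>\<in>UNIV. pd \<gamma> (hfun M \<alpha> (Suc p)) x * (\<Sum>\<kappa>\<in>UNIV. \<eta>I \<gamma> \<kappa> * \<eta> \<kappa> (unit_idx M)))"
    by (simp add: Omega_recursion(1)[OF x] gram_def sum_fun_eq pd_hfun_0[OF x] sum_distrib_left mult_ac eta_sym[of "unit_idx M"])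
  also have "\<dots> = pd (unit_idx M) (hfun M \<alpha> (Suc p)) x"
    by (simp add: etaI_eta if_distrib[where f = "\<lambda>c. _ * c"] cong: if_cong)
  finally show ?thesis by (simp add: pd_unit_hfun x)
qed

lemma star_dh_unit: "(\<And>\<alpha>. component M (X \<alpha>) = X \<alpha>) \<Longrightarrow> star (dh (unit_idx M) 0) X = X"
proof
  fix \<gamma> assume X: "\<And>\<alpha>. component M (X \<alpha>) = X \<alpha>"
  have dh: "dh (unit_idx M) 0 \<kappa> = \<phi> (\<lambda>_. \<eta> (unit_idx M) \<kappa>)" for \<kappa>
    unfolding dh_def by (rule \<phi>_cong) (rule pd_hfun_0)
  have "star (dh (unit_idx M) 0) X \<gamma> = (\<Sum>\<beta>\<in>UNIV. \<Sum>\<alpha>\<in>UNIV. \<phi> (\<lambda>_. \<eta> (unit_idx M) \<alpha>) * (\<phi> (cup M \<alpha> \<beta> \<gamma>) * X \<beta>))"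
    unfolding star_def dh by (subst sum.swap) (simp only: \<phi>_left_commute[of "\<phi> (\<lambda>_. \<eta> (unit_idx M) _)"])
  also have "\<dots> = (\<Sum>\<beta>\<in>UNIV. \<phi> (\<lambda>x. \<Sum>\<alpha>\<in>UNIV. \<eta> (unit_idx M) \<alpha> * cup M \<alpha> \<beta> \<gamma> x) * X \<beta>)"
    by (simp only: \<phi>_sum_mult holo_on_const holo_cup)
  also have "\<dots> = (\<Sum>\<beta>\<in>UNIV. \<phi> (\<lambda>_. if \<gamma> = \<beta> then 1 else 0) * X \<beta>)"
  proof (rule sum.cong[OF refl])
    fix \<beta>
    have "\<phi> (\<lambda>x. \<Sum>\<alpha>\<in>UNIV. \<eta> (unit_idx M) \<alpha> * cup M \<alpha> \<beta> \<gamma> x) = \<phi> (\<lambda>_. if \<gamma> = \<beta> then 1 else 0)"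
      by (rule \<phi>_cong) (auto simp: unit_cup)
    then show "\<phi> (\<lambda>x. \<Sum>\<alpha>\<in>UNIV. \<eta> (unit_idx M) \<alpha> * cup M \<alpha> \<beta> \<gamma> x) * X \<beta> = \<phi> (\<lambda>_. if \<gamma> = \<beta> then 1 else 0) * X \<beta>"
      by simp
  qed
  finally show "star (dh (unit_idx M) 0) X \<gamma> = X \<gamma>" by (simp add: \<phi>_const_delta X)
qed

end

context tau_velocity
begin

lemma dfn_gram: "dfn (gram \<alpha> p \<beta> r) = pairing (star (dh_pred \<alpha> p) (dh \<beta> r)) vel + pairing (star (dh \<alpha> p) (dh_pred \<beta> r)) vel"
proof -
  have "dfn (gram \<alpha> p \<beta> r) = pairing (star (dh_pred \<alpha> p) vel) (dh \<beta> r) + pairing (dh \<alpha> p) (star (dh_pred \<beta> r) vel)"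
    unfolding gram_def pairing_def
    by (simp add: dfn_sum dfn_mult holo_sum holo_mult holo_on_const holo_on_pd holo_hfun dfn_dh dh_def
        distrib_left sum.distrib del: times_fun_apply)
  also have "pairing (star (dh_pred \<alpha> p) vel) (dh \<beta> r) = pairing (star (dh_pred \<alpha> p) (dh \<beta> r)) vel"
    unfolding pairing_star star_commute_even[OF parv_dh parv_vel] ..
  also have "pairing (dh \<alpha> p) (star (dh_pred \<beta> r) vel) = pairing (star (dh \<alpha> p) (dh_pred \<beta> r)) vel"
    unfolding pairing_star ..
  finally show ?thesis .
qed

lemma pairing_zero_left [simp]: "pairing 0 X = 0"
  by (simp add: pairing_def)

text \<open>\<open>dfn_gram\<close> yields two products. The second is the derivative of
  Omega_{alpha,p+1;beta,r}, known by induction and subtracted in the recursion; in the base case it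
  is absent because \<open>dh_pred\<close> vanishes.\<close>

lemma dfn_Omega: "dfn (Omega M \<alpha> p \<beta> r) = pairing (star (dh \<alpha> p) (dh \<beta> r)) vel"
proof (induction r arbitrary: p)
  case 0
  have "dfn (Omega M \<alpha> p \<beta> 0) = dfn (gram \<alpha> (Suc p) \<beta> 0)"
    by (rule dfn_cong) (rule Omega_recursion(1))
  then show ?case by (simp add: dfn_gram dh_pred_def star_zero_right)
next
  case (Suc r)
  have "dfn (gram \<alpha> (Suc p) \<beta> (Suc r)) = dfn (Omega M \<alpha> p \<beta> (Suc r) + Omega M \<alpha> (Suc p) \<beta> r)"
    by (rule dfn_cong) (simp add: Omega_recursion(2))
  also have "\<dots> = dfn (Omega M \<alpha> p \<beta> (Suc r)) + dfn (Omega M \<alpha> (Suc p) \<beta> r)"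
    by (rule dfn_add) (rule holo_Omega)+
  finally show ?case by (simp add: Suc dfn_gram dh_pred_def)
qed

end

context calibrated_frobenius
begin

text \<open>Commuting with the x-derivative forces the values on jets. The value <dh, delta_n> on
  Phi is chosen because its x-derivative is the flow of <dh, w_n>, the x-derivative of Phi.\<close>

definition flow_values :: "('n \<Rightarrow> 'n tau_algebra) \<Rightarrow> (nat \<Rightarrow> 'n \<Rightarrow> 'n tau_algebra) \<Rightarrow> ('n \<Rightarrow> nat \<Rightarrow> 'n tau_algebra)
    \<Rightarrow> 'n gen \<Rightarrow> 'n tau_algebra" where
  "flow_values u \<delta> F g = (case g of V \<alpha> s \<Rightarrow> (dd ^^ s) (raise u \<alpha>) | Sg \<alpha> k s \<Rightarrow> (dd ^^ s) (\<delta> k \<alpha>)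
     | Ff \<alpha> p \<Rightarrow> F \<alpha> p | Ph \<alpha> p n \<Rightarrow> pairing (dh \<alpha> p) (\<delta> n))"

lemma parv_raise: "parv i u \<Longrightarrow> par i (raise u \<alpha>)"
  unfolding raise_def by (intro par_sum par_\<phi>_mult) auto

lemma par_dd_pow: "par i x \<Longrightarrow> par i ((dd ^^ s) x)"
  by (induction s) (simp_all add: par_dd)

lemma par_pairing: "parv i X \<Longrightarrow> parv j Y \<Longrightarrow> par (i + j) (pairing X Y)"
  unfolding pairing_def by (intro par_sum par_\<phi>_mult par_mult) auto

lemma tau_flow_values:
  assumes "parv e u" "\<And>k. parv (e + 1) (\<delta> k)" "\<And>\<alpha> p. par e (F \<alpha> p)" "\<And>k \<alpha>. pos (\<delta> k \<alpha>)"
    and "\<And>\<alpha> p. dd (F \<alpha> p) = pairing (dh \<alpha> p) u"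
    and "\<And>k. star vx (\<delta> k) = star u (sig1 k)"
    and "\<And>k. \<delta> (Suc k) = Uop (\<delta> k) + star u (Nm (sig k))"
  shows "tau_flow M e (flow_values u \<delta> F) \<delta>" "tau_velocity.vel M (flow_values u \<delta> F) = u"
proof -
  have "par (e + gdeg g) (flow_values u \<delta> F g)" for g
    using assms(1-3) par_pairing[OF parv_dh assms(2)]
    by (cases g) (auto simp: flow_values_def intro: par_dd_pow parv_raise)
  \<comment> \<open>Interpreted on its own first: the assumptions of \<open>tau_flow\<close> mention
    \<open>vel\<close>, which has to be identified with u before they can be checked.\<close>
  then interpret tau_velocity M e "flow_values u \<delta> F"
    by unfold_locales
  have "vel = lower (raise u)"
    by (simp add: fun_eq_iff vel_def lower_def flow_values_def)
  also have "\<dots> = u"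
    using par_component[of e] assms(1) by (simp add: fun_eq_iff lower_raise)
  finally show u: "vel = u" .
  show "tau_flow M e (flow_values u \<delta> F) \<delta>"
    by unfold_locales (use assms in \<open>simp_all add: u\<close>, simp_all add: flow_values_def)
qed

definition dT :: "'n \<Rightarrow> nat \<Rightarrow> 'n gen \<Rightarrow> 'n tau_algebra" where
  "dT \<beta> r = flow_values (star (dh \<beta> r) vx) (\<lambda>k. star (dh \<beta> r) (sig1 k)) (\<lambda>\<alpha> p. \<phi> (Omega M \<alpha> p \<beta> r))"

lemma pos_star_right: "(\<And>\<alpha>. pos (Y \<alpha>)) \<Longrightarrow> pos (star X Y \<gamma>)"
  unfolding star_def by (intro pos_sum pos_mult_right) auto

lemma pos_sig1: "pos (sig1 k \<alpha>)"
  unfolding sig1_def by (rule pos_gen) simp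

lemma tau_flow_T:
  shows "tau_flow M 0 (dT \<beta> r) (\<lambda>k. star (dh \<beta> r) (sig1 k))"
    and "tau_velocity.vel M (dT \<beta> r) = star (dh \<beta> r) vx"
proof -
  let ?H = "dh \<beta> r"
  have "parv 0 (star ?H vx)" using parv_star[OF parv_dh parv_vx] by simp
  moreover have "parv (0 + 1) (star ?H (sig1 k))" for k
    using parv_star[OF parv_dh parv_sig1] by simp
  moreover have "par 0 (\<phi> (Omega M \<alpha> p \<beta> r))" for \<alpha> p by simp
  moreover have "pos (star ?H (sig1 k) \<alpha>)" for k \<alpha> by (rule pos_star_right) (rule pos_sig1)
  moreover have "dd (\<phi> (Omega M \<alpha> p \<beta> r)) = pairing (dh \<alpha> p) (star ?H vx)" for \<alpha> p
    by (simp add: dd_\<phi> holo_Omega x.dfn_Omega x_vel pairing_star)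
  moreover have "star vx (star ?H (sig1 k)) = star (star ?H vx) (sig1 k)" for k
    by (simp only: star_assoc[symmetric] star_commute_even[OF parv_vx parv_dh])
  moreover have "star ?H (sig1 (Suc k)) = Uop (star ?H (sig1 k)) + star (star ?H vx) (Nm (sig k))" for k
    by (simp only: sig_recursion star_add_right Uop_star_right[OF parv_dh] star_assoc)
  ultimately show "tau_flow M 0 (dT \<beta> r) (\<lambda>k. star ?H (sig1 k))"
    and "tau_velocity.vel M (dT \<beta> r) = star ?H vx"
    unfolding dT_def by (rule tau_flow_values)+
qed

text \<open>The constant function 1/2 provides division by 2; x has to lie in the factor of M for
  \<open>q 1\<close> to fix it.\<close>

lemma double_zero:
  assumes "component M x = x" "x + x = 0"
  shows "x = 0"
proof -
  have "(\<lambda>_. 1/2) + (\<lambda>_. 1/2) = (1 :: 'n scalar_fn)" by (simp add: fun_eq_iff)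
  then have "\<phi> 1 = \<phi> (\<lambda>_. 1/2) + \<phi> (\<lambda>_. 1/2)"
    using \<phi>_add[OF holo_on_const holo_on_const, of "1/2" "1/2"] by simp
  then have "q 1 * x = \<phi> (\<lambda>_. 1/2) * (x + x)" by (simp add: distrib_left distrib_right)
  then show ?thesis using assms by (simp add: q_one_mult)
qed

text \<open>Reversing the sum exchanges the two indices, whose total is constant, and odd covectors
  anticommute; so the sum equals its own negative.\<close>

lemma antisymmetric_sum:
  assumes "\<And>k. parv 1 (f k)"
  shows "(\<Sum>i<N. star (f (a + i)) (f (a + N - Suc i))) = 0"
proof -
  define S where "S = (\<Sum>i<N. star (f (a + i)) (f (a + N - Suc i)))"
  have "S = (\<Sum>i<N. star (f (a + (N - Suc i))) (f (a + N - Suc (N - Suc i))))"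
    unfolding S_def by (rule sum.nat_diff_reindex[symmetric])
  also have "\<dots> = (\<Sum>i<N. - star (f (a + i)) (f (a + N - Suc i)))"
  proof (rule sum.cong[OF refl])
    fix i assume "i \<in> {..<N}"
    then have "a + (N - Suc i) = a + N - Suc i" "a + N - Suc (N - Suc i) = a + i" by auto
    then show "star (f (a + (N - Suc i))) (f (a + N - Suc (N - Suc i))) = - star (f (a + i)) (f (a + N - Suc i))"
      using star_commute_odd[OF assms assms] by metis
  qed
  also have "\<dots> = - S" by (simp add: S_def sum_negf)
  finally have "S = - S" .
  then have "S \<alpha> + S \<alpha> = 0" for \<alpha> by (metis add.inverse_inverse add.right_inverse uminus_apply)
  moreover have "component M (S \<alpha>) = S \<alpha>" for \<alpha>
  proof -
    have "par 2 (star (f i) (f j) \<alpha>)" for i j using parv_star[OF assms assms] by (simp add: numeral_2_eq_2)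
    then have "par 2 (S \<alpha>)" unfolding S_def sum_fun_eq by (intro par_sum) auto
    then show ?thesis by (rule par_component)
  qed
  ultimately have "S \<alpha> = 0" for \<alpha> by (rule double_zero[rotated])
  then show ?thesis by (simp add: S_def[symmetric] fun_eq_iff)
qed

text \<open>\<open>Zle n m\<close> and \<open>Zval m n\<close> are $\partial\sigma_n/\partial\tau_m$, the former for $n \le m$.\<close>

definition Zle :: "nat \<Rightarrow> nat \<Rightarrow> 'n \<Rightarrow> 'n tau_algebra" where
  "Zle n m = (\<Sum>i<m - n. star (Nm (sig (n + i))) (sig1 (m - Suc i)))"

definition Zval :: "nat \<Rightarrow> nat \<Rightarrow> 'n \<Rightarrow> 'n tau_algebra" where
  "Zval m n = (if n \<le> m then Zle n m else - Zle m n)"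

lemma parv_rho: "parv 1 (Nm (sig k))"
  by (rule parv_scal) (rule parv_sig)

lemma star_vx_rho: "star vx (Nm (sig k)) = sig1 (Suc k) - Uop (sig1 k)"
  by (simp add: sig_recursion)

lemma star_diff_left: "star (X - Y) Z = star X Z - star Y Z"
  using star_add_left[of X "- Y" Z] by (simp add: star_uminus_left)

text \<open>Telescoping: $v_x\circ\rho_a=w_{a+1}-\mathcal U w_a$, and sums of $w_a\circ w_b$ over a
  range symmetric in $a$ and $b$ vanish.\<close>

lemma star_vx_Zle: "n \<le> m \<Longrightarrow> star vx (Zle n m) = star (sig1 m) (sig1 n)"
proof -
  assume "n \<le> m"
  then obtain N where m: "m = n + N" by (metis le_add_diff_inverse)
  have "star vx (Zle n m) = (\<Sum>i<N. star (sig1 (Suc (n + i)) - Uop (sig1 (n + i))) (sig1 (n + N - Suc i)))"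
    by (simp add: Zle_def m star_sum_right star_assoc[symmetric] star_vx_rho)
  also have "\<dots> = (\<Sum>i<N. star (sig1 (Suc (n + i))) (sig1 (n + N - Suc i)))
      - Uop (\<Sum>i<N. star (sig1 (n + i)) (sig1 (n + N - Suc i)))"
    by (simp only: star_diff_left Uop_sum Uop_star_left sum_subtractf)
  also have "(\<Sum>i<N. star (sig1 (n + i)) (sig1 (n + N - Suc i))) = 0"
    by (rule antisymmetric_sum) (rule parv_sig1)
  also have "(\<Sum>i<N. star (sig1 (Suc (n + i))) (sig1 (n + N - Suc i))) = star (sig1 m) (sig1 n)"
  proof (cases N)
    case 0
    \<comment> \<open>Here m = n and the sum is empty; the one-term case of
      \<open>antisymmetric_sum\<close> says that w_n o w_n = 0.\<close>
    have "(\<Sum>i<1. star (sig1 (n + i)) (sig1 (n + 1 - Suc i))) = 0"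
      by (rule antisymmetric_sum) (rule parv_sig1)
    then show ?thesis by (simp add: m 0)
  next
    case (Suc K)
    \<comment> \<open>The last summand, i = K, is w_m o w_n. The others have both indices running
      over n+1, ..., n+K in opposite directions and cancel.\<close>
    have "(\<Sum>i<K. star (sig1 (Suc n + i)) (sig1 (Suc n + K - Suc i))) = 0"
      by (rule antisymmetric_sum) (rule parv_sig1)
    then show ?thesis by (simp add: m Suc)
  qed
  finally show ?thesis by (simp add: Uop_zero del: zero_fun_apply)
qed

lemma star_vx_Zval: "star vx (Zval m n) = star (sig1 m) (sig1 n)"
proof (cases "n \<le> m")
  case False
  then show ?thesis
    using star_vx_Zle[of m n] star_commute_odd[OF parv_sig1 parv_sig1, of m n]
    by (simp add: Zval_def star_uminus_right)
qed (simp add: Zval_def star_vx_Zle)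

lemma star_rho_sig1_Suc:
  "star (Nm (sig i)) (sig1 (Suc k)) = Uop (star (Nm (sig i)) (sig1 k)) + star vx (star (Nm (sig i)) (Nm (sig k)))"
proof -
  have "star (Nm (sig i)) (star vx (Nm (sig k))) = star vx (star (Nm (sig i)) (Nm (sig k)))"
    by (simp only: star_assoc[symmetric] star_commute_even[OF parv_vx parv_rho, of i])
  then show ?thesis by (simp only: sig_recursion star_add_right Uop_star_right[OF parv_rho])
qed

lemma Zle_diag [simp]: "Zle n n = 0"
  by (simp add: Zle_def)

text \<open>The recursion for w is applied to the right factor of each summand. The terms with U
  reassemble, the products rho o rho cancel over a symmetric range, and a boundary term with rho_n
  and w_m remains.\<close>

lemma Zval_Suc: "Zval m (Suc n) = Uop (Zval m n) + star (sig1 m) (Nm (sig n))"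
proof -
  let ?r = "\<lambda>k. Nm (sig k)"
  have c: "star (sig1 m) (?r n) = - star (?r n) (sig1 m)"
    by (rule star_commute_odd[OF parv_sig1 parv_rho])
  show ?thesis
  proof (cases "Suc n \<le> m")
    case True
    then obtain K where m: "m = Suc (n + K)" by (metis add_Suc le_add_diff_inverse)
    \<comment> \<open>The sum for n+1 lacks the summand with left index n; restoring it makes the
      range symmetric.\<close>
    have shift: "(\<Sum>i<Suc K. star (?r (n + i)) (f (n + Suc K - Suc i)))
        = star (?r n) (f (n + K)) + (\<Sum>i<K. star (?r (Suc n + i)) (f (n + K - Suc i)))" for f
      by (subst sum.lessThan_Suc_shift) simp
    have "(\<Sum>i<Suc K. star (?r (n + i)) (?r (n + Suc K - Suc i))) = 0"
      by (rule antisymmetric_sum) (rule parv_rho)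
    then have anti: "star (?r n) (?r (n + K)) + (\<Sum>i<K. star (?r (Suc n + i)) (?r (n + K - Suc i))) = 0"
      by (rule trans[OF sym[OF shift[of ?r]]])
    have "Zle (Suc n) m = (\<Sum>i<K. star (?r (Suc n + i)) (sig1 (Suc (n + K - Suc i))))"
      unfolding Zle_def m by (rule sum.cong) (auto intro!: arg_cong2[where f = star] arg_cong[where f = sig1])
    also have "\<dots> = Uop (\<Sum>i<K. star (?r (Suc n + i)) (sig1 (n + K - Suc i)))
        + star vx (\<Sum>i<K. star (?r (Suc n + i)) (?r (n + K - Suc i)))"
      by (simp only: star_rho_sig1_Suc sum.distrib Uop_sum star_sum_right)
    also have "(\<Sum>i<K. star (?r (Suc n + i)) (?r (n + K - Suc i))) = - star (?r n) (?r (n + K))"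
      using anti by (simp only: eq_neg_iff_add_eq_0 add.commute)
    also have "(\<Sum>i<K. star (?r (Suc n + i)) (sig1 (n + K - Suc i))) = Zle n m - star (?r n) (sig1 (n + K))"
      using shift[of sig1] by (simp add: Zle_def m del: sum.lessThan_Suc)
    also have "Uop (Zle n m - star (?r n) (sig1 (n + K))) + star vx (- star (?r n) (?r (n + K)))
        = Uop (Zle n m) - star (?r n) (sig1 m)"
      unfolding m star_rho_sig1_Suc Uop_diff star_uminus_right by simp
    finally show ?thesis using True c by (simp add: Zval_def)
  next
    case False
    then obtain N where n: "n = m + N" by (metis le_add_diff_inverse not_less_eq_eq)
    \<comment> \<open>For n at least m the range grows instead, and the new last summand is rho_n o
      w_m.\<close>
    have "Zle m (Suc n) = (\<Sum>i<N. star (?r (m + i)) (sig1 (n - i))) + star (?r n) (sig1 m)"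
      by (simp add: Zle_def n Suc_diff_le)
    also have "(\<Sum>i<N. star (?r (m + i)) (sig1 (n - i))) = (\<Sum>i<N. star (?r (m + i)) (sig1 (Suc (m + N - Suc i))))"
      by (rule sum.cong) (auto simp: n intro!: arg_cong2[where f = star] arg_cong[where f = sig1])
    also have "\<dots> = Uop (\<Sum>i<N. star (?r (m + i)) (sig1 (m + N - Suc i)))
        + star vx (\<Sum>i<N. star (?r (m + i)) (?r (m + N - Suc i)))"
      by (simp only: star_rho_sig1_Suc sum.distrib Uop_sum star_sum_right)
    also have "(\<Sum>i<N. star (?r (m + i)) (?r (m + N - Suc i))) = 0"
      by (rule antisymmetric_sum) (rule parv_rho)
    also have "(\<Sum>i<N. star (?r (m + i)) (sig1 (m + N - Suc i))) = Zle m n"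
      by (simp add: Zle_def n)
    finally have Z: "Zle m (Suc n) = Uop (Zle m n) + star (?r n) (sig1 m)"
      by (simp add: star_zero_right del: zero_fun_apply plus_fun_apply)
    have "Zval m n = - Zle m n" using n by (cases "N = 0") (simp_all add: Zval_def)
    then show ?thesis using False c Z by (simp add: Zval_def Uop_uminus)
  qed
qed

definition dS :: "nat \<Rightarrow> 'n gen \<Rightarrow> 'n tau_algebra" where
  "dS m = flow_values (sig1 m) (Zval m) (\<lambda>\<alpha> p. \<g> (Ph \<alpha> p m))"

lemma q_dx_Ph: "q (dx_gen M (Ph \<alpha> p n)) = pairing (dh \<alpha> p) (sig1 n)"
proof -
  have h: "holo (\<lambda>x. \<eta>I \<beta> \<gamma> * pd \<beta> (hfun M \<alpha> p) x)" for \<beta> \<gamma>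
    by (intro holo_lambda_mult holo_on_const holo_on_pd holo_hfun)
  then show ?thesis
    by (simp add: pairing_def dh_def sig1_def q_sum q_mult dring_intros mult.commute[of "pd _ _ _"]
        \<phi>_scale holo_on_pd holo_hfun mult.assoc)
qed

lemma parv_Zval: "parv 2 (Zval m n)"
proof -
  have "parv 2 (star (Nm (sig i)) (sig1 j))" for i j
    using parv_star[OF parv_rho parv_sig1] by (simp add: numeral_2_eq_2)
  then show ?thesis
    unfolding Zval_def Zle_def by (auto simp: sum_fun_eq intro!: par_sum par_uminus)
qed

lemma pos_Zval: "pos (Zval m n \<alpha>)"
  unfolding Zval_def Zle_def by (auto simp: sum_fun_eq intro!: pos_sum pos_uminus pos_star_right pos_sig1)

lemma tau_flow_S:
  shows "tau_flow M 1 (dS m) (Zval m)" and "tau_velocity.vel M (dS m) = sig1 m"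
proof -
  have par2: "parv (1 + 1) (Zval m k)" for k using parv_Zval by (simp add: numeral_2_eq_2)
  have par1: "par 1 (\<g> (Ph \<alpha> p m))" for \<alpha> p using par_gen[of "Ph \<alpha> p m"] by simp
  have dd: "dd (\<g> (Ph \<alpha> p m)) = pairing (dh \<alpha> p) (sig1 m)" for \<alpha> p
    unfolding dd_gen by (rule q_dx_Ph)
  show "tau_flow M 1 (dS m) (Zval m)" and "tau_velocity.vel M (dS m) = sig1 m"
    unfolding dS_def
    by (rule tau_flow_values parv_sig1 par1 par2 pos_Zval dd star_vx_Zval Zval_Suc)+
qed

section \<open>The prescribed right-hand sides as covector expressions\<close>

lemma q_T_V: "q (\<Sum>\<gamma>\<in>UNIV. \<Sum>\<kappa>\<in>UNIV. fn (\<lambda>x. \<eta>I \<alpha> \<gamma> * pd \<kappa> (pd \<gamma> (hfun M \<beta> (Suc p))) x) * gen (V \<kappa> 1))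
    = raise (star (dh \<beta> p) vx) \<alpha>"
  and T_V_dring: "(\<Sum>\<gamma>\<in>UNIV. \<Sum>\<kappa>\<in>UNIV. fn (\<lambda>x. \<eta>I \<alpha> \<gamma> * pd \<kappa> (pd \<gamma> (hfun M \<beta> (Suc p))) x) * gen (V \<kappa> 1)) \<in> dring M"
proof -
  have h: "holo (\<lambda>x. \<eta>I \<alpha> \<gamma> * pd \<kappa> (pd \<gamma> (hfun M \<beta> (Suc p))) x)" for \<gamma> \<kappa>
    by (intro holo_lambda_mult holo_on_const holo_on_pd holo_hfun)
  have "star (dh \<beta> p) vx \<gamma> = (\<Sum>\<kappa>\<in>UNIV. \<phi> (pd \<kappa> (pd \<gamma> (hfun M \<beta> (Suc p)))) * \<g> (V \<kappa> 1))" for \<gamma>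
    using x.dfn_dh[of \<gamma> \<beta> "Suc p"] by (simp add: x.dfn_def dh_pred_def x_vel)
  then show "q (\<Sum>\<gamma>\<in>UNIV. \<Sum>\<kappa>\<in>UNIV. fn (\<lambda>x. \<eta>I \<alpha> \<gamma> * pd \<kappa> (pd \<gamma> (hfun M \<beta> (Suc p))) x) * gen (V \<kappa> 1))
    = raise (star (dh \<beta> p) vx) \<alpha>"
    using h by (simp add: raise_def q_sum q_mult dring_intros \<phi>_scale holo_on_pd holo_hfun sum_distrib_left mult.assoc)
  show "(\<Sum>\<gamma>\<in>UNIV. \<Sum>\<kappa>\<in>UNIV. fn (\<lambda>x. \<eta>I \<alpha> \<gamma> * pd \<kappa> (pd \<gamma> (hfun M \<beta> (Suc p))) x) * gen (V \<kappa> 1)) \<in> dring M"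
    using h by (intro dring_intros) simp
qed

lemma q_T_Sg: "q (\<Sum>\<gamma>\<in>UNIV. \<Sum>\<epsilon>\<in>UNIV. fn (\<lambda>x. \<eta>I \<gamma> \<epsilon> * pd \<alpha> (pd \<epsilon> (hfun M \<beta> (Suc p))) x) * gen (Sg \<gamma> k 1))
    = star (dh \<beta> p) (sig1 k) \<alpha>"
  and T_Sg_dring: "(\<Sum>\<gamma>\<in>UNIV. \<Sum>\<epsilon>\<in>UNIV. fn (\<lambda>x. \<eta>I \<gamma> \<epsilon> * pd \<alpha> (pd \<epsilon> (hfun M \<beta> (Suc p))) x) * gen (Sg \<gamma> k 1)) \<in> dring M"
proof -
  have h: "holo (\<lambda>x. \<eta>I \<gamma> \<epsilon> * pd \<alpha> (pd \<epsilon> (hfun M \<beta> (Suc p))) x)" for \<gamma> \<epsilon>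
    by (intro holo_lambda_mult holo_on_const holo_on_pd holo_hfun)
  have c: "(\<Sum>\<epsilon>\<in>UNIV. \<eta>I \<gamma> \<epsilon> * pd \<alpha> (pd \<epsilon> (hfun M \<beta> (Suc p))) x) = (\<Sum>\<kappa>\<in>UNIV. pd \<kappa> (hfun M \<beta> p) x * cup M \<kappa> \<gamma> \<alpha> x)"
    if "x \<in> X0" for x \<gamma>
    using that unfolding pd_pd_hfun_Suc[OF that]
    by (simp add: cup_cmul sum_distrib_left mult_ac cmul_sym[of x _ \<alpha>]) (rule sum.swap)
  have "q (\<Sum>\<gamma>\<in>UNIV. \<Sum>\<epsilon>\<in>UNIV. fn (\<lambda>x. \<eta>I \<gamma> \<epsilon> * pd \<alpha> (pd \<epsilon> (hfun M \<beta> (Suc p))) x) * gen (Sg \<gamma> k 1))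
    = (\<Sum>\<gamma>\<in>UNIV. \<Sum>\<epsilon>\<in>UNIV. \<phi> (\<lambda>_. \<eta>I \<gamma> \<epsilon>) * (\<phi> (pd \<alpha> (pd \<epsilon> (hfun M \<beta> (Suc p)))) * sig1 k \<gamma>))"
    using h by (simp add: sig1_def q_sum q_mult dring_intros \<phi>_scale holo_on_pd holo_hfun mult.assoc)
  also have "\<dots> = (\<Sum>\<gamma>\<in>UNIV. \<phi> (\<lambda>x. \<Sum>\<epsilon>\<in>UNIV. \<eta>I \<gamma> \<epsilon> * pd \<alpha> (pd \<epsilon> (hfun M \<beta> (Suc p))) x) * sig1 k \<gamma>)"
    by (simp only: \<phi>_sum_mult holo_on_const holo_on_pd holo_hfun)
  also have "\<dots> = (\<Sum>\<gamma>\<in>UNIV. \<phi> (\<lambda>x. \<Sum>\<kappa>\<in>UNIV. pd \<kappa> (hfun M \<beta> p) x * cup M \<kappa> \<gamma> \<alpha> x) * sig1 k \<gamma>)"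
    by (simp only: \<phi>_cong[OF c])
  also have "\<dots> = (\<Sum>\<gamma>\<in>UNIV. \<Sum>\<kappa>\<in>UNIV. \<phi> (pd \<kappa> (hfun M \<beta> p)) * (\<phi> (cup M \<kappa> \<gamma> \<alpha>) * sig1 k \<gamma>))"
    by (subst \<phi>_sum_mult) (auto intro: holo_hfun holo_cup)
  also have "\<dots> = star (dh \<beta> p) (sig1 k) \<alpha>"
    unfolding star_def by (subst sum.swap) (simp only: dh_def \<phi>_left_commute[of "\<phi> (pd _ _)"])
  finally show "q (\<Sum>\<gamma>\<in>UNIV. \<Sum>\<epsilon>\<in>UNIV. fn (\<lambda>x. \<eta>I \<gamma> \<epsilon> * pd \<alpha> (pd \<epsilon> (hfun M \<beta> (Suc p))) x) * gen (Sg \<gamma> k 1))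
    = star (dh \<beta> p) (sig1 k) \<alpha>" .
  show "(\<Sum>\<gamma>\<in>UNIV. \<Sum>\<epsilon>\<in>UNIV. fn (\<lambda>x. \<eta>I \<gamma> \<epsilon> * pd \<alpha> (pd \<epsilon> (hfun M \<beta> (Suc p))) x) * gen (Sg \<gamma> k 1)) \<in> dring M"
    using h by (intro dring_intros) simp
qed

lemma q_S_V: "q (\<Sum>\<beta>\<in>UNIV. fn (\<lambda>_. \<eta>I \<alpha> \<beta>) * gen (Sg \<beta> m 1)) = raise (sig1 m) \<alpha>"
  and S_V_dring: "(\<Sum>\<beta>\<in>UNIV. fn (\<lambda>_. \<eta>I \<alpha> \<beta>) * gen (Sg \<beta> m 1)) \<in> dring M"
  by (simp_all add: raise_def sig1_def q_sum q_mult dring_intros holo_on_const)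

lemma q_sigma_tau: "q (sigma_tau M \<alpha> k m) = Zle k m \<alpha>"
  and sigma_tau_dring: "sigma_tau M \<alpha> k m \<in> dring M"
proof -
  have cs: "\<phi> (cup M \<gamma> \<beta> \<alpha>) = \<phi> (cup M \<beta> \<gamma> \<alpha>)" for \<beta> \<gamma>
    by (rule \<phi>_cong) (rule cup_sym)
  have Gam: "\<phi> (Gam M \<gamma> \<beta> \<alpha>) = \<phi> (cup M \<beta> \<gamma> \<alpha>) * \<phi> (\<lambda>_. 1/2 - \<mu> \<beta>)" for \<beta> \<gamma>
  proof -
    have "Gam M \<gamma> \<beta> \<alpha> = (\<lambda>x. (1/2 - \<mu> \<beta>) * cup M \<gamma> \<beta> \<alpha> x)" by (simp add: fun_eq_iff Gam_def)
    then show ?thesis using \<phi>_scale[OF holo_cup] cs \<phi>_central by metis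
  qed
  have "q (sigma_tau M \<alpha> k m) = (\<Sum>\<gamma>\<in>UNIV. \<Sum>\<beta>\<in>UNIV. \<Sum>i<m - k. \<phi> (Gam M \<gamma> \<beta> \<alpha>) * (sig (k + i) \<beta> * sig1 (m - Suc i) \<gamma>))"
    unfolding sigma_tau_def
    by (simp add: q_sum q_mult dring_intros holo_Gam sig_def sig1_def sum_distrib_left)
  also have "\<dots> = (\<Sum>i<m - k. \<Sum>\<gamma>\<in>UNIV. \<Sum>\<beta>\<in>UNIV. \<phi> (Gam M \<gamma> \<beta> \<alpha>) * (sig (k + i) \<beta> * sig1 (m - Suc i) \<gamma>))"
    by (rule sum_rotate[symmetric])
  also have "\<dots> = (\<Sum>i<m - k. star (Nm (sig (k + i))) (sig1 (m - Suc i)) \<alpha>)"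
    by (rule sum.cong[OF refl], subst sum.swap) (simp only: star_def Gam scal_def mult.assoc)
  finally show "q (sigma_tau M \<alpha> k m) = Zle k m \<alpha>" by (simp add: Zle_def sum_fun_eq)
  show "sigma_tau M \<alpha> k m \<in> dring M"
    unfolding sigma_tau_def by (intro dring_intros) (simp add: holo_Gam)
qed

lemma q_Delta_ge: "q (Delta_ge M \<alpha> p k n) = pairing (dh \<alpha> p) (Zle n k)"
  and Delta_ge_dring: "Delta_ge M \<alpha> p k n \<in> dring M"
proof -
  have h: "holo (\<lambda>x. \<eta>I \<gamma> \<kappa> * pd \<kappa> (hfun M \<alpha> p) x * Gam M \<delta> \<xi> \<gamma> x)" for \<gamma> \<kappa> \<delta> \<xi>
    by (intro holo_lambda_mult holo_on_const holo_on_pd holo_hfun holo_Gam)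
  have split: "fn (\<lambda>x. \<eta>I \<gamma> \<kappa> * pd \<kappa> (hfun M \<alpha> p) x * Gam M \<delta> \<xi> \<gamma> x)
      = fn (\<lambda>_. \<eta>I \<gamma> \<kappa>) * fn (pd \<kappa> (hfun M \<alpha> p)) * fn (Gam M \<delta> \<xi> \<gamma>)" for \<gamma> \<kappa> \<delta> \<xi>
    by (simp add: fn_mult[symmetric] times_fun_def)
  \<comment> \<open>Delta is the gradient of h paired with the prescribed derivative of sigma, which
    reduces it to \<open>q_sigma_tau\<close>.\<close>
  have D: "Delta_ge M \<alpha> p k n = (\<Sum>\<gamma>\<in>UNIV. \<Sum>\<kappa>\<in>UNIV. fn (\<lambda>_. \<eta>I \<gamma> \<kappa>) * fn (pd \<kappa> (hfun M \<alpha> p)) * sigma_tau M \<gamma> n k)"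
    unfolding Delta_ge_def sigma_tau_def split by (simp only: sum_distrib_left mult.assoc)
  show "Delta_ge M \<alpha> p k n \<in> dring M"
    unfolding D by (intro dring_intros) (auto intro: holo_hfun sigma_tau_dring)
  have "q (Delta_ge M \<alpha> p k n) = (\<Sum>\<gamma>\<in>UNIV. \<Sum>\<kappa>\<in>UNIV. \<phi> (\<lambda>_. \<eta>I \<kappa> \<gamma>) * (dh \<alpha> p \<kappa> * Zle n k \<gamma>))"
    unfolding D
    by (simp add: q_sum q_mult dring_intros sigma_tau_dring holo_on_const holo_on_pd holo_hfun q_sigma_tau
        dh_def mult.assoc) (simp only: etaI_sym)
  also have "\<dots> = pairing (dh \<alpha> p) (Zle n k)"
    unfolding pairing_def by (rule sum.swap)
  finally show "q (Delta_ge M \<alpha> p k n) = pairing (dh \<alpha> p) (Zle n k)" .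
qed

lemma q_Delta: "q (Delta M \<alpha> p k n) = pairing (dh \<alpha> p) (Zval k n)"
  and Delta_dring: "Delta M \<alpha> p k n \<in> dring M"
  unfolding Delta_def Zval_def
  by (auto simp: q_uminus q_Delta_ge Delta_ge_dring dring_intros pairing_def sum_negf)

text \<open>The covector dh_{1,0} is the unit of the product, and Omega_{alpha,p;1,0} = h_{alpha,p};
  so the values of this flow are those of the x-derivative.\<close>

lemma dT_unit: "dT (unit_idx M) 0 g = q (dx_gen M g)"
proof -
  have vx: "star (dh (unit_idx M) 0) vx = vx" and s: "star (dh (unit_idx M) 0) (sig1 k) = sig1 k" for k
  proof -
    show "star (dh (unit_idx M) 0) vx = vx"
      by (rule star_dh_unit) (rule par_component[OF spec[OF parv_vx]])
    show "star (dh (unit_idx M) 0) (sig1 k) = sig1 k"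
      by (rule star_dh_unit) (rule par_component[OF spec[OF parv_sig1]])
  qed
  have V: "(dd ^^ s) (\<g> (V \<alpha> 1)) = \<g> (V \<alpha> (Suc s))" for \<alpha> s
    by (induction s) simp_all
  have S: "(dd ^^ s) (\<g> (Sg \<alpha> k 1)) = \<g> (Sg \<alpha> k (Suc s))" for \<alpha> k s
    by (induction s) simp_all
  have rv: "raise vx \<alpha> = \<g> (V \<alpha> 1)" for \<alpha>
    by (simp add: vx_lower raise_lower)
  show ?thesis
  proof (cases g)
    case (Ff \<alpha> p)
    then show ?thesis using \<phi>_cong[OF Omega_unit] by (simp add: dT_def flow_values_def)
  next
    case (Ph \<alpha> p n)
    then show ?thesis using q_dx_Ph[of \<alpha> p n] by (simp add: dT_def flow_values_def s del: dx_gen.simps)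
  qed (use V S in \<open>simp_all add: dT_def flow_values_def vx s rv sig1_def\<close>)
qed

theorem super_flows_exist: "\<exists>T S. super_flows M T S"
proof -
  interpret T: tau_flow M 0 "dT \<beta> r" "\<lambda>k. star (dh \<beta> r) (sig1 k)" for \<beta> r by (rule tau_flow_T)
  interpret S: tau_flow M 1 "dS m" "Zval m" for m by (rule tau_flow_S)
  have "super_flows M (\<lambda>\<beta> r. T.flow \<beta> r) (\<lambda>m. S.flow m)"
    unfolding super_flows_def
  proof (intro conjI allI ballI impI)
    fix a assume a: "a \<in> dring M"
    have "dT (unit_idx M) 0 = (\<lambda>g. q (dx_gen M g))" by (rule ext) (rule dT_unit)
    then have "T.D (unit_idx M) 0 a = x.D a" by simp
    then show "T.flow (unit_idx M) 0 a \<approx>\<^bsub>M\<^esub> dx M a"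
      using a by (simp add: sreq_iff T.q_flow q_dx dx_dring)
  next
    fix \<alpha> \<beta> p
    show "T.flow \<beta> p (gen (V \<alpha> 0)) \<approx>\<^bsub>M\<^esub> (\<Sum>\<gamma>\<in>UNIV. \<Sum>\<kappa>\<in>UNIV. fn (\<lambda>x. \<eta>I \<alpha> \<gamma> * pd \<kappa> (pd \<gamma> (hfun M \<beta> (Suc p))) x) * gen (V \<kappa> 1))"
      by (rule T.flow_gen[OF T_V_dring]) (simp only: q_T_V, simp add: dT_def flow_values_def)
  next
    fix \<alpha> k \<beta> p
    show "T.flow \<beta> p (gen (Sg \<alpha> k 0)) \<approx>\<^bsub>M\<^esub> (\<Sum>\<gamma>\<in>UNIV. \<Sum>\<epsilon>\<in>UNIV. fn (\<lambda>x. \<eta>I \<gamma> \<epsilon> * pd \<alpha> (pd \<epsilon> (hfun M \<beta> (Suc p))) x) * gen (Sg \<gamma> k 1))"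
      by (rule T.flow_gen[OF T_Sg_dring]) (simp only: q_T_Sg, simp add: dT_def flow_values_def)
  next
    fix \<alpha> m
    show "S.flow m (gen (V \<alpha> 0)) \<approx>\<^bsub>M\<^esub> (\<Sum>\<beta>\<in>UNIV. fn (\<lambda>_. \<eta>I \<alpha> \<beta>) * gen (Sg \<beta> m 1))"
      by (rule S.flow_gen[OF S_V_dring]) (simp only: q_S_V, simp add: dS_def flow_values_def)
  next
    fix \<alpha> and k m :: nat assume km: "k \<le> m"
    show "S.flow m (gen (Sg \<alpha> k 0)) \<approx>\<^bsub>M\<^esub> sigma_tau M \<alpha> k m"
      by (rule S.flow_gen[OF sigma_tau_dring]) (simp add: q_sigma_tau dS_def flow_values_def Zval_def km)
    \<comment> \<open>For k < m the sign is built into \<open>Zval\<close>; for k = m the sum is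
      empty.\<close>
    have "- Zval k m \<alpha> = Zle k m \<alpha>" using km by (cases "k = m") (simp_all add: Zval_def)
    then have "q (- S.flow k (gen (Sg \<alpha> m 0))) = q (sigma_tau M \<alpha> k m)"
      by (simp only: q_uminus S.q_flow mon_dring S.D_gen S.d_Sg_0 q_sigma_tau)
    then show "- S.flow k (gen (Sg \<alpha> m 0)) \<approx>\<^bsub>M\<^esub> sigma_tau M \<alpha> k m"
      by (simp only: sreq_iff dring_intros sigma_tau_dring S.flow_dring)
  next
    fix \<alpha> p \<beta> r
    show "T.flow \<beta> r (gen (Ff \<alpha> p)) \<approx>\<^bsub>M\<^esub> fn (Omega M \<alpha> p \<beta> r)"
      by (rule T.flow_gen) (simp_all add: holo_Omega dT_def flow_values_def)
  next
    fix \<alpha> p n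
    show "S.flow n (gen (Ff \<alpha> p)) \<approx>\<^bsub>M\<^esub> gen (Ph \<alpha> p n)"
      by (rule S.flow_gen) (simp_all add: dS_def flow_values_def)
  next
    fix \<alpha> p n \<beta> r
    \<comment> \<open>The two sides are <dh_alpha o dh_beta, w_n> and <dh_alpha, dh_beta o w_n>,
      equal by invariance of the pairing.\<close>
    have "q (S.flow n (fn (Omega M \<alpha> p \<beta> r))) = dT \<beta> r (Ph \<alpha> p n)"
      by (simp only: S.q_flow fn_dring holo_Omega S.D_fn S.dfn_Omega tau_flow_S(2) T.d_Ph pairing_star)
    then show "T.flow \<beta> r (gen (Ph \<alpha> p n)) \<approx>\<^bsub>M\<^esub> S.flow n (fn (Omega M \<alpha> p \<beta> r))"
      by (rule T.flow_gen[OF S.flow_dring])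
  next
    fix \<alpha> p n k
    show "S.flow k (gen (Ph \<alpha> p n)) \<approx>\<^bsub>M\<^esub> Delta M \<alpha> p k n"
      by (rule S.flow_gen[OF Delta_dring]) (simp add: q_Delta S.d_Ph)
  qed (rule T.superderivation_flow S.superderivation_flow T.flow_dx S.flow_dx; assumption?)+
  then show ?thesis by blast
qed

end

section \<open>Commutativity of the flows\<close>

text \<open>Positivity on odd generators is a separate assumption: an odd X sends them to even
  elements, and even parity says nothing about positive degree.\<close>

locale superderivation_on_chart = calibrated_frobenius M
  for M :: "'n::finite frobenius_data" +
  fixes e :: nat and X :: "'n superpoly \<Rightarrow> 'n superpoly"
  assumes superderivation: "superderivation M e X"
    and commute_dx: "\<And>a. a \<in> dring M \<Longrightarrow> X (dx M a) \<approx>\<^bsub>M\<^esub> dx M (X a)"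
    and pos_X: "\<And>g. is_odd g \<Longrightarrow> pos (cls M (X (gen g)))"
begin

lemma X_dring: "a \<in> dring M \<Longrightarrow> X a \<in> dring M"
  using superderivation by (simp add: superderivation_def)

lemma X_cong: "a \<in> dring M \<Longrightarrow> b \<in> dring M \<Longrightarrow> q a = q b \<Longrightarrow> q (X a) = q (X b)"
proof -
  assume ab: "a \<in> dring M" "b \<in> dring M" "q a = q b"
  then have "a \<approx>\<^bsub>M\<^esub> b" by (simp add: sreq_iff)
  then have "X a \<approx>\<^bsub>M\<^esub> X b" using superderivation ab unfolding superderivation_def by blast
  then show ?thesis using ab by (simp add: sreq_iff X_dring)
qed

definition hat :: "'n tau_algebra \<Rightarrow> 'n tau_algebra" where
  "hat x = q (X (rep x))"

lemma hat_q: "a \<in> dring M \<Longrightarrow> hat (q a) = q (X a)"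
  unfolding hat_def by (rule X_cong) (simp_all add: q_rep)

lemma hat_component [simp]: "component M (hat x) = hat x"
  by (simp add: hat_def)

lemma hat_add: "hat (x + y) = hat x + hat y"
proof -
  have "hat (x + y) = q (X (rep x + rep y))"
    unfolding hat_def by (rule X_cong) (simp_all add: q_rep q_add dring_intros component_add)
  also have "\<dots> = q (X (rep x) + X (rep y))"
  proof -
    have "X (rep x + rep y) \<approx>\<^bsub>M\<^esub> X (rep x) + X (rep y)"
      using superderivation rep_dring unfolding superderivation_def by blast
    then show ?thesis by (simp add: sreq_iff X_dring dring_intros)
  qed
  finally show ?thesis by (simp add: hat_def q_add X_dring)
qed

lemma hat_zero [simp]: "hat 0 = 0"
  using hat_add[of 0 0] by simp

lemma hat_uminus: "hat (- x) = - hat x"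
  using hat_add[of "- x" x] by (simp add: eq_neg_iff_add_eq_0)

lemma hat_sum: "hat (sum f I) = (\<Sum>i\<in>I. hat (f i))"
  by (induction I rule: infinite_finite_induct) (simp_all add: hat_add)

lemma hat_of_component: "hat (component M x) = hat x"
proof -
  have "hat (q (rep x)) = q (X (rep x))" by (rule hat_q) simp
  then show ?thesis by (simp add: q_rep hat_def)
qed

lemma hat_mult: "par i x \<Longrightarrow> hat (x * y) = hat x * y + parity_sign (e * i) (x * hat y)"
proof -
  assume "par i x"
  then obtain a where a: "a \<in> dring M" "has_parity i a" "q a = x" by (auto simp: par_def)
  have d: "X a * rep y + parity_sign (e * i) (a * X (rep y)) \<in> dring M"
    using a by (simp add: parity_sign_def X_dring dring_intros)
  have "X (a * rep y) \<approx>\<^bsub>M\<^esub> X a * rep y + (- 1) ^ (e * i) * a * X (rep y)"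
    using superderivation a rep_dring[of y] unfolding superderivation_def by blast
  then have "X (a * rep y) \<approx>\<^bsub>M\<^esub> X a * rep y + parity_sign (e * i) (a * X (rep y))"
    by (simp add: minus_one_power_mult parity_sign_mult_left)
  then have "q (X (a * rep y)) = q (X a) * component M y + parity_sign (e * i) (x * hat y)"
    using a d by (simp add: sreq_iff X_dring dring_intros q_add q_mult q_rep parity_sign_def q_uminus hat_def)
  moreover have "hat (x * y) = hat (q (a * rep y))"
  proof -
    have "q (a * rep y) = component M x * component M y" using a by (auto simp: q_mult q_rep)
    then have "q (a * rep y) = component M (x * y)" by (simp only: component_mult)
    then show ?thesis by (simp only: hat_of_component)
  qed
  moreover have "q (X a) * component M y = hat x * y"
    using a component_mult_left[of M "q (X a)" y] by (simp add: hat_q[symmetric])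
  ultimately show ?thesis using a by (simp add: hat_q dring_intros)
qed

lemma hat_\<phi>: "holo f \<Longrightarrow> hat (\<phi> f) = (\<Sum>\<alpha>\<in>UNIV. \<phi> (pd \<alpha> f) * hat (\<g> (V \<alpha> 0)))"
proof -
  assume f: "holo f"
  have d: "(\<Sum>\<alpha>\<in>UNIV. fn (pd \<alpha> f) * X (gen (V \<alpha> 0))) \<in> dring M"
    using f by (intro dring_intros X_dring) (auto intro: holo_on_pd)
  have "X (fn f) \<approx>\<^bsub>M\<^esub> (\<Sum>\<alpha>\<in>UNIV. fn (pd \<alpha> f) * X (gen (V \<alpha> 0)))"
    using superderivation f unfolding superderivation_def by blast
  then have "q (X (fn f)) = q (\<Sum>\<alpha>\<in>UNIV. fn (pd \<alpha> f) * X (gen (V \<alpha> 0)))"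
    using d f by (simp add: sreq_iff X_dring)
  then show ?thesis
    using f by (simp add: hat_q q_sum q_mult X_dring dring_intros holo_on_pd)
qed

lemma hat_const_mult: "hat (\<phi> (\<lambda>_. c) * x) = \<phi> (\<lambda>_. c) * hat x"
proof -
  have "pd \<alpha> (\<lambda>_::complex^'n. c) = 0" for \<alpha> by (simp add: fun_eq_iff pd_const)
  then have "hat (\<phi> (\<lambda>_. c)) = 0" by (simp add: hat_\<phi> holo_on_const)
  then show ?thesis by (simp add: hat_mult[OF par_\<phi>])
qed

lemma par_hat: "par i x \<Longrightarrow> par (e + i) (hat x)"
proof -
  assume "par i x"
  then obtain a where a: "a \<in> dring M" "has_parity i a" "q a = x" by (auto simp: par_def)
  obtain b where "b \<in> dring M" "has_parity (e + i) b" "X a \<approx>\<^bsub>M\<^esub> b"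
    using superderivation a unfolding superderivation_def by blast
  then show ?thesis using a by (auto simp: par_def hat_q sreq_iff X_dring)
qed

lemma hat_dd: "hat (dd x) = dd (hat x)"
proof -
  have "dd x = q (dx M (rep x))" by (simp add: dd_def q_dx)
  then have "hat (dd x) = q (X (dx M (rep x)))" by (simp add: hat_q dx_dring)
  also have "\<dots> = q (dx M (X (rep x)))"
    using commute_dx[of "rep x"] by (simp add: sreq_iff X_dring dx_dring)
  also have "\<dots> = dd (hat x)" by (simp add: hat_def dd_q q_dx X_dring)
  finally show ?thesis .
qed

lemma pos_hat: "pos x \<Longrightarrow> pos (hat x)"
proof -
  assume "pos x"
  then obtain a where a: "a \<in> dring M" "positive_degree a" "q a = x" by (auto simp: pos_def)
  have word: "pos (hat (q (mon w)))" if "super_degree (Word w) > 0" for w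
    using that
  proof (induction w)
    case (Cons g w)
    have eq: "hat (q (mon (g # w))) = hat (\<g> g) * q (mon w) + parity_sign (e * gdeg g) (\<g> g * hat (q (mon w)))"
      using hat_mult[OF par_gen[of g], of "q (mon w)"] by (simp add: mon_Cons[of g w] q_mult)
    show ?case
    proof (cases "is_odd g")
      case True
      then show ?thesis unfolding eq
        by (intro pos_add pos_parity_sign pos_mult_left pos_gen) (simp_all add: hat_q pos_X)
    next
      case False
      then have "super_degree (Word w) > 0" using Cons.prems by (simp add: super_degree_Cons)
      then show ?thesis unfolding eq
        by (intro pos_add pos_parity_sign pos_mult_right pos_mon Cons.IH)
    qed
  qed simp
  have "pos (hat (q a))" using open_chart a(1)
  proof (induction rule: dring_induct)
    case (single w f)
    then have "super_degree w > 0" using a(2) by (auto simp: positive_degree_def)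
    with word[of "letters w"] pos_mon[of "letters w"] show ?case
      by (simp add: q_single single hat_mult[OF par_\<phi>] pos_add pos_mult_right)
  qed (simp_all add: q_add hat_add pos_add)
  then show ?thesis by (simp add: a)
qed

end

locale superderivation_pair =
  calibrated_frobenius M + X: superderivation_on_chart M e X + Y: superderivation_on_chart M e' Y
  for M :: "'n::finite frobenius_data" and e X e' Y
begin

definition comm :: "'n tau_algebra \<Rightarrow> 'n tau_algebra" where
  "comm x = X.hat (Y.hat x) - parity_sign (e * e') (Y.hat (X.hat x))"

lemma comm_add: "comm (x + y) = comm x + comm y"
  by (simp add: comm_def X.hat_add Y.hat_add parity_sign_add)

lemma comm_zero [simp]: "comm 0 = 0"
  by (simp add: comm_def)

lemma comm_sum: "comm (sum f I) = (\<Sum>i\<in>I. comm (f i))"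
  by (induction I rule: infinite_finite_induct) (simp_all add: comm_add)

lemma comm_dd: "comm (dd x) = dd (comm x)"
  by (simp add: comm_def X.hat_dd Y.hat_dd dd_diff dd_parity_sign)

lemma comm_component: "component M (comm x) = comm x"
proof -
  have neg: "component M (- x) = - component M x" for x :: "'n tau_algebra"
    using component_add[of M "- x" x] by (simp add: eq_neg_iff_add_eq_0)
  then have "component M (x - y) = component M x - component M y" for x y :: "'n tau_algebra"
    using component_add[of M x "- y"] by simp
  with neg show ?thesis by (simp add: comm_def parity_sign_def)
qed

text \<open>The terms with one derivation on each factor cancel in the graded commutator, which is
  therefore a derivation. Restricted to even x that it kills, this pulls coefficient functions and
  v_x out of it without signs.\<close>

lemma comm_mult_even:
  assumes "par 0 x" "comm x = 0"
  shows "comm (x * y) = x * comm y"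
proof -
  have pX: "par (e + 0) (X.hat x)" and pY: "par (e' + 0) (Y.hat x)"
    using X.par_hat[OF assms(1)] Y.par_hat[OF assms(1)] by auto
  have XY: "X.hat (Y.hat (x * y)) = X.hat (Y.hat x) * y + parity_sign (e * e') (Y.hat x * X.hat y)
      + (X.hat x * Y.hat y + x * X.hat (Y.hat y))"
    using assms(1) pY by (simp add: Y.hat_mult[OF assms(1)] X.hat_add X.hat_mult[OF pY] X.hat_mult[OF assms(1)])
  have YX: "Y.hat (X.hat (x * y)) = Y.hat (X.hat x) * y + parity_sign (e * e') (X.hat x * Y.hat y)
      + (Y.hat x * X.hat y + x * Y.hat (X.hat y))"
    using assms(1) pX by (simp add: X.hat_mult[OF assms(1)] Y.hat_add Y.hat_mult[OF pX] Y.hat_mult[OF assms(1)] mult.commute[of e])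
  have "comm (x * y) = comm x * y + x * comm y"
    unfolding comm_def XY YX
    by (simp add: parity_sign_add parity_sign_mult_left parity_sign_mult_right algebra_simps)
  then show ?thesis by (simp add: assms(2))
qed

lemma comm_const_mult: "comm (\<phi> (\<lambda>_. c) * x) = \<phi> (\<lambda>_. c) * comm x"
  by (simp add: comm_def X.hat_const_mult Y.hat_const_mult parity_sign_mult_right right_diff_distrib)

lemma pos_comm: "pos x \<Longrightarrow> pos (comm x)"
  unfolding comm_def by (intro pos_diff pos_parity_sign X.pos_hat Y.pos_hat)

text \<open>After applying the chain rule twice, the terms with second derivatives of f cancel by
  \<open>pd_commute\<close>; the rest is the commutator on the coordinates.\<close>

lemma comm_fn:
  assumes "\<And>\<alpha>. comm (\<g> (V \<alpha> 0)) = 0" "holo_on (chart M) f"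
  shows "comm (\<phi> f) = 0"
proof -
  let ?v = "\<lambda>\<alpha>. \<g> (V \<alpha> 0)"
  have h: "holo_on (chart M) (pd \<alpha> f)" for \<alpha> using assms(2) by (rule holo_on_pd)
  have p: "par 0 (?v \<alpha>)" for \<alpha> using par_gen[of "V \<alpha> 0"] by simp
  have sw: "X.hat (?v \<beta>) * Y.hat (?v \<alpha>) = parity_sign (e * e') (Y.hat (?v \<alpha>) * X.hat (?v \<beta>))" for \<alpha> \<beta>
    using supercommute[OF X.par_hat[OF p] Y.par_hat[OF p]] by simp
  have XY: "X.hat (Y.hat (\<phi> f)) = (\<Sum>\<alpha>\<in>UNIV. \<Sum>\<beta>\<in>UNIV. \<phi> (pd \<beta> (pd \<alpha> f)) * (X.hat (?v \<beta>) * Y.hat (?v \<alpha>)))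
      + (\<Sum>\<alpha>\<in>UNIV. \<phi> (pd \<alpha> f) * X.hat (Y.hat (?v \<alpha>)))"
    by (simp add: Y.hat_\<phi>[OF assms(2)] X.hat_sum X.hat_mult[OF par_\<phi>] X.hat_\<phi>[OF h] sum.distrib sum_distrib_right mult.assoc)
  have YX: "Y.hat (X.hat (\<phi> f)) = (\<Sum>\<alpha>\<in>UNIV. \<Sum>\<beta>\<in>UNIV. \<phi> (pd \<beta> (pd \<alpha> f)) * (Y.hat (?v \<beta>) * X.hat (?v \<alpha>)))
      + (\<Sum>\<alpha>\<in>UNIV. \<phi> (pd \<alpha> f) * Y.hat (X.hat (?v \<alpha>)))"
    by (simp add: X.hat_\<phi>[OF assms(2)] Y.hat_sum Y.hat_mult[OF par_\<phi>] Y.hat_\<phi>[OF h] sum.distrib sum_distrib_right mult.assoc)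
  have "(\<Sum>\<alpha>\<in>UNIV. \<Sum>\<beta>\<in>UNIV. \<phi> (pd \<beta> (pd \<alpha> f)) * (X.hat (?v \<beta>) * Y.hat (?v \<alpha>)))
      = (\<Sum>\<beta>\<in>UNIV. \<Sum>\<alpha>\<in>UNIV. \<phi> (pd \<alpha> (pd \<beta> f)) * (X.hat (?v \<beta>) * Y.hat (?v \<alpha>)))"
  proof (subst sum.swap, intro sum.cong refl)
    fix \<alpha> \<beta>
    have "\<phi> (pd \<beta> (pd \<alpha> f)) = \<phi> (pd \<alpha> (pd \<beta> f))"
      by (rule \<phi>_cong) (rule pd_commute[OF open_chart assms(2)])
    then show "\<phi> (pd \<beta> (pd \<alpha> f)) * (X.hat (?v \<beta>) * Y.hat (?v \<alpha>)) = \<phi> (pd \<alpha> (pd \<beta> f)) * (X.hat (?v \<beta>) * Y.hat (?v \<alpha>))"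
      by simp
  qed
  then have "comm (\<phi> f) = (\<Sum>\<alpha>\<in>UNIV. \<phi> (pd \<alpha> f) * comm (?v \<alpha>))"
    unfolding comm_def XY YX sw
    by (simp add: parity_sign_add parity_sign_sum parity_sign_mult_right right_diff_distrib sum_subtractf)
  then show ?thesis by (simp add: assms(1))
qed

lemma comm_V:
  assumes "\<And>\<alpha>. comm (\<g> (Ff \<alpha> 0)) = 0"
  shows "comm (\<g> (V \<beta> 0)) = 0"
proof -
  have V: "\<g> (V \<gamma> 0) = \<phi> (\<lambda>x. x $ \<gamma>)" for \<gamma> :: 'n
    using relations.coordinate[of \<gamma> M] by (simp add: q_eq_iff holo_on_coord)
  have "dd (\<g> (Ff \<alpha> 0)) = lower (\<lambda>\<gamma>. \<g> (V \<gamma> 0)) \<alpha>" for \<alpha>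
  proof -
    have "dd (\<g> (Ff \<alpha> 0)) = \<phi> (\<lambda>x. \<Sum>\<gamma>\<in>UNIV. eta M \<alpha> \<gamma> * x $ \<gamma>)"
      by simp (rule \<phi>_cong, rule hfun_0)
    then show ?thesis by (simp add: lower_def V \<phi>_lincomb[OF holo_on_coord])
  qed
  then have "comm (lower (\<lambda>\<gamma>. \<g> (V \<gamma> 0)) \<alpha>) = 0" for \<alpha>
    using comm_dd[of "\<g> (Ff \<alpha> 0)"] assms by simp
  then have "comm (raise (lower (\<lambda>\<gamma>. \<g> (V \<gamma> 0))) \<beta>) = 0"
    unfolding raise_def comm_sum comm_const_mult by simp
  then show ?thesis by (simp add: raise_lower)
qed

lemma comm_sig_Suc:
  assumes V: "\<And>\<alpha>. comm (\<g> (V \<alpha> 0)) = 0" and s: "\<And>\<alpha>. comm (sig k \<alpha>) = 0"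
  shows "comm (sig (Suc k) \<alpha>) = 0"
proof (rule no_odd_constants)
  show "pos (comm (sig (Suc k) \<alpha>))"
    by (rule pos_comm) (simp add: sig_def pos_gen)
  have sig1: "comm (sig1 k \<beta>) = 0" for \<beta>
    using comm_dd[of "sig k \<beta>"] s fun_cong[OF ddv_sig] by simp
  have V1: "comm (vx \<beta>) = 0" for \<beta>
    using comm_dd[of "\<g> (V _ 0)"] V by (simp add: vx_def comm_sum comm_const_mult)
  have U: "comm (Uop (sig1 k) \<alpha>) = 0"
    by (simp add: Uop_def comm_sum comm_mult_even[OF par_\<phi> comm_fn[OF V holo_Ufun]] sig1)
  have "comm (star vx (Nm (sig k)) \<alpha>) = 0"
    by (simp add: star_def comm_sum comm_mult_even[OF par_\<phi> comm_fn[OF V holo_cup]]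
        comm_mult_even[OF spec[OF parv_vx] V1] scal_def comm_const_mult s)
  with U have "comm (sig1 (Suc k) \<alpha>) = 0"
    by (simp add: sig_recursion comm_add)
  then show "dd (comm (sig (Suc k) \<alpha>)) = 0"
    using comm_dd[of "sig (Suc k) \<alpha>"] fun_cong[OF ddv_sig] by simp
qed

lemma comm_sig:
  assumes "\<And>\<alpha>. comm (\<g> (V \<alpha> 0)) = 0" "\<And>\<alpha>. comm (sig 0 \<alpha>) = 0"
  shows "comm (sig k \<alpha>) = 0"
  by (induction k arbitrary: \<alpha>) (use assms comm_sig_Suc in blast)+

text \<open>The x-derivative of Phi is the gradient of h paired with w_n, and the commutator kills
  both; positivity then allows integration.\<close>

lemma comm_Ph:
  assumes V: "\<And>\<alpha>. comm (\<g> (V \<alpha> 0)) = 0" and s: "\<And>\<alpha>. comm (sig n \<alpha>) = 0"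
  shows "comm (\<g> (Ph \<alpha> p n)) = 0"
proof (rule no_odd_constants)
  show "pos (comm (\<g> (Ph \<alpha> p n)))"
    by (rule pos_comm) (simp add: pos_gen)
  have sig1: "comm (sig1 n \<beta>) = 0" for \<beta>
    using comm_dd[of "sig n \<beta>"] s fun_cong[OF ddv_sig] by simp
  have "comm (pairing (dh \<alpha> p) (sig1 n)) = 0"
    by (simp add: pairing_def dh_def comm_sum comm_const_mult
        comm_mult_even[OF par_\<phi> comm_fn[OF V holo_on_pd[OF holo_hfun]]] sig1)
  then show "dd (comm (\<g> (Ph \<alpha> p n))) = 0"
    unfolding comm_dd[symmetric] dd_gen q_dx_Ph .
qed

end

section \<open>Arbitrary solutions of the flow equations\<close>

locale super_tau_flows = calibrated_frobenius M for M :: "'n::finite frobenius_data" +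
  fixes T :: "'n \<Rightarrow> nat \<Rightarrow> 'n superpoly \<Rightarrow> 'n superpoly" and S :: "nat \<Rightarrow> 'n superpoly \<Rightarrow> 'n superpoly"
  assumes super_flows: "super_flows M T S"
begin

lemma superderivation_T: "superderivation M 0 (T \<beta> r)" and superderivation_S: "superderivation M (Suc 0) (S k)"
  using super_flows by (simp_all add: super_flows_def)

lemma T_dring: "a \<in> dring M \<Longrightarrow> T \<beta> r a \<in> dring M" and S_dring: "a \<in> dring M \<Longrightarrow> S k a \<in> dring M"
  using superderivation_T[of \<beta> r] superderivation_S[of k] by (simp_all add: superderivation_def)

lemma T_dx: "a \<in> dring M \<Longrightarrow> T \<beta> r (dx M a) \<approx>\<^bsub>M\<^esub> dx M (T \<beta> r a)"
  and S_dx: "a \<in> dring M \<Longrightarrow> S k (dx M a) \<approx>\<^bsub>M\<^esub> dx M (S k a)"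
proof -
  have "\<forall>\<beta> r. \<forall>a\<in>dring M. T \<beta> r (dx M a) \<approx>\<^bsub>M\<^esub> dx M (T \<beta> r a)"
    using super_flows unfolding super_flows_def by (elim conjE)
  then show "a \<in> dring M \<Longrightarrow> T \<beta> r (dx M a) \<approx>\<^bsub>M\<^esub> dx M (T \<beta> r a)" by simp
  have "\<forall>k. \<forall>a\<in>dring M. S k (dx M a) \<approx>\<^bsub>M\<^esub> dx M (S k a)"
    using super_flows unfolding super_flows_def by (elim conjE)
  then show "a \<in> dring M \<Longrightarrow> S k (dx M a) \<approx>\<^bsub>M\<^esub> dx M (S k a)" by simp
qed

lemma q_T_gens:
  "q (T \<beta> r (gen (V \<alpha> 0))) = raise (star (dh \<beta> r) vx) \<alpha>"
  "q (T \<beta> r (gen (Ff \<alpha> p))) = \<phi> (Omega M \<alpha> p \<beta> r)"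
  "q (T \<beta> r (gen (Ph \<alpha> p n))) = q (S n (fn (Omega M \<alpha> p \<beta> r)))"
proof -
  have "\<forall>\<alpha> \<beta> r. T \<beta> r (gen (V \<alpha> 0)) \<approx>\<^bsub>M\<^esub> (\<Sum>\<gamma>\<in>UNIV. \<Sum>\<kappa>\<in>UNIV. fn (\<lambda>x. \<eta>I \<alpha> \<gamma> * pd \<kappa> (pd \<gamma> (hfun M \<beta> (Suc r))) x) * gen (V \<kappa> 1))"
    using super_flows unfolding super_flows_def by (elim conjE)
  then have "T \<beta> r (gen (V \<alpha> 0)) \<approx>\<^bsub>M\<^esub> (\<Sum>\<gamma>\<in>UNIV. \<Sum>\<kappa>\<in>UNIV. fn (\<lambda>x. \<eta>I \<alpha> \<gamma> * pd \<kappa> (pd \<gamma> (hfun M \<beta> (Suc r))) x) * gen (V \<kappa> 1))"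
    by blast
  then show "q (T \<beta> r (gen (V \<alpha> 0))) = raise (star (dh \<beta> r) vx) \<alpha>"
    unfolding sreq_iff[OF T_dring[OF mon_dring] T_V_dring] q_T_V .
  have "\<forall>\<alpha> p \<beta> r. T \<beta> r (gen (Ff \<alpha> p)) \<approx>\<^bsub>M\<^esub> fn (Omega M \<alpha> p \<beta> r)"
    using super_flows unfolding super_flows_def by (elim conjE)
  then show "q (T \<beta> r (gen (Ff \<alpha> p))) = \<phi> (Omega M \<alpha> p \<beta> r)"
    by (simp add: sreq_iff T_dring holo_Omega)
  have "\<forall>\<alpha> p n \<beta> r. T \<beta> r (gen (Ph \<alpha> p n)) \<approx>\<^bsub>M\<^esub> S n (fn (Omega M \<alpha> p \<beta> r))"
    using super_flows unfolding super_flows_def by (elim conjE)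
  then show "q (T \<beta> r (gen (Ph \<alpha> p n))) = q (S n (fn (Omega M \<alpha> p \<beta> r)))"
    by (simp add: sreq_iff T_dring S_dring holo_Omega)
qed

lemma q_S_gens:
  "q (S n (gen (Ff \<alpha> p))) = \<g> (Ph \<alpha> p n)"
  "q (S k (gen (Ph \<alpha> p n))) = pairing (dh \<alpha> p) (Zval k n)"
proof -
  have "\<forall>\<alpha> p n. S n (gen (Ff \<alpha> p)) \<approx>\<^bsub>M\<^esub> gen (Ph \<alpha> p n)"
    using super_flows unfolding super_flows_def by (elim conjE)
  moreover have "\<forall>\<alpha> p n k. S k (gen (Ph \<alpha> p n)) \<approx>\<^bsub>M\<^esub> Delta M \<alpha> p k n"
    using super_flows unfolding super_flows_def by (elim conjE)
  ultimately show "q (S n (gen (Ff \<alpha> p))) = \<g> (Ph \<alpha> p n)" "q (S k (gen (Ph \<alpha> p n))) = pairing (dh \<alpha> p) (Zval k n)"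
    by (simp_all add: sreq_iff S_dring Delta_dring q_Delta)
qed

text \<open>Through this identification sigma inherits the antisymmetric tau-flows of Phi and is
  itself a tau-derivative of f.\<close>

lemma sig_Ph: "sig k \<alpha> = \<g> (Ph \<alpha> 0 k)"
  using relations.Phi_zero[of \<alpha> k M] q_eq_iff[of "gen (Ph \<alpha> 0 k)" "gen (Sg \<alpha> k 0)"] by (simp add: sig_def)

lemma pos_T: "is_odd g \<Longrightarrow> pos (q (T \<beta> r (gen g)))"
proof -
  assume g: "is_odd g"
  have "has_parity 1 (gen g)" using has_parity_mon[of "[g]"] g by (simp add: super_degree_Cons)
  then obtain b where "b \<in> dring M" "has_parity (0 + 1) b" "T \<beta> r (gen g) \<approx>\<^bsub>M\<^esub> b"
    using superderivation_T[of \<beta> r] mon_dring unfolding superderivation_def by blast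
  then have "par 1 (q (T \<beta> r (gen g)))" by (auto simp: par_def sreq_iff T_dring)
  then show ?thesis by (rule par_odd_pos) simp
qed

text \<open>Parity does not help for an odd flow. On Phi positivity is visible in Delta, whose
  summands contain w; it passes to sigma as Phi_{alpha,0}, and to the jets of sigma by commuting
  with the x-derivative.\<close>

lemma pos_S: "is_odd g \<Longrightarrow> pos (q (S k (gen g)))"
proof -
  assume g: "is_odd g"
  have Ph: "pos (q (S k (gen (Ph \<alpha> p n))))" for \<alpha> p n
    unfolding q_S_gens pairing_def by (intro pos_sum pos_mult_right) (rule pos_Zval)
  have Sg: "pos (q (S k (gen (Sg \<alpha> n s))))" for \<alpha> n s
  proof (induction s)
    case 0
    have "S k (gen (Sg \<alpha> n 0)) \<approx>\<^bsub>M\<^esub> S k (gen (Ph \<alpha> 0 n))"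
    proof -
      have "gen (Sg \<alpha> n 0) \<approx>\<^bsub>M\<^esub> gen (Ph \<alpha> 0 n)"
        using sig_Ph[of n \<alpha>] by (simp add: sreq_iff sig_def)
      then show ?thesis using superderivation_S[of k] mon_dring unfolding superderivation_def by blast
    qed
    then show ?case using Ph[of \<alpha> 0 n] by (simp add: sreq_iff S_dring)
  next
    case (Suc s)
    have "dd (\<g> (Sg \<alpha> n s)) = \<g> (Sg \<alpha> n (Suc s))" by simp
    then have "gen (Sg \<alpha> n (Suc s)) \<approx>\<^bsub>M\<^esub> dx M (gen (Sg \<alpha> n s))"
      by (simp add: sreq_iff dx_dring q_dx)
    then have "S k (gen (Sg \<alpha> n (Suc s))) \<approx>\<^bsub>M\<^esub> S k (dx M (gen (Sg \<alpha> n s)))"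
      using superderivation_S[of k] mon_dring dx_dring[OF mon_dring] unfolding superderivation_def by blast
    then have "q (S k (gen (Sg \<alpha> n (Suc s)))) = q (dx M (S k (gen (Sg \<alpha> n s))))"
      using S_dx[OF mon_dring, of k "[Sg \<alpha> n s]"] by (simp add: sreq_iff S_dring dx_dring)
    then show ?case
      using pos_dd[OF Suc] by (simp add: dd_q S_dring q_dx)
  qed
  show ?thesis using g Ph Sg by (cases g) auto
qed

lemma chart_derivation_T: "superderivation_on_chart M 0 (T \<beta> r)"
  by unfold_locales (auto intro: superderivation_T T_dx pos_T)

lemma chart_derivation_S: "superderivation_on_chart M (Suc 0) (S k)"
  by unfold_locales (auto intro: superderivation_S S_dx pos_S)

sublocale T: superderivation_on_chart M 0 "T \<beta> r" for \<beta> r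
  by (rule chart_derivation_T)

sublocale S: superderivation_on_chart M "Suc 0" "S k" for k
  by (rule chart_derivation_S)

sublocale TT: superderivation_pair M 0 "T \<beta> r" 0 "T \<beta>' r'" for \<beta> r \<beta>' r'
  by unfold_locales

sublocale TS: superderivation_pair M 0 "T \<beta> r" "Suc 0" "S k" for \<beta> r k
  by unfold_locales

sublocale SS: superderivation_pair M "Suc 0" "S k" "Suc 0" "S l" for k l
  by unfold_locales

text \<open>A given T and the constructed flow \<open>dT \<beta> r\<close> agree on the coordinates,
  hence on functions, so the computation for the latter applies.\<close>

lemma hat_T_Omega: "T.hat \<beta> r (\<phi> (Omega M \<alpha> p \<beta>' r')) = pairing (star (dh \<alpha> p) (dh \<beta>' r')) (star (dh \<beta> r) vx)"
proof -
  interpret F: tau_flow M 0 "dT \<beta> r" "\<lambda>k. star (dh \<beta> r) (sig1 k)" by (rule tau_flow_T)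
  have "T.hat \<beta> r (\<phi> (Omega M \<alpha> p \<beta>' r')) = F.dfn (Omega M \<alpha> p \<beta>' r')"
    unfolding T.hat_\<phi>[OF holo_Omega] F.dfn_def
    by (simp add: T.hat_q q_T_gens) (simp add: dT_def flow_values_def)
  then show ?thesis by (simp only: F.dfn_Omega tau_flow_T(2))
qed

lemma TT_Ff: "TT.comm \<beta> r \<beta>' r' (\<g> (Ff \<alpha> p)) = 0"
proof -
  have "star (dh \<beta>' r') (star (dh \<beta> r) vx) = star (dh \<beta> r) (star (dh \<beta>' r') vx)"
    by (simp only: star_assoc[symmetric] star_commute_even[OF parv_dh parv_dh, of \<beta>' r'])
  then show ?thesis
    by (simp add: TT.comm_def T.hat_q q_T_gens hat_T_Omega pairing_star)
qed

lemma Zval_antisym: "Zval k n = - Zval n k"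
  by (cases k n rule: linorder_cases) (simp_all add: Zval_def)

lemma hat_S_Ph: "S.hat k (\<g> (Ph \<alpha> p n)) = - S.hat n (\<g> (Ph \<alpha> p k))"
  by (simp add: S.hat_q q_S_gens Zval_antisym[of k n] pairing_def sum_negf)

lemma hat_S_Ff: "S.hat k (\<g> (Ff \<alpha> p)) = \<g> (Ph \<alpha> p k)"
  by (simp add: S.hat_q q_S_gens)

lemma hat_T_Ff: "T.hat \<beta> r (\<g> (Ff \<alpha> p)) = \<phi> (Omega M \<alpha> p \<beta> r)"
  by (simp add: T.hat_q q_T_gens)

text \<open>The prescription of the t-flow of Phi as the tau-flow of Omega, with Phi and Omega read
  as the tau- and t-derivatives of f.\<close>

lemma TS_Ff: "TS.comm \<beta> r k (\<g> (Ff \<alpha> p)) = 0"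
proof -
  have "T.hat \<beta> r (\<g> (Ph \<alpha> p k)) = S.hat k (\<phi> (Omega M \<alpha> p \<beta> r))"
    unfolding T.hat_q[OF mon_dring] q_T_gens by (rule S.hat_q[symmetric]) (simp add: holo_Omega)
  then show ?thesis by (simp add: TS.comm_def hat_S_Ff hat_T_Ff)
qed

lemma SS_Ff: "SS.comm k l (\<g> (Ff \<alpha> p)) = 0"
  by (simp add: SS.comm_def hat_S_Ff hat_S_Ph[of k _ _ l])

lemma TT_V: "TT.comm \<beta> r \<beta>' r' (\<g> (V \<alpha> 0)) = 0" and TS_V: "TS.comm \<beta> r k (\<g> (V \<alpha> 0)) = 0"
  and SS_V: "SS.comm k l (\<g> (V \<alpha> 0)) = 0"
  by (rule TT.comm_V TS.comm_V SS.comm_V, rule TT_Ff TS_Ff SS_Ff)+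

lemma TS_apply: "TS.comm \<beta> r k x = T.hat \<beta> r (S.hat k x) - S.hat k (T.hat \<beta> r x)"
  by (simp add: TS.comm_def)

lemma SS_apply: "SS.comm k l x = S.hat k (S.hat l x) + S.hat l (S.hat k x)"
  by (simp add: SS.comm_def)

lemma sig_hat: "sig k \<alpha> = S.hat k (\<g> (Ff \<alpha> 0))"
  by (simp add: sig_Ph hat_S_Ff)

lemma hat_S_sig: "S.hat k (sig n \<alpha>) = - S.hat n (sig k \<alpha>)"
  unfolding sig_Ph by (rule hat_S_Ph)

text \<open>With f = f_{alpha,0}, sigma_k = S_k f and T sigma_k = S_k Omega. The term T S_m sigma_k
  is antisymmetric in k and m by the flows of Phi, and S_m S_k Omega because odd flows already
  anticommute on functions of v.\<close>

lemma TS_sig_antisym: "TS.comm \<beta> r m (sig k \<alpha>) = - TS.comm \<beta> r k (sig m \<alpha>)"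
proof -
  let ?O = "\<phi> (Omega M \<alpha> 0 \<beta> r)"
  have t: "T.hat \<beta> r (sig k \<alpha>) = S.hat k ?O" for k
    using TS_Ff[of \<beta> r k \<alpha> 0] by (simp add: TS_apply sig_hat hat_T_Ff)
  have "SS.comm m k ?O = 0" by (rule SS.comm_fn[OF SS_V holo_Omega])
  then have "S.hat m (S.hat k ?O) = - S.hat k (S.hat m ?O)" by (simp add: SS_apply eq_neg_iff_add_eq_0)
  then show ?thesis
    unfolding TS_apply t hat_S_sig[of m k] T.hat_uminus by simp
qed

text \<open>Antisymmetry gives the case k = m = 0 after division by 2. The recursion extends it from
  sigma_0 to all sigma_m for S_0, antisymmetry exchanges the two indices, and the recursion is
  applied once more.\<close>

lemma TS_sig: "TS.comm \<beta> r m (sig k \<alpha>) = 0"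
proof -
  have "TS.comm \<beta> r 0 (sig 0 \<alpha>) = 0" for \<alpha>
  proof (rule double_zero[OF TS.comm_component])
    show "TS.comm \<beta> r 0 (sig 0 \<alpha>) + TS.comm \<beta> r 0 (sig 0 \<alpha>) = 0"
      using TS_sig_antisym[of \<beta> r 0 0 \<alpha>] by (simp add: eq_neg_iff_add_eq_0)
  qed
  then have "TS.comm \<beta> r 0 (sig m \<alpha>) = 0" for m \<alpha> by (rule TS.comm_sig[OF TS_V])
  then have "TS.comm \<beta> r m (sig 0 \<alpha>) = 0" for m \<alpha> by (simp add: TS_sig_antisym[of _ _ m 0])
  then show ?thesis by (rule TS.comm_sig[OF TS_V])
qed

lemma TS_Ph: "TS.comm \<beta> r m (\<g> (Ph \<alpha> p n)) = 0"
  by (rule TS.comm_Ph[OF TS_V TS_sig])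

text \<open>As Phi^n = S_n f and t-flows commute with S_n on f and on Omega, the commutator of two
  t-flows on Phi is S_n of their commutator on f.\<close>

lemma TT_Ph: "TT.comm \<beta> r \<beta>' r' (\<g> (Ph \<alpha> p n)) = 0"
proof -
  have "T.hat \<beta> r (T.hat \<beta>' r' (\<g> (Ph \<alpha> p n))) = S.hat n (T.hat \<beta> r (T.hat \<beta>' r' (\<g> (Ff \<alpha> p))))" for \<beta> \<beta>' :: 'n and r r' :: nat
  proof -
    have "TS.comm \<beta> r n (\<phi> (Omega M \<alpha> p \<beta>' r')) = 0" by (rule TS.comm_fn[OF TS_V holo_Omega])
    moreover have "T.hat \<beta>' r' (\<g> (Ph \<alpha> p n)) = S.hat n (T.hat \<beta>' r' (\<g> (Ff \<alpha> p)))"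
      using TS_Ff[of \<beta>' r' n \<alpha> p] by (simp add: TS_apply hat_S_Ff)
    ultimately show ?thesis
      by (simp add: TS_apply hat_T_Ff)
  qed
  then show ?thesis using TT_Ff[of \<beta> r \<beta>' r' \<alpha> p] by (simp add: TT.comm_def)
qed

lemma TT_sig: "TT.comm \<beta> r \<beta>' r' (sig k \<alpha>) = 0"
  unfolding sig_Ph by (rule TT_Ph)

text \<open>With A k l m = S_k S_l sigma_m, the anticommutator is symmetric in k and l, while A is
  antisymmetric in l and m. These symmetries settle sigma_0 for the flow pairs (0,0), (k,0) and
  (k,l) in turn; each time the recursion extends the result to all sigma_m before the next
  pair.\<close>

lemma SS_sig: "SS.comm k l (sig m \<alpha>) = 0"
proof -
  define A where "A k l m \<alpha> = S.hat k (S.hat l (sig m \<alpha>))" for k l m \<alpha>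
  have comm: "SS.comm k l (sig m \<alpha>) = A k l m \<alpha> + A l k m \<alpha>" for k l m \<alpha>
    by (simp add: SS_apply A_def)
  have anti: "A k l m \<alpha> = - A k m l \<alpha>" for k l m \<alpha>
    unfolding A_def hat_S_sig[of l m] S.hat_uminus ..
  have comp: "component M (A k l m \<alpha>) = A k l m \<alpha>" for k l m \<alpha>
    by (simp add: A_def)
  have self: "A k l l \<alpha> = 0" for k l \<alpha>
    by (rule double_zero[OF comp]) (use anti[of k l l \<alpha>] in \<open>simp add: eq_neg_iff_add_eq_0\<close>)
  have c00: "SS.comm 0 0 (sig m \<alpha>) = 0" for m \<alpha>
    by (rule SS.comm_sig[OF SS_V]) (simp add: comm self)
  have A00: "A 0 0 m \<alpha> = 0" for m \<alpha>
    by (rule double_zero[OF comp]) (use c00[of m \<alpha>] in \<open>simp add: comm\<close>)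
  have ck0: "SS.comm k 0 (sig m \<alpha>) = 0" for k m \<alpha>
    by (rule SS.comm_sig[OF SS_V]) (simp add: comm self anti[of 0 _ 0] A00)
  have "SS.comm k l (sig 0 \<alpha>) = 0" for k l \<alpha>
  proof -
    have "A k 0 l \<alpha> = - A 0 k l \<alpha>" "A l 0 k \<alpha> = - A 0 l k \<alpha>"
      using ck0[of k l \<alpha>] ck0[of l k \<alpha>] by (simp_all add: comm eq_neg_iff_add_eq_0)
    \<comment> \<open>Moving the index 0 to the middle and then to the front turns the
      anticommutator into A 0 k l + A 0 l k, which vanishes by antisymmetry.\<close>
    then show ?thesis by (simp add: comm anti[of _ _ 0] anti[of 0 l k])
  qed
  then show ?thesis by (rule SS.comm_sig[OF SS_V])
qed

lemma SS_Ph: "SS.comm k l (\<g> (Ph \<alpha> p n)) = 0"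
  by (rule SS.comm_Ph[OF SS_V SS_sig])

theorem flows_supercommute: "flows_supercommute M T S"
  unfolding flows_supercommute_def
proof (intro ballI)
  fix u :: "'n superpoly" assume u: "u \<in> unknowns"
  then have d: "u \<in> dring M" by (auto simp: unknowns_def)
  have z: "TT.comm \<alpha> p \<beta> r (q u) = 0" "TS.comm \<beta> r k (q u) = 0" "SS.comm k l (q u) = 0" for \<alpha> p \<beta> r k l
    using u by (auto simp: unknowns_def TT_V TT_sig[unfolded sig_def] TT_Ff TT_Ph
        TS_V TS_sig[unfolded sig_def] TS_Ff TS_Ph SS_V SS_sig[unfolded sig_def] SS_Ff SS_Ph)
  show "(\<forall>\<alpha> p \<beta> q. T \<alpha> p (T \<beta> q u) \<approx>\<^bsub>M\<^esub> T \<beta> q (T \<alpha> p u)) \<and>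
        (\<forall>\<beta> q k. T \<beta> q (S k u) \<approx>\<^bsub>M\<^esub> S k (T \<beta> q u)) \<and>
        (\<forall>k l. S k (S l u) \<approx>\<^bsub>M\<^esub> - S l (S k u))"
  proof (intro conjI allI)
    fix \<alpha> p \<beta> r
    show "T \<alpha> p (T \<beta> r u) \<approx>\<^bsub>M\<^esub> T \<beta> r (T \<alpha> p u)"
      using z(1)[of \<alpha> p \<beta> r] d by (simp add: sreq_iff T_dring TT.comm_def T.hat_q)
  next
    fix \<beta> r k
    show "T \<beta> r (S k u) \<approx>\<^bsub>M\<^esub> S k (T \<beta> r u)"
      using z(2)[of \<beta> r k] d by (simp add: sreq_iff T_dring S_dring TS_apply T.hat_q S.hat_q)
  next
    fix k l
    show "S k (S l u) \<approx>\<^bsub>M\<^esub> - S l (S k u)"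
      using z(3)[of k l] d
      by (simp add: sreq_iff S_dring dring_intros SS_apply S.hat_q q_uminus eq_neg_iff_add_eq_0)
  qed
qed

end

theorem theorem4p3:
  fixes M :: "'n::finite frobenius_data"
  assumes "frobenius_manifold M"
    and "calibration M"
    and "two_point_functions M"
  shows "(\<exists>T S. super_flows M T S) \<and>
         (\<forall>T S. super_flows M T S \<longrightarrow> flows_supercommute M T S)"
proof -
  interpret calibrated_frobenius M by (rule calibrated_frobenius.intro) (rule assms)+
  have "flows_supercommute M T S" if "super_flows M T S" for T S
    by (rule super_tau_flows.flows_supercommute)
       (rule super_tau_flows.intro[OF calibrated_frobenius_axioms super_tau_flows_axioms.intro[OF that]])
  with super_flows_exist show ?thesis by blast
qed

end
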